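(* Let $L$ be a self-adjoint positive definite operator in a Hilbert space $\mathcal{H}$. For $\alpha>0$ and $1\le q\le\infty$ the norm of the Besov space $\mathcal{B}^{\alpha}_{\mathcal{H},q}(\sqrt{L})$ is equivalent to $$\|f\|_{\mathcal{H}}+\left(\sum_{j=0}^{\infty}\left(2^{j\alpha}\mathcal{E}(f,2^{j})\right)^{q}\right)^{1/q}$$ (with the standard modification for $q=\infty$).
   Context: "Positive definite" is meant in the sense $\langle Lf,f\rangle\ge 0$ on the domain of $L$; $\sqrt{L}$ is the non-negative square root of $L$. For $\omega>0$ the Paley-Wiener space $\mathbf{PW}_{\omega}(\sqrt{L})$ is the range of the spectral projection of $\sqrt{L}$ corresponding to $[0,\omega]$ (equivalently, the vectors whose spectral Fourier transform, in the direct integral spectral representation of $\sqrt{L}$, has support in $[0,\omega]$). The best approximation functional is $\mathcal{E}(f,\omega)=\inf_{g\in\mathbf{PW}_{\omega}(\sqrt{L})}\|f-g\|_{\mathcal{H}}$. For $r\in\mathbb{N}$, $H^{r}$ is the domain of $(I+L)^{r/2}$ with the graph norm. The Besov space is $\mathcal{B}^{\alpha}_{\mathcal{H},q}(\sqrt{L})=(\mathcal{H},H^{r})^{K}_{\theta,q}$, where $r$ is any natural number with $0<\alpha<r$, $\theta=\alpha/r$, and $(\cdot,\cdot)^{K}_{\theta,q}$ is the real (Peetre $K$-method) interpolation space: with $K(f,t)=\inf\{\|f_0\|_{\mathcal{H}}+t\|f_1\|_{H^r}: f=f_0+f_1\}$, its norm is $\left(\int_0^\infty(t^{-\theta}K(f,t))^q\frac{dt}{t}\right)^{1/q}$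 (supremum for $q=\infty$). Equivalence of norms means two-sided estimates with positive constants independent of $f\in\mathcal{H}$ (both sides being allowed to be $+\infty$). *)

theory Defs
  imports "HOL-Analysis.Analysis"
begin

section \<open>Complex Hilbert spaces\<close>

text \<open>The library has only real inner product spaces. A complex inner product space is one
  whose real inner product is the real part of a Hermitian form, so that norm and topology are
  the library's. The form is linear in its first argument.\<close>

class complex_inner = real_inner +
  fixes scaleC :: "complex \<Rightarrow> 'a \<Rightarrow> 'a" (infixr "*\<^sub>C" 75)
    and cinner :: "'a \<Rightarrow> 'a \<Rightarrow> complex"
  assumes scaleC_add_right: "a *\<^sub>C (x + y) = a *\<^sub>C x + a *\<^sub>C y"
    and scaleC_add_left: "(a + b) *\<^sub>C x = a *\<^sub>C x + b *\<^sub>C x"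
    and scaleC_scaleC: "a *\<^sub>C b *\<^sub>C x = (a * b) *\<^sub>C x"
    and scaleC_of_real: "complex_of_real r *\<^sub>C x = r *\<^sub>R x"
    and cinner_commute: "cinner x y = cnj (cinner y x)"
    and cinner_add_left: "cinner (x + y) z = cinner x z + cinner y z"
    and cinner_scaleC_left: "cinner (a *\<^sub>C x) y = a * cinner x y"
    and Re_cinner: "Re (cinner x y) = inner x y"

class chilbert_space = complex_inner + complete_space


section \<open>Unbounded operators\<close>

text \<open>An operator in \<open>'a\<close> is identified with its graph, so that equality of operators includes
  equality of domains and relational composition is composition on the natural domain.\<close>

type_synonym 'a oper = "('a \<times> 'a) set"

definition linear_oper :: "'a::complex_inner oper \<Rightarrow> bool" where
  "linear_oper T \<longleftrightarrow> single_valued T \<and> (0, 0) \<in> T \<and>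
    (\<forall>x y x' y'. (x, y) \<in> T \<longrightarrow> (x', y') \<in> T \<longrightarrow> (x + x', y + y') \<in> T) \<and>
    (\<forall>a x y. (x, y) \<in> T \<longrightarrow> (a *\<^sub>C x, a *\<^sub>C y) \<in> T)"

definition oper_apply :: "'a oper \<Rightarrow> 'a \<Rightarrow> 'a" where
  "oper_apply T x = (THE y. (x, y) \<in> T)"

definition adjoint_oper :: "'a::complex_inner oper \<Rightarrow> 'a oper" where
  "adjoint_oper T = {(y, z). \<forall>(x, w) \<in> T. cinner w y = cinner x z}"

definition self_adjoint :: "'a::complex_inner oper \<Rightarrow> bool" where
  "self_adjoint T \<longleftrightarrow> linear_oper T \<and> closure (Domain T) = UNIV \<and> adjoint_oper T = T"

definition positive_oper :: "'a::complex_inner oper \<Rightarrow> bool" where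
  "positive_oper T \<longleftrightarrow> (\<forall>(f, g) \<in> T. cinner g f \<in> \<real>\<^sub>\<ge>\<^sub>0)"

definition sqrt_oper :: "'a::complex_inner oper \<Rightarrow> 'a oper" where
  "sqrt_oper T = (THE S. self_adjoint S \<and> positive_oper S \<and> S O S = T)"


section \<open>Spectral measures and functional calculus\<close>

definition orth_projection :: "('a::complex_inner \<Rightarrow> 'a) \<Rightarrow> bool" where
  "orth_projection P \<longleftrightarrow>
    (\<forall>x y. P (x + y) = P x + P y) \<and> (\<forall>a x. P (a *\<^sub>C x) = a *\<^sub>C P x) \<and>
    (\<forall>x. P (P x) = P x) \<and> (\<forall>x y. cinner (P x) y = cinner x (P y))"

definition projection_valued_measure :: "(real set \<Rightarrow> 'a::complex_inner \<Rightarrow> 'a) \<Rightarrow> bool" where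
  "projection_valued_measure E \<longleftrightarrow>
    (\<forall>B \<in> sets borel. orth_projection (E B)) \<and>
    E UNIV = id \<and>
    (\<forall>A \<in> sets borel. \<forall>B \<in> sets borel. E (A \<inter> B) = E A \<circ> E B) \<and>
    (\<forall>A :: nat \<Rightarrow> real set. range A \<subseteq> sets borel \<longrightarrow> disjoint_family A \<longrightarrow>
      (\<forall>f. (\<lambda>n. E (A n) f) sums E (\<Union>n. A n) f))"

definition scalar_measure ::
    "(real set \<Rightarrow> 'a::complex_inner \<Rightarrow> 'a) \<Rightarrow> 'a \<Rightarrow> real measure" where
  "scalar_measure E f = measure_of UNIV (sets borel) (\<lambda>B. ennreal (Re (cinner (E B f) f)))"

definition spectral_domain ::
    "(real set \<Rightarrow> 'a::complex_inner \<Rightarrow> 'a) \<Rightarrow> (real \<Rightarrow> real) \<Rightarrow> 'a set" where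
  "spectral_domain E \<phi> = {f. (\<integral>\<^sup>+ x. ennreal ((\<phi> x)\<^sup>2) \<partial>scalar_measure E f) < \<infinity>}"

text \<open>\<open>spectral_form E \<phi> f h\<close> is the integral of \<open>\<phi>\<close> against the complex measure
  \<open>B \<mapsto> \<langle>E B f, h\<rangle>\<close>, written by polarization. It is used for \<open>f\<close>, \<open>h\<close> in
  \<open>spectral_domain E \<phi>\<close>, where all four integrals converge. This domain is dense, so
  testing against its elements determines the value of the operator \<open>\<integral> \<phi> dE\<close>.\<close>

definition spectral_form ::
    "(real set \<Rightarrow> 'a::complex_inner \<Rightarrow> 'a) \<Rightarrow> (real \<Rightarrow> real) \<Rightarrow> 'a \<Rightarrow> 'a \<Rightarrow> complex" where
  "spectral_form E \<phi> f h =
    (\<Sum>k<4. \<i> ^ k * complex_of_real (\<integral>x. \<phi> x \<partial>scalar_measure E (f + (\<i> ^ k) *\<^sub>C h))) / 4"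

definition spectral_integral ::
    "(real set \<Rightarrow> 'a::complex_inner \<Rightarrow> 'a) \<Rightarrow> (real \<Rightarrow> real) \<Rightarrow> 'a oper" where
  "spectral_integral E \<phi> = {(f, g). f \<in> spectral_domain E \<phi> \<and>
    (\<forall>h \<in> spectral_domain E \<phi>. cinner g h = spectral_form E \<phi> f h)}"

definition is_spectral_measure ::
    "'a::complex_inner oper \<Rightarrow> (real set \<Rightarrow> 'a \<Rightarrow> 'a) \<Rightarrow> bool" where
  "is_spectral_measure T E \<longleftrightarrow>
    projection_valued_measure E \<and> T = spectral_integral E (\<lambda>x. x)"

text \<open>For self-adjoint \<open>T\<close> in a Hilbert space the spectral measure exists and its values on
  Borel sets are unique; the choice below only concerns sets that are not Borel.\<close>

definition spectral_measure ::
    "'a::complex_inner oper \<Rightarrow> real set \<Rightarrow> 'a \<Rightarrow> 'a" where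
  "spectral_measure T = (SOME E. is_spectral_measure T E)"

definition oper_fun :: "(real \<Rightarrow> real) \<Rightarrow> 'a::complex_inner oper \<Rightarrow> 'a oper" where
  "oper_fun \<phi> T = spectral_integral (spectral_measure T) \<phi>"


section \<open>Paley--Wiener spaces and best approximation\<close>

definition paley_wiener :: "'a::complex_inner oper \<Rightarrow> real \<Rightarrow> 'a set" where
  "paley_wiener S \<omega> = range (spectral_measure S {0..\<omega>})"

definition best_approx :: "'a::complex_inner oper \<Rightarrow> 'a \<Rightarrow> real \<Rightarrow> real" where
  "best_approx S f \<omega> = (INF g \<in> paley_wiener S \<omega>. norm (f - g))"


section \<open>Sobolev and Besov spaces\<close>

definition sobolev_oper :: "'a::complex_inner oper \<Rightarrow> nat \<Rightarrow> 'a oper" where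
  "sobolev_oper L r = oper_fun (\<lambda>x. (1 + x) powr (real r / 2)) L"

definition sobolev_norm :: "'a::complex_inner oper \<Rightarrow> nat \<Rightarrow> 'a \<Rightarrow> real" where
  "sobolev_norm L r f = norm f + norm (oper_apply (sobolev_oper L r) f)"

definition K_functional ::
    "'a::real_normed_vector set \<Rightarrow> ('a \<Rightarrow> real) \<Rightarrow> 'a \<Rightarrow> real \<Rightarrow> real" where
  "K_functional X N f t = Inf {norm f0 + t * N f1 | f0 f1. f1 \<in> X \<and> f = f0 + f1}"

definition ennreal_root :: "real \<Rightarrow> ennreal \<Rightarrow> ennreal" where
  "ennreal_root p x = (if x = \<infinity> then \<infinity> else ennreal (enn2real x powr (1 / p)))"

text \<open>The norm of the interpolation space between the ambient space and a subspace \<open>X\<close>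
  with norm \<open>N\<close>.\<close>

definition interpolation_norm ::
    "'a::real_normed_vector set \<Rightarrow> ('a \<Rightarrow> real) \<Rightarrow> real \<Rightarrow> ennreal \<Rightarrow> 'a \<Rightarrow> ennreal" where
  "interpolation_norm X N \<theta> q f =
    (if q = \<infinity> then (SUP t \<in> {0<..}. ennreal (t powr (- \<theta>) * K_functional X N f t))
     else ennreal_root (enn2real q)
       (\<integral>\<^sup>+ t \<in> {0<..}. ennreal ((t powr (- \<theta>) * K_functional X N f t) powr enn2real q / t)
          \<partial>lborel))"

definition besov_norm ::
    "'a::complex_inner oper \<Rightarrow> nat \<Rightarrow> real \<Rightarrow> ennreal \<Rightarrow> 'a \<Rightarrow> ennreal" where
  "besov_norm L r \<alpha> q =
    interpolation_norm (Domain (sobolev_oper L r)) (sobolev_norm L r) (\<alpha> / real r) q"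

definition approximation_norm ::
    "'a::complex_inner oper \<Rightarrow> real \<Rightarrow> ennreal \<Rightarrow> 'a \<Rightarrow> ennreal" where
  "approximation_norm L \<alpha> q f = ennreal (norm f) +
    (if q = \<infinity>
     then (SUP j :: nat. ennreal (2 powr (real j * \<alpha>) * best_approx (sqrt_oper L) f (2 ^ j)))
     else ennreal_root (enn2real q)
       (\<Sum>j. ennreal ((2 powr (real j * \<alpha>) * best_approx (sqrt_oper L) f (2 ^ j))
          powr enn2real q)))"

end

theory Submission
  imports Defs "HOL-Probability.Helly_Selection" "HOL-Real_Asymp.Real_Asymp"
begin

text \<open>The proof has a spectral part and an interpolation part.

  The best approximations are taken from spectral subspaces of \<open>\<surd>L\<close>, whereas the Sobolev norm
  is defined through the spectral measure \<open>E\<close> of \<open>L\<close>. Both spectral measures have to be shown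
  to exist and to be compatible. For existence, consider \<open>B = (1 + L)\<^sup>-\<^sup>1\<close>, a positive contraction.
  The numbers \<open>\<langle>B\<^sup>k (1 - B)\<^sup>l f, f\<rangle>\<close> are nonnegative, so that Hausdorff's moment theorem
  (\<open>hausdorff_moment\<close>) gives a measure on \<open>[0, 1]\<close> with moments \<open>\<langle>B\<^sup>n f, f\<rangle>\<close>. Its integrals are
  bounded quadratic forms in \<open>f\<close> and hence come from operators; this is a functional calculus for
  bounded Borel functions. Its values at indicators form a projection-valued measure, and the
  substitution \<open>x = 1/y - 1\<close> turns it into a spectral measure of \<open>L\<close>
  (\<open>spectral_measure_exists\<close>). Conversely, every spectral measure of \<open>L\<close> determines the
  resolvent and with it the moments of \<open>1/(1 + x)\<close>, so that it is unique
  (\<open>spectral_measure_unique\<close>). Pushing a spectral measure forward under squaring then shows that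
  the positive square root is unique and that its Paley--Wiener space for \<open>\<omega>\<close> is the range of
  \<open>E [0, \<omega>\<^sup>2]\<close> (\<open>paley_wiener_sqrt\<close>).

  For the interpolation part put \<open>P\<^sub>j = E [0, 4\<^sup>j]\<close>. The best approximation of \<open>f\<close> at \<open>2\<^sup>j\<close> is
  \<open>P\<^sub>j f\<close>. Since \<open>(1 + x)\<^sup>r\<^sup>/\<^sup>2\<close> is at least \<open>2\<^sup>r\<^sup>j\<close> off \<open>[0, 4\<^sup>j]\<close> and at most a constant times
  \<open>2\<^sup>r\<^sup>j\<close> on it, the projections satisfy a Jackson and a Bernstein inequality. The first bounds the
  error at \<open>2\<^sup>j\<close> by the \<open>K\<close>-functional at \<open>t = 2\<^sup>-\<^sup>r\<^sup>j\<close>. The second, applied to the increments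
  \<open>P\<^sub>j\<^sub>+\<^sub>1 f - P\<^sub>j f\<close>, bounds the \<open>K\<close>-functional by a sum of earlier errors with geometrically
  decaying weights; the decay rate \<open>2\<^sup>\<alpha>\<^sup>-\<^sup>r\<close> is less than \<open>1\<close> because \<open>\<alpha> < r\<close>. A discrete Hardy
  inequality (\<open>recursive_power_sum_le\<close>) and a dyadic decomposition of the integral over \<open>t\<close> give
  the equivalence of norms (\<open>interpolation_norm_equivalence\<close>).\<close>


section \<open>Orthogonal projection and the Riesz representation theorem\<close>

text \<open>A minimizing sequence for the distance from \<open>x\<close> to \<open>M\<close> is Cauchy by the parallelogram
  law; its limit is the foot of the perpendicular.\<close>

lemma orthogonal_foot_exists:
  fixes M :: "'a::{real_inner,complete_space} set"
  assumes M: "subspace M" "closed M"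
  obtains m where "m \<in> M" "\<And>y. y \<in> M \<Longrightarrow> inner (x - m) y = 0"
proof -
  define d where "d = (INF m\<in>M. norm (x - m))"
  have bdd: "bdd_below ((\<lambda>m. norm (x - m)) ` M)" by (rule bdd_belowI[of _ 0]) auto
  have ne: "M \<noteq> {}" using M(1) subspace_0 by auto
  have d_le: "d \<le> norm (x - m)" if "m \<in> M" for m
    unfolding d_def using bdd that by (rule cINF_lower)
  have d0: "0 \<le> d" unfolding d_def using ne by (intro cINF_greatest) auto
  have "\<exists>m\<in>M. norm (x - m) < d + 1 / Suc n" for n
  proof -
    have "d < d + 1 / Suc n" by simp
    then show ?thesis unfolding d_def using cINF_less_iff[OF ne bdd] by blast
  qed
  then obtain s where s: "\<And>n. s n \<in> M" "\<And>n. norm (x - s n) < d + 1 / Suc n" by metis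
  define e where "e n = (d + 1 / Suc n)\<^sup>2 - d\<^sup>2" for n
  have e_lim: "e \<longlonglongrightarrow> 0"
  proof -
    have "(\<lambda>n. (d + 1 / Suc n)\<^sup>2 - d\<^sup>2) \<longlonglongrightarrow> (d + 0)\<^sup>2 - d\<^sup>2"
      using LIMSEQ_inverse_real_of_nat by (intro tendsto_intros) (simp add: inverse_eq_divide)
    then show ?thesis by (simp add: e_def[abs_def])
  qed
  have par: "(norm (s i - s j))\<^sup>2 \<le> 2 * e i + 2 * e j" for i j
  proof -
    have "(1/2) *\<^sub>R (s i + s j) \<in> M" using M(1) s(1) by (simp add: subspace_add subspace_scale)
    then have "d \<le> norm (x - (1/2) *\<^sub>R (s i + s j))" by (rule d_le)
    then have 1: "d\<^sup>2 \<le> (norm (x - (1/2) *\<^sub>R (s i + s j)))\<^sup>2" using d0 by (simp add: power_mono)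
    have sq: "(norm (x - s n))\<^sup>2 \<le> (d + 1 / Suc n)\<^sup>2" for n
      using s(2)[of n] by (simp add: power_mono)
    have "(norm (s i - s j))\<^sup>2 = 2 * (norm (x - s i))\<^sup>2 + 2 * (norm (x - s j))\<^sup>2
        - 4 * (norm (x - (1/2) *\<^sub>R (s i + s j)))\<^sup>2"
      by (simp add: power2_norm_eq_inner algebra_simps inner_commute)
    also have "\<dots> \<le> 2 * e i + 2 * e j" using 1 sq[of i] sq[of j] by (simp add: e_def)
    finally show ?thesis .
  qed
  have "Cauchy s"
  proof (rule metric_CauchyI)
    fix \<epsilon> :: real assume "0 < \<epsilon>"
    then have "\<forall>\<^sub>F n in sequentially. e n < \<epsilon>\<^sup>2 / 4" using e_lim by (intro order_tendstoD(2)) auto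
    then obtain N where N: "\<And>n. n \<ge> N \<Longrightarrow> e n < \<epsilon>\<^sup>2 / 4" by (auto simp: eventually_sequentially)
    have "dist (s i) (s j) < \<epsilon>" if "i \<ge> N" "j \<ge> N" for i j
    proof -
      have "(norm (s i - s j))\<^sup>2 < \<epsilon>\<^sup>2" using par[of i j] N[OF that(1)] N[OF that(2)] by simp
      then show ?thesis using \<open>0 < \<epsilon>\<close> by (simp add: dist_norm power2_less_imp_less)
    qed
    then show "\<exists>N. \<forall>i\<ge>N. \<forall>j\<ge>N. dist (s i) (s j) < \<epsilon>" by blast
  qed
  then obtain m where m: "s \<longlonglongrightarrow> m" using Cauchy_convergent convergent_def by blast
  have mM: "m \<in> M" using M(2) s(1) m closed_sequentially by blast
  have "(\<lambda>n. norm (x - s n)) \<longlonglongrightarrow> norm (x - m)" using m by (intro tendsto_intros)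
  moreover have "(\<lambda>n. d + 1 / Suc n) \<longlonglongrightarrow> d + 0"
    using LIMSEQ_inverse_real_of_nat by (intro tendsto_intros) (simp add: inverse_eq_divide)
  ultimately have "norm (x - m) \<le> d + 0"
    by (rule LIMSEQ_le) (use s(2) less_imp_le in blast)
  then have nm: "norm (x - m) = d" using d_le[OF mM] by simp
  have "inner (x - m) y = 0" if y: "y \<in> M" for y
  proof (cases "y = 0")
    case False
    define t where "t = inner (x - m) y / (norm y)\<^sup>2"
    have "m + t *\<^sub>R y \<in> M" using M(1) mM y by (simp add: subspace_add subspace_scale)
    then have "d\<^sup>2 \<le> (norm (x - (m + t *\<^sub>R y)))\<^sup>2" using d_le d0 by (simp add: power_mono)
    also have "\<dots> = d\<^sup>2 - 2 * t * inner (x - m) y + t\<^sup>2 * (norm y)\<^sup>2"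
      unfolding nm[symmetric] power2_norm_eq_inner
      by (simp add: algebra_simps inner_commute power2_eq_square)
    also have "\<dots> = d\<^sup>2 - (inner (x - m) y)\<^sup>2 / (norm y)\<^sup>2"
      using False by (simp add: t_def power2_eq_square field_simps)
    finally have "(inner (x - m) y)\<^sup>2 / (norm y)\<^sup>2 \<le> 0" by simp
    then show ?thesis using False by (simp add: divide_le_0_iff)
  qed simp
  then show thesis using that mM by blast
qed

text \<open>The representing vector is a multiple of a vector orthogonal to the kernel.\<close>

lemma riesz_representation:
  fixes l :: "'a::{real_inner,complete_space} \<Rightarrow> real"
  assumes l: "bounded_linear l"
  obtains z where "\<And>y. l y = inner z y"
proof (cases "\<forall>y. l y = 0")
  case True
  then show thesis using that[of 0] by simp
next
  case False
  then obtain x where x: "l x \<noteq> 0" by blast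
  interpret bounded_linear l by fact
  let ?M = "{y. l y = 0}"
  have "subspace ?M" by (auto simp: subspace_def add scaleR zero)
  moreover have "closed ?M"
    by (intro closed_Collect_eq continuous_on_const linear_continuous_on l)
  ultimately obtain m where m: "m \<in> ?M" "\<And>y. y \<in> ?M \<Longrightarrow> inner (x - m) y = 0"
    using orthogonal_foot_exists[of ?M x] by blast
  define u where "u = x - m"
  have lu: "l u = l x" using m(1) by (simp add: u_def diff)
  then have "u \<noteq> 0" using x zero by auto
  have "l y = inner ((l u / (norm u)\<^sup>2) *\<^sub>R u) y" for y
  proof -
    have "y - (l y / l u) *\<^sub>R u \<in> ?M" using lu x by (simp add: diff scaleR)
    then have "inner u (y - (l y / l u) *\<^sub>R u) = 0" using m(2) u_def by blast
    then have "inner u y = l y / l u * (norm u)\<^sup>2" by (simp add: inner_diff_right power2_norm_eq_inner)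
    then show ?thesis using lu x \<open>u \<noteq> 0\<close> by simp
  qed
  then show thesis by (rule that)
qed


section \<open>Quadratic forms\<close>

text \<open>A quadratic form is described by identities between finitely many of its values, because
  such identities pass to linear combinations and to pointwise limits. The integrals
  \<open>\<integral> \<phi> d\<mu>\<^sub>f\<close> are recognized as quadratic forms in \<open>f\<close> in this way.\<close>

definition polar :: "('a::real_vector \<Rightarrow> real) \<Rightarrow> 'a \<Rightarrow> 'a \<Rightarrow> real" where
  "polar q x y = (q (x + y) - q (x - y)) / 4"

definition quadratic_form :: "('a::real_vector \<Rightarrow> real) \<Rightarrow> bool" where
  "quadratic_form q \<longleftrightarrow> (\<forall>x. polar q x x = q x) \<and> (\<forall>x y. polar q x y = polar q y x) \<and>
    (\<forall>x y z. polar q (x + y) z = polar q x z + polar q y z) \<and>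
    (\<forall>c x z. polar q (c *\<^sub>R x) z = c * polar q x z)"

lemma quadratic_formD:
  assumes "quadratic_form q"
  shows "polar q x x = q x" "polar q x y = polar q y x"
    "polar q (x + y) z = polar q x z + polar q y z"
    "polar q (c *\<^sub>R x) z = c * polar q x z"
  using assms by (auto simp: quadratic_form_def)

lemma polar_add: "polar (\<lambda>x. p x + q x) x y = polar p x y + polar q x y"
  by (simp add: polar_def field_simps)

lemma polar_cmult: "polar (\<lambda>x. c * q x) x y = c * polar q x y"
  by (simp add: polar_def field_simps)

lemma polar_tendsto:
  assumes "\<And>x. (\<lambda>n. q n x) \<longlonglongrightarrow> p x"
  shows "(\<lambda>n. polar (q n) x y) \<longlonglongrightarrow> polar p x y"
  unfolding polar_def by (intro tendsto_intros assms) simp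

lemma quadratic_form_add:
  "quadratic_form p \<Longrightarrow> quadratic_form q \<Longrightarrow> quadratic_form (\<lambda>x. p x + q x)"
  unfolding quadratic_form_def[of "\<lambda>x. p x + q x"] polar_add
  by (simp add: quadratic_formD(1,3,4) quadratic_formD(2)[of p] quadratic_formD(2)[of q] algebra_simps)

lemma quadratic_form_cmult: "quadratic_form q \<Longrightarrow> quadratic_form (\<lambda>x. c * q x)"
  unfolding quadratic_form_def[of "\<lambda>x. c * q x"] polar_cmult
  by (auto simp: quadratic_formD(1,3,4) algebra_simps intro: quadratic_formD(2))

lemma quadratic_form_tendsto:
  assumes q: "\<And>n. quadratic_form (q n)" and lim: "\<And>x. (\<lambda>n. q n x) \<longlonglongrightarrow> p x"
  shows "quadratic_form p"
proof -
  note pl = polar_tendsto[of q p, OF lim]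
  have "polar p x x = p x" for x
    using LIMSEQ_unique[OF pl[of x x]] lim[of x] q by (simp add: quadratic_form_def)
  moreover have "polar p x y = polar p y x" for x y
    using LIMSEQ_unique[OF pl[of x y]] pl[of y x] q by (simp add: quadratic_form_def)
  moreover have "polar p (x + y) z = polar p x z + polar p y z" for x y z
    using LIMSEQ_unique[OF pl[of "x + y" z]] tendsto_add[OF pl[of x z] pl[of y z]]
    by (simp add: quadratic_formD(3)[OF q])
  moreover have "polar p (c *\<^sub>R x) z = c * polar p x z" for c x z
    using LIMSEQ_unique[OF pl[of "c *\<^sub>R x" z]] tendsto_mult_left[OF pl[of x z], of c]
    by (simp add: quadratic_formD(4)[OF q])
  ultimately show ?thesis by (simp add: quadratic_form_def)
qed

lemma polar_inner:
  assumes "linear X" and sym: "\<And>x y. inner (X x) y = inner x (X y)"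
  shows "polar (\<lambda>x. inner (X x) x) x y = inner (X x) y"
proof -
  interpret linear X by fact
  show ?thesis
    using sym[of y x]
    by (simp add: polar_def add diff inner_add_left inner_add_right inner_diff_left
        inner_diff_right inner_commute)
qed

lemma quadratic_form_inner:
  assumes X: "linear X" and sym: "\<And>x y. inner (X x) y = inner x (X y)"
  shows "quadratic_form (\<lambda>x. inner (X x) x)"
proof -
  interpret linear X by fact
  show ?thesis
    unfolding quadratic_form_def polar_inner[OF X sym]
    using sym by (auto simp: add scale inner_add_left) (metis inner_commute sym)
qed

text \<open>The bound for unit vectors comes from the parallelogram law, and the general one from
  homogeneity.\<close>

lemma abs_polar_le:
  fixes q :: "'a::real_inner \<Rightarrow> real"
  assumes q: "quadratic_form q" and bd: "\<And>x. \<bar>q x\<bar> \<le> M * (norm x)\<^sup>2"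
  shows "\<bar>polar q x y\<bar> \<le> M * norm x * norm y"
proof -
  have sc1: "polar q (c *\<^sub>R x) y = c * polar q x y" for c x y
    by (rule quadratic_formD(4)[OF q])
  have sc2: "polar q x (c *\<^sub>R y) = c * polar q x y" for c x y
    using sc1 quadratic_formD(2)[OF q] by metis
  have unit: "\<bar>polar q x y\<bar> \<le> M" if "norm x = 1" "norm y = 1" for x y
  proof -
    have "\<bar>polar q x y\<bar> \<le> (\<bar>q (x + y)\<bar> + \<bar>q (x - y)\<bar>) / 4" by (simp add: polar_def)
    also have "\<dots> \<le> (M * (norm (x + y))\<^sup>2 + M * (norm (x - y))\<^sup>2) / 4"
      using bd[of "x + y"] bd[of "x - y"] by simp
    also have "\<dots> = M * (2 * (norm x)\<^sup>2 + 2 * (norm y)\<^sup>2) / 4"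
      by (simp add: power2_norm_eq_inner algebra_simps inner_commute)
    finally show ?thesis using that by simp
  qed
  show ?thesis
  proof (cases "x = 0 \<or> y = 0")
    case True
    then show ?thesis using sc1[of 0 0 y] sc2[of x 0 0] by auto
  next
    case False
    then have "polar q x y = norm x * (norm y * polar q (x /\<^sub>R norm x) (y /\<^sub>R norm y))"
      by (simp add: sc1 sc2 field_simps)
    also have "\<bar>\<dots>\<bar> \<le> norm x * (norm y * M)"
      using unit[of "x /\<^sub>R norm x" "y /\<^sub>R norm y"] False
      by (simp add: abs_mult mult_left_mono)
    finally show ?thesis by (simp add: mult_ac)
  qed
qed

text \<open>Each \<open>polar q x\<close> is a bounded functional, which is represented by a vector \<open>X x\<close>.\<close>

lemma quadratic_form_operator:
  fixes q :: "'a::{real_inner,complete_space} \<Rightarrow> real"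
  assumes q: "quadratic_form q" and bd: "\<And>x. \<bar>q x\<bar> \<le> M * (norm x)\<^sup>2"
  obtains X where "bounded_linear X" "\<And>x y. inner (X x) y = polar q x y"
proof -
  have add1: "polar q (x + y) z = polar q x z + polar q y z"
    and sc1: "polar q (c *\<^sub>R x) z = c * polar q x z"
    and sym: "polar q x y = polar q y x" for x y z c
    using quadratic_formD[OF q] by auto
  note B = abs_polar_le[OF q bd]
  have "bounded_linear (polar q x)" for x
  proof
    show "polar q x (y + z) = polar q x y + polar q x z" for y z
      by (metis add1 sym)
    show "polar q x (c *\<^sub>R y) = c *\<^sub>R polar q x y" for c y
      by (metis sc1 sym real_scaleR_def)
    show "\<exists>K. \<forall>y. norm (polar q x y) \<le> norm y * K"
      using B[of x] by (intro exI[of _ "M * norm x"]) (simp add: mult.commute)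
  qed
  then have "\<exists>z. \<forall>y. polar q x y = inner z y" for x
    using riesz_representation by metis
  then obtain X where X: "\<And>x y. inner (X x) y = polar q x y" by metis
  have eqI: "u = v" if "\<And>y. inner u y = inner v y" for u v :: 'a
    by (metis inner_diff_left inner_eq_zero_iff right_minus_eq that)
  have "bounded_linear X"
  proof
    show "X (x + y) = X x + X y" for x y by (rule eqI) (simp add: X add1 inner_add_left)
    show "X (c *\<^sub>R x) = c *\<^sub>R X x" for c x by (rule eqI) (simp add: X sc1)
    have "norm (X x) \<le> norm x * M" for x
    proof (cases "X x = 0")
      case True
      have "0 \<le> M * norm x * norm x" using bd[of x] by (simp add: power2_eq_square mult.assoc)
      then have "0 \<le> norm x * M"
        by (cases "x = 0") (auto simp: zero_le_mult_iff)
      then show ?thesis using True by simp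
    next
      case False
      have "norm (X x) * norm (X x) = inner (X x) (X x)"
        by (simp add: power2_norm_eq_inner flip: power2_eq_square)
      also have "\<dots> \<le> M * norm x * norm (X x)" unfolding X using B[of x "X x"] by simp
      finally show ?thesis using False by (simp add: mult.commute)
    qed
    then show "\<exists>K. \<forall>x. norm (X x) \<le> norm x * K" by blast
  qed
  then show thesis using that X by blast
qed


section \<open>Bounded Borel functions\<close>

definition bounded_borel :: "(real \<Rightarrow> real) \<Rightarrow> bool" where
  "bounded_borel \<phi> \<longleftrightarrow> \<phi> \<in> borel_measurable borel \<and> (\<exists>M. \<forall>x. \<bar>\<phi> x\<bar> \<le> M)"

text \<open>Identities between integrals, or between operators of the functional calculus, that involve a
  bounded Borel function pass to sums, multiples and bounded pointwise limits. These closure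
  properties drive the two induction principles that follow.\<close>

definition bounded_class :: "((real \<Rightarrow> real) \<Rightarrow> bool) \<Rightarrow> bool" where
  "bounded_class P \<longleftrightarrow>
    (\<forall>\<phi> \<psi>. bounded_borel \<phi> \<longrightarrow> bounded_borel \<psi> \<longrightarrow> P \<phi> \<longrightarrow> P \<psi> \<longrightarrow> P (\<lambda>x. \<phi> x + \<psi> x)) \<and>
    (\<forall>c \<phi>. bounded_borel \<phi> \<longrightarrow> P \<phi> \<longrightarrow> P (\<lambda>x. c * \<phi> x)) \<and>
    (\<forall>\<phi>s \<phi> M. (\<forall>n. bounded_borel (\<phi>s n) \<and> P (\<phi>s n)) \<longrightarrow> (\<forall>n x. \<bar>\<phi>s n x\<bar> \<le> M) \<longrightarrow>
       (\<forall>x. (\<lambda>n. \<phi>s n x) \<longlonglongrightarrow> \<phi> x) \<longrightarrow> bounded_borel \<phi> \<longrightarrow> P \<phi>)"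

lemma bounded_classI:
  assumes "\<And>\<phi> \<psi>. \<lbrakk>bounded_borel \<phi>; bounded_borel \<psi>; P \<phi>; P \<psi>\<rbrakk> \<Longrightarrow> P (\<lambda>x. \<phi> x + \<psi> x)"
    and "\<And>c \<phi>. \<lbrakk>bounded_borel \<phi>; P \<phi>\<rbrakk> \<Longrightarrow> P (\<lambda>x. c * \<phi> x)"
    and "\<And>\<phi>s \<phi> M. \<lbrakk>\<And>n. bounded_borel (\<phi>s n); \<And>n. P (\<phi>s n); \<And>n x. \<bar>\<phi>s n x\<bar> \<le> M;
       \<And>x. (\<lambda>n. \<phi>s n x) \<longlonglongrightarrow> \<phi> x; bounded_borel \<phi>\<rbrakk> \<Longrightarrow> P \<phi>"
  shows "bounded_class P"
  using assms unfolding bounded_class_def by blast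

lemma bounded_classD:
  assumes "bounded_class P"
  shows bounded_class_add:
      "\<lbrakk>bounded_borel \<phi>; bounded_borel \<psi>; P \<phi>; P \<psi>\<rbrakk> \<Longrightarrow> P (\<lambda>x. \<phi> x + \<psi> x)"
    and bounded_class_cmult: "\<lbrakk>bounded_borel \<phi>; P \<phi>\<rbrakk> \<Longrightarrow> P (\<lambda>x. c * \<phi> x)"
    and bounded_class_lim: "\<lbrakk>\<And>n. bounded_borel (\<phi>s n); \<And>n. P (\<phi>s n); \<And>n x. \<bar>\<phi>s n x\<bar> \<le> M;
       \<And>x. (\<lambda>n. \<phi>s n x) \<longlonglongrightarrow> \<phi> x; bounded_borel \<phi>\<rbrakk> \<Longrightarrow> P \<phi>"
  using assms unfolding bounded_class_def by blast+

lemma bounded_borelI: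
  "\<phi> \<in> borel_measurable borel \<Longrightarrow> (\<And>x. \<bar>\<phi> x\<bar> \<le> M) \<Longrightarrow> bounded_borel \<phi>"
  by (auto simp: bounded_borel_def)

lemma bounded_borel_measurable: "bounded_borel \<phi> \<Longrightarrow> \<phi> \<in> borel_measurable borel"
  by (simp add: bounded_borel_def)

lemma bounded_borel_indicator: "A \<in> sets borel \<Longrightarrow> bounded_borel (indicat_real A)"
  by (rule bounded_borelI[where M=1]) (auto simp: indicator_def)

lemma bounded_borel_const: "bounded_borel (\<lambda>x. c)"
  by (rule bounded_borelI[where M="\<bar>c\<bar>"]) auto

lemma bounded_borel_add:
  assumes "bounded_borel \<phi>" "bounded_borel \<psi>"
  shows "bounded_borel (\<lambda>x. \<phi> x + \<psi> x)"
proof -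
  obtain M N where "\<And>x. \<bar>\<phi> x\<bar> \<le> M" "\<And>x. \<bar>\<psi> x\<bar> \<le> N"
    using assms by (auto simp: bounded_borel_def)
  then have "\<bar>\<phi> x + \<psi> x\<bar> \<le> M + N" for x by (meson abs_triangle_ineq add_mono order_trans)
  then show ?thesis
    by (rule bounded_borelI[rotated])
       (intro borel_measurable_add bounded_borel_measurable assms)
qed

lemma bounded_borel_mult:
  assumes "bounded_borel \<phi>" "bounded_borel \<psi>"
  shows "bounded_borel (\<lambda>x. \<phi> x * \<psi> x)"
proof -
  obtain M N where MN: "\<And>x. \<bar>\<phi> x\<bar> \<le> M" "\<And>x. \<bar>\<psi> x\<bar> \<le> N"
    using assms by (auto simp: bounded_borel_def)
  have "\<bar>\<phi> x * \<psi> x\<bar> \<le> M * N" for x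
    unfolding abs_mult using MN by (meson abs_ge_zero mult_mono order_trans)
  then show ?thesis
    by (rule bounded_borelI[rotated])
       (intro borel_measurable_times bounded_borel_measurable assms)
qed

lemma bounded_borel_cmult: "bounded_borel \<phi> \<Longrightarrow> bounded_borel (\<lambda>x. c * \<phi> x)"
  by (rule bounded_borel_mult[OF bounded_borel_const])

lemma bounded_borel_diff:
  "bounded_borel \<phi> \<Longrightarrow> bounded_borel \<psi> \<Longrightarrow> bounded_borel (\<lambda>x. \<phi> x - \<psi> x)"
  using bounded_borel_add[of \<phi> "\<lambda>x. (-1) * \<psi> x"] bounded_borel_cmult[of \<psi> "-1"] by simp

lemma bounded_borel_power: "bounded_borel \<phi> \<Longrightarrow> bounded_borel (\<lambda>x. \<phi> x ^ n)"
  by (induction n) (simp_all add: bounded_borel_const bounded_borel_mult)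

lemma bounded_borel_comp:
  assumes "bounded_borel \<phi>" "u \<in> borel_measurable borel"
  shows "bounded_borel (\<lambda>x. \<phi> (u x))"
  using assms by (auto simp: bounded_borel_def intro: measurable_compose)

lemma bounded_borel_sum:
  "(\<And>i. i \<in> I \<Longrightarrow> bounded_borel (\<phi> i)) \<Longrightarrow> bounded_borel (\<lambda>x. \<Sum>i\<in>I. \<phi> i x)"
  by (induction I rule: infinite_finite_induct)
     (simp_all add: bounded_borel_const bounded_borel_add)

lemmas bounded_borel_intros =
  bounded_borel_indicator bounded_borel_const bounded_borel_add bounded_borel_mult
  bounded_borel_cmult bounded_borel_power bounded_borel_sum

lemma bounded_class_sum:
  assumes P: "bounded_class P" "P (\<lambda>x. 0)"
    and "\<And>i. i \<in> I \<Longrightarrow> bounded_borel (\<phi> i)" "\<And>i. i \<in> I \<Longrightarrow> P (\<phi> i)"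
  shows "P (\<lambda>x. \<Sum>i\<in>I. \<phi> i x)"
  using assms(3,4)
  by (induction I rule: infinite_finite_induct)
     (simp_all add: P(2) bounded_class_add[OF P(1)] bounded_borel_sum)

text \<open>A bounded Borel function is a pointwise limit of dominated simple functions.\<close>

lemma bounded_borel_induct:
  assumes \<phi>: "bounded_borel \<phi>" and P: "bounded_class P"
    and ind: "\<And>A. A \<in> sets borel \<Longrightarrow> P (indicat_real A)"
  shows "P \<phi>"
proof -
  obtain s where s: "\<And>i. simple_function borel (s i)" "\<And>x. (\<lambda>i. s i x) \<longlonglongrightarrow> \<phi> x"
      "\<And>i x. dist (s i x) 0 \<le> 2 * dist (\<phi> x) 0"
    using borel_measurable_implies_sequence_metric[OF bounded_borel_measurable[OF \<phi>], of 0] by auto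
  obtain M where M: "\<And>x. \<bar>\<phi> x\<bar> \<le> M" using \<phi> by (auto simp: bounded_borel_def)
  have P0: "P (\<lambda>x. 0)"
    using bounded_class_cmult[OF P bounded_borel_indicator, of "{}" 0] ind by simp
  have simple: "bounded_borel f \<and> P f" if "simple_function borel f" for f :: "real \<Rightarrow> real"
  proof -
    have fin: "finite (range f)" and meas: "\<And>y. f -` {y} \<in> sets borel"
      using simple_functionD[OF that] by auto
    have eq: "f = (\<lambda>x. \<Sum>y\<in>range f. y * indicat_real (f -` {y}) x)"
    proof
      fix x
      have "(\<Sum>y\<in>range f. y * indicat_real (f -` {y}) x) = (\<Sum>y\<in>{f x}. y * indicat_real (f -` {y}) x)"
        using fin by (intro sum.mono_neutral_right) auto
      then show "f x = (\<Sum>y\<in>range f. y * indicat_real (f -` {y}) x)" by simp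
    qed
    have "bounded_borel (\<lambda>x. \<Sum>y\<in>range f. y * indicat_real (f -` {y}) x)"
      using meas by (intro bounded_borel_intros)
    moreover have "P (\<lambda>x. \<Sum>y\<in>range f. y * indicat_real (f -` {y}) x)"
      using meas by (intro bounded_class_sum[OF P P0] bounded_class_cmult[OF P] ind bounded_borel_intros)
    ultimately show ?thesis using eq by metis
  qed
  show ?thesis
  proof (rule bounded_class_lim[OF P, where \<phi>s = s and M = "2 * M"])
    show "\<bar>s n x\<bar> \<le> 2 * M" for n x using s(3)[of n x] M[of x] by simp
  qed (use simple s \<phi> in auto)
qed

text \<open>By Bernstein approximation the powers of \<open>u\<close> generate the continuous functions of \<open>u\<close>;
  these generate the indicators of half-lines, and a Dynkin argument does the rest.\<close>

lemma bounded_borel_induct_powers: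
  assumes \<phi>: "bounded_borel \<phi>" and P: "bounded_class P"
    and u: "u \<in> borel_measurable borel" "\<And>x. 0 \<le> u x" "\<And>x. u x \<le> (1::real)"
    and pow: "\<And>n. P (\<lambda>x. u x ^ n)"
  shows "P (\<lambda>x. \<phi> (u x))"
proof -
  have bu: "bounded_borel u" using u by (intro bounded_borelI[where M=1]) auto
  have P1: "P (\<lambda>x. 1)" using pow[of 0] by simp
  have P0: "P (\<lambda>x. 0)" using bounded_class_cmult[OF P bounded_borel_const P1, of 0] by simp
  have b1u: "bounded_borel (\<lambda>x. 1 - u x)"
    by (intro bounded_borel_diff bounded_borel_const bu)
  note bb = bounded_borel_intros bu b1u
  have mono: "P (\<lambda>x. u x ^ k * (1 - u x) ^ l)" for k l
  proof (induction l arbitrary: k)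
    case (Suc l)
    have "P (\<lambda>x. u x ^ k * (1 - u x) ^ l + (-1) * (u x ^ Suc k * (1 - u x) ^ l))"
      by (intro bounded_class_add[OF P] bounded_class_cmult[OF P] Suc bb)
    then show ?case by (simp add: algebra_simps)
  qed (simp add: pow)
  have cont: "P (\<lambda>x. c (u x))" if c: "continuous_on {0..1} c" for c
  proof -
    have "\<exists>n. \<forall>t\<in>{0..1}. \<bar>c t - (\<Sum>k\<le>n. c (k / n) * Bernstein n k t)\<bar> < 1 / Suc i" for i
      using Bernstein_Weierstrass[OF c, of "1 / Suc i"] by force
    then obtain n where n: "\<And>i t. t \<in> {0..1} \<Longrightarrow>
        \<bar>c t - (\<Sum>k\<le>n i. c (k / n i) * Bernstein (n i) k t)\<bar> < 1 / Suc i" by metis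
    define b where "b i x = (\<Sum>k\<le>n i. c (k / n i) * Bernstein (n i) k (u x))" for i x
    have b_eq: "b i = (\<lambda>x. \<Sum>k\<le>n i. c (k / n i) * (of_nat (n i choose k) * (u x ^ k * (1 - u x) ^ (n i - k))))" for i
      by (simp add: b_def[abs_def] Bernstein_def mult_ac)
    have err: "\<bar>c (u x) - b i x\<bar> < 1 / Suc i" for i x
      using n[of "u x" i] u by (simp add: b_def)
    obtain K where K: "\<And>t. t \<in> {0..1} \<Longrightarrow> \<bar>c t\<bar> \<le> K"
      using compact_imp_bounded[OF compact_continuous_image[OF c compact_Icc]]
      unfolding bounded_iff by (metis imageI real_norm_def)
    have lim: "(\<lambda>i. b i x) \<longlonglongrightarrow> c (u x)" for x
    proof (rule LIMSEQ_I)
      fix e :: real assume "0 < e"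
      then obtain N where N: "1 / Suc N < e" using nat_approx_posE by metis
      have "norm (b i x - c (u x)) < e" if "i \<ge> N" for i
      proof -
        have "1 / Suc i \<le> (1 / Suc N :: real)" using that by (simp add: frac_le)
        then show ?thesis using err[of x i] N by (simp add: abs_minus_commute)
      qed
      then show "\<exists>N. \<forall>i\<ge>N. norm (b i x - c (u x)) < e" by blast
    qed
    have bbi: "bounded_borel (b i)" for i unfolding b_eq by (intro bb)
    show ?thesis
    proof (rule bounded_class_lim[OF P, where \<phi>s = b and M = "K + 1"])
      show "bounded_borel (b i)" for i by (rule bbi)
      show "P (b i)" for i
        unfolding b_eq by (intro bounded_class_sum[OF P P0] bounded_class_cmult[OF P] mono bb)
      show "\<bar>b i x\<bar> \<le> K + 1" for i x
      proof -
        have "1 / Suc i \<le> (1::real)" by simp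
        moreover have "\<bar>c (u x)\<bar> \<le> K" using K u by simp
        ultimately show ?thesis using err[of x i] by linarith
      qed
      show "(\<lambda>i. b i x) \<longlonglongrightarrow> c (u x)" for x by (rule lim)
      show "bounded_borel (\<lambda>x. c (u x))"
      proof (rule bounded_borelI[where M=K])
        show "(\<lambda>x. c (u x)) \<in> borel_measurable borel"
          by (rule borel_measurable_LIMSEQ_real[OF lim]) (use bbi bounded_borel_measurable in blast)
        show "\<bar>c (u x)\<bar> \<le> K" for x using K u by simp
      qed
    qed
  qed
  have half: "P (\<lambda>x. indicat_real {..a} (u x))" for a
  proof (rule bounded_class_lim[OF P, where M = 1
        and \<phi>s = "\<lambda>n x. max 0 (min 1 (1 - real n * (u x - a)))"])
    show "P (\<lambda>x. max 0 (min 1 (1 - real n * (u x - a))))" for n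
      by (rule cont) (intro continuous_intros)
    show "bounded_borel (\<lambda>x. max 0 (min 1 (1 - real n * (u x - a))))" for n
      using u(1) by (intro bounded_borelI[where M=1]) auto
    show "\<bar>max 0 (min 1 (1 - real n * (u x - a)))\<bar> \<le> 1" for n x by auto
    show "(\<lambda>n. max 0 (min 1 (1 - real n * (u x - a)))) \<longlonglongrightarrow> indicat_real {..a} (u x)" for x
    proof (cases "u x \<le> a")
      case True
      then have "1 - real n * (u x - a) \<ge> 1" for n by (simp add: mult_nonneg_nonpos)
      then have "max 0 (min 1 (1 - real n * (u x - a))) = 1" for n by (simp add: min_absorb1)
      then show ?thesis using True by simp
    next
      case False
      then obtain N where N: "1 / (u x - a) < of_nat N" using reals_Archimedean2 by blast
      have "max 0 (min 1 (1 - real n * (u x - a))) = 0" if "n \<ge> N" for n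
      proof -
        have "1 / (u x - a) \<le> real n" using N that by (meson less_imp_le of_nat_mono order_trans)
        then have "1 \<le> real n * (u x - a)" using False by (simp add: divide_le_eq)
        then show ?thesis by simp
      qed
      then have "\<forall>\<^sub>F n in sequentially. max 0 (min 1 (1 - real n * (u x - a))) = 0"
        by (auto simp: eventually_sequentially)
      then show ?thesis using False by (simp add: tendsto_eventually)
    qed
    show "bounded_borel (\<lambda>x. indicat_real {..a} (u x))"
      by (intro bounded_borel_comp[OF _ u(1)] bounded_borel_indicator) simp
  qed
  have ind: "P (\<lambda>x. indicat_real A (u x))" if "A \<in> sets borel" for A
  proof -
    have bi: "bounded_borel (\<lambda>x. indicat_real A (u x))" if "A \<in> sets borel" for A
      by (intro bounded_borel_comp[OF _ u(1)] bounded_borel_indicator that)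
    have borel_eq: "sets borel = sigma_sets UNIV (range (\<lambda>a::real. {..a}))"
      unfolding borel_eq_atMost by simp
    have "Int_stable (range (\<lambda>a::real. {..a}))" by (auto simp: Int_stable_def)
    moreover have "range (\<lambda>a::real. {..a}) \<subseteq> Pow UNIV" by simp
    moreover have "A \<in> sigma_sets UNIV (range (\<lambda>a::real. {..a}))" using that by (simp add: borel_eq)
    ultimately show ?thesis
    proof (induction rule: sigma_sets_induct_disjoint)
      case (basic A)
      then show ?case using half by auto
    next
      case empty
      then show ?case using P0 by simp
    next
      case (compl A)
      then have "P (\<lambda>x. 1 + (-1) * indicat_real A (u x))"
        by (intro bounded_class_add[OF P] bounded_class_cmult[OF P] P1 bounded_borel_const
            bounded_borel_cmult bi) (auto simp: borel_eq)
      moreover have "1 + (-1) * indicat_real A t = indicat_real (UNIV - A) t" for t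
        by (simp add: indicator_def)
      ultimately show ?case by simp
    next
      case (union A)
      then have Ab: "\<And>i. A i \<in> sets borel" by (auto simp: borel_eq)
      have sum_eq: "(\<Sum>i<n. indicat_real (A i) t) = indicat_real (\<Union>i<n. A i) t" for n t
        using union(1) by (subst indicator_UN_disjoint) (auto simp: disjoint_family_on_def)
      show ?case
      proof (rule bounded_class_lim[OF P, where \<phi>s = "\<lambda>n x. \<Sum>i<n. indicat_real (A i) (u x)" and M=1])
        show "P (\<lambda>x. \<Sum>i<n. indicat_real (A i) (u x))" for n
          by (intro bounded_class_sum[OF P P0] bi Ab union)
        show "bounded_borel (\<lambda>x. \<Sum>i<n. indicat_real (A i) (u x))" for n
          by (intro bounded_borel_sum bi Ab)
        show "\<bar>\<Sum>i<n. indicat_real (A i) (u x)\<bar> \<le> 1" for n x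
          unfolding sum_eq by (simp add: indicator_def)
        show "bounded_borel (\<lambda>x. indicat_real (\<Union>i. A i) (u x))" using Ab by (intro bi) auto
        show "(\<lambda>n. \<Sum>i<n. indicat_real (A i) (u x)) \<longlonglongrightarrow> indicat_real (\<Union>i. A i) (u x)" for x
          unfolding sum_eq by (rule LIMSEQ_indicator_UN)
      qed
    qed
  qed
  define Q where "Q \<psi> \<longleftrightarrow> P (\<lambda>x. \<psi> (u x))" for \<psi>
  have "bounded_class Q"
  proof (rule bounded_classI, goal_cases)
    case (1 \<phi> \<psi>)
    then show ?case unfolding Q_def by (intro bounded_class_add[OF P] bounded_borel_comp[OF _ u(1)])
  next
    case (2 c \<phi>)
    then show ?case unfolding Q_def by (intro bounded_class_cmult[OF P] bounded_borel_comp[OF _ u(1)])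
  next
    case (3 \<phi>s \<phi> M)
    show ?case
      unfolding Q_def
    proof (rule bounded_class_lim[OF P])
      show "bounded_borel (\<lambda>x. \<phi>s n (u x))" for n by (rule bounded_borel_comp[OF 3(1) u(1)])
      show "P (\<lambda>x. \<phi>s n (u x))" for n using 3(2) by (simp add: Q_def)
      show "\<bar>\<phi>s n (u x)\<bar> \<le> M" for n x by (rule 3(3))
      show "(\<lambda>n. \<phi>s n (u x)) \<longlonglongrightarrow> \<phi> (u x)" for x by (rule 3(4))
      show "bounded_borel (\<lambda>x. \<phi> (u x))" by (rule bounded_borel_comp[OF 3(5) u(1)])
    qed
  qed
  from bounded_borel_induct[OF \<phi> this] ind show ?thesis by (simp add: Q_def)
qed


section \<open>Functional calculus of a quadratic family of measures\<close>

locale borel_family =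
  fixes \<mu> :: "'a \<Rightarrow> real measure"
  assumes sets_mu: "sets (\<mu> f) = sets borel" and finite_mu: "finite_measure (\<mu> f)"
begin

lemma space_mu: "space (\<mu> f) = UNIV"
  using sets_eq_imp_space_eq[OF sets_mu] by simp

lemma measurable_mu: "measurable (\<mu> f) N = measurable borel N"
  by (rule measurable_cong_sets) (simp_all add: sets_mu)

lemma integrable_bounded:
  assumes "bounded_borel \<phi>"
  shows "integrable (\<mu> f) \<phi>"
proof -
  obtain M where "\<And>x. \<bar>\<phi> x\<bar> \<le> M" using assms by (auto simp: bounded_borel_def)
  then show ?thesis using assms
    by (intro finite_measure.integrable_const_bound[OF finite_mu, where B=M])
       (auto simp: measurable_mu bounded_borel_def)
qed

lemma integral_tendsto:
  assumes "\<And>n. bounded_borel (\<phi>s n)" "\<And>n x. \<bar>\<phi>s n x\<bar> \<le> M"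
    "\<And>x. (\<lambda>n. \<phi>s n x) \<longlonglongrightarrow> \<phi> x" "bounded_borel \<phi>"
  shows "(\<lambda>n. \<integral>x. \<phi>s n x \<partial>\<mu> f) \<longlonglongrightarrow> (\<integral>x. \<phi> x \<partial>\<mu> f)"
proof (rule integral_dominated_convergence[where w = "\<lambda>x. M"])
  show "integrable (\<mu> f) (\<lambda>x. M)" by (intro integrable_bounded bounded_borel_const)
qed (use assms in \<open>auto simp: measurable_mu dest: bounded_borel_measurable\<close>)

end

text \<open>The scalar measures \<open>B \<mapsto> \<langle>E B f, f\<rangle>\<close> of a projection-valued measure and the solutions of
  the moment problems of a bounded operator both form such a family.\<close>

locale measure_family = borel_family \<mu> for \<mu> :: "'a::{real_inner,complete_space} \<Rightarrow> real measure" +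
  assumes quadratic_mu: "A \<in> sets borel \<Longrightarrow> quadratic_form (\<lambda>f. measure (\<mu> f) A)"
    and mass_mu: "measure (\<mu> f) UNIV = (norm f)\<^sup>2"
begin

lemma quadratic_integral:
  assumes "bounded_borel \<phi>"
  shows "quadratic_form (\<lambda>f. \<integral>x. \<phi> x \<partial>\<mu> f)"
  using assms
proof (rule bounded_borel_induct)
  show "bounded_class (\<lambda>\<phi>. quadratic_form (\<lambda>f. \<integral>x. \<phi> x \<partial>\<mu> f))"
  proof (rule bounded_classI, goal_cases)
    case (3 \<phi>s \<phi> M)
    show ?case by (rule quadratic_form_tendsto[OF 3(2)]) (rule integral_tendsto[OF 3(1,3-5)])
  qed (simp_all add: integrable_bounded quadratic_form_add quadratic_form_cmult)
qed (simp add: space_mu quadratic_mu)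

lemma abs_integral_le:
  assumes "bounded_borel \<phi>" "\<And>x. \<bar>\<phi> x\<bar> \<le> M"
  shows "\<bar>\<integral>x. \<phi> x \<partial>\<mu> f\<bar> \<le> M * (norm f)\<^sup>2"
proof -
  have "\<bar>\<integral>x. \<phi> x \<partial>\<mu> f\<bar> \<le> (\<integral>x. \<bar>\<phi> x\<bar> \<partial>\<mu> f)"
    by (rule integral_abs_bound)
  also have "\<dots> \<le> (\<integral>x. M \<partial>\<mu> f)"
    using assms by (intro integral_mono integrable_abs integrable_bounded bounded_borel_const) auto
  finally show ?thesis by (simp add: mass_mu space_mu mult.commute)
qed

definition calc :: "(real \<Rightarrow> real) \<Rightarrow> 'a \<Rightarrow> 'a" where
  "calc \<phi> = (SOME X. bounded_linear X \<and>
    (\<forall>f h. inner (X f) h = polar (\<lambda>f. \<integral>x. \<phi> x \<partial>\<mu> f) f h))"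

context
  fixes \<phi> assumes \<phi>: "bounded_borel \<phi>"
begin

lemma calc_props: "bounded_linear (calc \<phi>)"
  "inner (calc \<phi> f) h = polar (\<lambda>f. \<integral>x. \<phi> x \<partial>\<mu> f) f h"
proof -
  obtain M where M: "\<And>x. \<bar>\<phi> x\<bar> \<le> M" using \<phi> by (auto simp: bounded_borel_def)
  have "\<exists>X. bounded_linear X \<and> (\<forall>f h. inner (X f) h = polar (\<lambda>f. \<integral>x. \<phi> x \<partial>\<mu> f) f h)"
    using quadratic_form_operator[OF quadratic_integral[OF \<phi>] abs_integral_le[OF \<phi> M]] by metis
  from someI_ex[OF this] show "bounded_linear (calc \<phi>)"
    "inner (calc \<phi> f) h = polar (\<lambda>f. \<integral>x. \<phi> x \<partial>\<mu> f) f h"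
    unfolding calc_def by auto
qed

lemma calc_sym: "inner (calc \<phi> f) h = inner f (calc \<phi> h)"
  using quadratic_formD(2)[OF quadratic_integral[OF \<phi>]] calc_props(2)
  by (metis inner_commute)

lemma inner_calc_self: "inner (calc \<phi> f) f = (\<integral>x. \<phi> x \<partial>\<mu> f)"
  using calc_props(2) quadratic_formD(1)[OF quadratic_integral[OF \<phi>]] by metis

lemma calc_eqI:
  assumes "linear X" "\<And>f h. inner (X f) h = inner f (X h)"
    and "\<And>f. inner (X f) f = (\<integral>x. \<phi> x \<partial>\<mu> f)"
  shows "calc \<phi> = X"
proof -
  have "inner (calc \<phi> f) h = inner (X f) h" for f h
    using calc_props(2) polar_inner[OF assms(1,2)] assms(3) by simp
  then have "inner (calc \<phi> f - X f) h = 0" for f h by (simp add: inner_diff_left)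
  then have "calc \<phi> f = X f" for f by (metis inner_eq_zero_iff right_minus_eq)
  then show ?thesis by blast
qed

lemmas calc_linear = bounded_linear.linear[OF calc_props(1)]
lemmas calc_addv = linear_add[OF calc_linear]

end

lemma inner_eqI: "(\<And>h. inner u h = inner v h) \<Longrightarrow> u = (v::'a)"
  by (metis inner_diff_left inner_eq_zero_iff right_minus_eq)

lemma calc_cong_integral:
  "bounded_borel \<phi> \<Longrightarrow> bounded_borel \<psi> \<Longrightarrow> (\<And>f. (\<integral>x. \<phi> x \<partial>\<mu> f) = (\<integral>x. \<psi> x \<partial>\<mu> f)) \<Longrightarrow>
    calc \<phi> = calc \<psi>"
  by (intro ext inner_eqI) (simp add: calc_props)

lemma calc_add:
  "bounded_borel \<phi> \<Longrightarrow> bounded_borel \<psi> \<Longrightarrow> calc (\<lambda>x. \<phi> x + \<psi> x) f = calc \<phi> f + calc \<psi> f"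
  by (rule inner_eqI)
     (simp add: calc_props bounded_borel_add inner_add_left integrable_bounded polar_add)

lemma calc_cmult: "bounded_borel \<phi> \<Longrightarrow> calc (\<lambda>x. c * \<phi> x) f = c *\<^sub>R calc \<phi> f"
  by (rule inner_eqI) (simp add: calc_props bounded_borel_cmult polar_cmult)

lemma calc_diff:
  "bounded_borel \<phi> \<Longrightarrow> bounded_borel \<psi> \<Longrightarrow> calc (\<lambda>x. \<phi> x - \<psi> x) f = calc \<phi> f - calc \<psi> f"
  using calc_add[of \<phi> "\<lambda>x. (-1) * \<psi> x" f] calc_cmult[of \<psi> "-1" f] bounded_borel_cmult[of \<psi> "-1"]
  by simp

lemma calc_one: "calc (\<lambda>x. 1) = (\<lambda>f. f)"
  by (rule calc_eqI[OF bounded_borel_const])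
     (simp_all add: linear_iff space_mu mass_mu power2_norm_eq_inner)

lemma inner_calc_tendsto:
  assumes "\<And>n. bounded_borel (\<phi>s n)" "\<And>n x. \<bar>\<phi>s n x\<bar> \<le> M"
    "\<And>x. (\<lambda>n. \<phi>s n x) \<longlonglongrightarrow> \<phi> x" "bounded_borel \<phi>"
  shows "(\<lambda>n. inner (calc (\<phi>s n) f) h) \<longlonglongrightarrow> inner (calc \<phi> f) h"
  unfolding calc_props(2)[OF assms(1)] calc_props(2)[OF assms(4)]
  by (intro polar_tendsto integral_tendsto[OF assms])

text \<open>If \<open>J\<close> is unitary and leaves the measures invariant, then it commutes with the calculus. This
  is used for multiplication by \<open>\<i>\<close>.\<close>

lemma calc_commute:
  assumes \<phi>: "bounded_borel \<phi>" and J: "linear J" "\<And>x y. inner (J x) (J y) = inner x y" "surj J"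
    and inv: "\<And>f. \<mu> (J f) = \<mu> f"
  shows "calc \<phi> (J f) = J (calc \<phi> f)"
proof (rule inner_eqI)
  fix h
  obtain h' where h: "h = J h'" using J(3) by (metis surjD)
  have "inner (calc \<phi> (J f)) (J h') = inner (calc \<phi> f) h'"
    by (simp add: calc_props(2)[OF \<phi>] polar_def inv flip: linear_add[OF J(1)] linear_diff[OF J(1)])
  then show "inner (calc \<phi> (J f)) h = inner (J (calc \<phi> f)) h" by (simp add: h J(2))
qed

text \<open>A relation between \<open>calc \<phi>\<close> and \<open>\<phi>\<close> that is tested by inner products with operators fixed in
  advance has the closure properties of both induction principles.\<close>

lemma bounded_class_calc:
  assumes \<psi>: "bounded_borel \<psi>"
  shows "bounded_class (\<lambda>\<phi>. \<forall>f h. inner (calc (\<lambda>x. \<phi> x * \<psi> x) f) h = inner (calc \<phi> (X f)) (Y h))"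
proof (rule bounded_classI)
  fix \<phi>s \<phi> and M :: real
  assume *: "\<And>n. bounded_borel (\<phi>s n)"
    "\<And>n. \<forall>f h. inner (calc (\<lambda>x. \<phi>s n x * \<psi> x) f) h = inner (calc (\<phi>s n) (X f)) (Y h)"
    "\<And>n x. \<bar>\<phi>s n x\<bar> \<le> M" "\<And>x. (\<lambda>n. \<phi>s n x) \<longlonglongrightarrow> \<phi> x" "bounded_borel \<phi>"
  obtain N where N: "\<And>x. \<bar>\<psi> x\<bar> \<le> N" using \<psi> by (auto simp: bounded_borel_def)
  have 1: "(\<lambda>n. inner (calc (\<phi>s n) (X f)) (Y h)) \<longlonglongrightarrow> inner (calc \<phi> (X f)) (Y h)" for f h
    by (rule inner_calc_tendsto[OF *(1,3-5)])
  have 2: "(\<lambda>n. inner (calc (\<lambda>x. \<phi>s n x * \<psi> x) f) h) \<longlonglongrightarrow> inner (calc (\<lambda>x. \<phi> x * \<psi> x) f) h" for f h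
  proof (rule inner_calc_tendsto[where M = "M * N"])
    show "\<bar>\<phi>s n x * \<psi> x\<bar> \<le> M * N" for n x
      unfolding abs_mult using *(3) N by (meson abs_ge_zero mult_mono order_trans)
    show "(\<lambda>n. \<phi>s n x * \<psi> x) \<longlonglongrightarrow> \<phi> x * \<psi> x" for x by (intro tendsto_intros *)
  qed (intro bounded_borel_mult * \<psi>)+
  show "\<forall>f h. inner (calc (\<lambda>x. \<phi> x * \<psi> x) f) h = inner (calc \<phi> (X f)) (Y h)"
  proof (intro allI)
    fix f h
    have "(\<lambda>n. inner (calc (\<phi>s n) (X f)) (Y h)) \<longlonglongrightarrow> inner (calc (\<lambda>x. \<phi> x * \<psi> x) f) h"
      using 2[of f h] *(2) by simp
    then show "inner (calc (\<lambda>x. \<phi> x * \<psi> x) f) h = inner (calc \<phi> (X f)) (Y h)"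
      using 1[of f h] LIMSEQ_unique by blast
  qed
qed (simp_all add: \<psi> calc_add calc_cmult bounded_borel_mult inner_add_left distrib_right mult.assoc)

text \<open>Multiplicativity spreads from powers to all bounded Borel functions of \<open>u\<close>, in one factor
  at a time.\<close>

lemma calc_mult_powers:
  assumes u: "u \<in> borel_measurable borel" "\<And>x. 0 \<le> u x" "\<And>x. u x \<le> (1::real)"
    and pow: "\<And>m n f. calc (\<lambda>x. u x ^ m * u x ^ n) f = calc (\<lambda>x. u x ^ m) (calc (\<lambda>x. u x ^ n) f)"
    and \<phi>: "bounded_borel \<phi>" and \<psi>: "bounded_borel \<psi>"
  shows "calc (\<lambda>x. \<phi> (u x) * \<psi> (u x)) f = calc (\<lambda>x. \<phi> (u x)) (calc (\<lambda>x. \<psi> (u x)) f)"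
proof -
  have bu: "bounded_borel u" using u by (intro bounded_borelI[where M=1]) auto
  have bun: "bounded_borel (\<lambda>x. u x ^ n)" for n by (intro bounded_borel_power bu)
  have b\<psi>: "bounded_borel (\<lambda>x. \<psi> (u x))" by (rule bounded_borel_comp[OF \<psi> u(1)])
  have step: "\<forall>f h. inner (calc (\<lambda>x. \<psi> (u x) * u x ^ n) f) h
      = inner (calc (\<lambda>x. \<psi> (u x)) f) (calc (\<lambda>x. u x ^ n) h)" for n
  proof (rule bounded_borel_induct_powers[OF \<psi> bounded_class_calc[OF bun, where X = "\<lambda>f. f"] u])
    show "\<forall>f h. inner (calc (\<lambda>x. u x ^ m * u x ^ n) f) h
        = inner (calc (\<lambda>x. u x ^ m) f) (calc (\<lambda>x. u x ^ n) h)" for m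
      using pow[of n m] calc_sym[OF bun] by (simp add: mult.commute)
  qed
  have "\<forall>f h. inner (calc (\<lambda>x. \<phi> (u x) * \<psi> (u x)) f) h
      = inner (calc (\<lambda>x. \<phi> (u x)) (calc (\<lambda>x. \<psi> (u x)) f)) h"
  proof (rule bounded_borel_induct_powers[OF \<phi> bounded_class_calc[OF b\<psi>, where Y = "\<lambda>h. h"] u])
    show "\<forall>f h. inner (calc (\<lambda>x. u x ^ m * \<psi> (u x)) f) h
        = inner (calc (\<lambda>x. u x ^ m) (calc (\<lambda>x. \<psi> (u x)) f)) h" for m
      using step[of m] calc_sym[OF bun] by (simp add: mult.commute)
  qed
  then show ?thesis by (intro inner_eqI) simp
qed

lemma calc_mult_indicators:
  assumes ind: "\<And>A B f. A \<in> sets borel \<Longrightarrow> B \<in> sets borel \<Longrightarrow>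
      calc (indicat_real (A \<inter> B)) f = calc (indicat_real A) (calc (indicat_real B) f)"
    and \<phi>: "bounded_borel \<phi>" and \<psi>: "bounded_borel \<psi>"
  shows "calc (\<lambda>x. \<phi> x * \<psi> x) f = calc \<phi> (calc \<psi> f)"
proof -
  have ind': "calc (\<lambda>x. indicat_real A x * indicat_real B x) f
      = calc (indicat_real A) (calc (indicat_real B) f)"
    if "A \<in> sets borel" "B \<in> sets borel" for A B f
    using ind[OF that] by (simp add: indicator_inter_arith[abs_def])
  have step: "\<forall>f h. inner (calc (\<lambda>x. \<psi> x * indicat_real A x) f) h
      = inner (calc \<psi> f) (calc (indicat_real A) h)" if A: "A \<in> sets borel" for A
  proof (rule bounded_borel_induct[OF \<psi> bounded_class_calc[OF bounded_borel_indicator[OF A], where X = "\<lambda>f. f"]])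
    show "\<forall>f h. inner (calc (\<lambda>x. indicat_real B x * indicat_real A x) f) h
        = inner (calc (indicat_real B) f) (calc (indicat_real A) h)" if "B \<in> sets borel" for B
      using ind'[OF A that] calc_sym[OF bounded_borel_indicator[OF A]] by (simp add: mult.commute)
  qed
  have "\<forall>f h. inner (calc (\<lambda>x. \<phi> x * \<psi> x) f) h = inner (calc \<phi> (calc \<psi> f)) h"
  proof (rule bounded_borel_induct[OF \<phi> bounded_class_calc[OF \<psi>, where Y = "\<lambda>h. h"]])
    show "\<forall>f h. inner (calc (\<lambda>x. indicat_real A x * \<psi> x) f) h
        = inner (calc (indicat_real A) (calc \<psi> f)) h" if "A \<in> sets borel" for A
      using step[OF that] calc_sym[OF bounded_borel_indicator[OF that]] by (simp add: mult.commute)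
  qed
  then show ?thesis by (intro inner_eqI) simp
qed

end

locale multiplicative_family = measure_family +
  assumes calc_mult: "bounded_borel \<phi> \<Longrightarrow> bounded_borel \<psi> \<Longrightarrow> calc (\<lambda>x. \<phi> x * \<psi> x) f = calc \<phi> (calc \<psi> f)"
begin

lemma norm_calc: "bounded_borel \<phi> \<Longrightarrow> (norm (calc \<phi> f))\<^sup>2 = (\<integral>x. (\<phi> x)\<^sup>2 \<partial>\<mu> f)"
  using inner_calc_self[OF bounded_borel_mult, of \<phi> \<phi> f] calc_sym[of \<phi> "calc \<phi> f" f]
  by (simp add: calc_mult power2_norm_eq_inner) (simp add: power2_eq_square inner_commute)

lemma norm_calc_le:
  assumes "bounded_borel \<phi>" "\<And>x. \<bar>\<phi> x\<bar> \<le> M"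
  shows "norm (calc \<phi> f) \<le> M * norm f"
proof (rule power2_le_imp_le)
  have M: "0 \<le> M" using assms(2)[of 0] by linarith
  have "(norm (calc \<phi> f))\<^sup>2 \<le> \<bar>\<integral>x. (\<phi> x)\<^sup>2 \<partial>\<mu> f\<bar>" using norm_calc[OF assms(1)] by simp
  also have "\<dots> \<le> M\<^sup>2 * (norm f)\<^sup>2"
    by (rule abs_integral_le)
       (use assms M in \<open>auto intro: bounded_borel_power simp: abs_le_square_iff[symmetric]\<close>)
  finally show "(norm (calc \<phi> f))\<^sup>2 \<le> (M * norm f)\<^sup>2" by (simp add: power_mult_distrib)
  show "0 \<le> M * norm f" using M by simp
qed

lemma calc_tendsto:
  assumes "\<And>n. bounded_borel (\<phi>s n)" "\<And>n x. \<bar>\<phi>s n x\<bar> \<le> M"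
    "\<And>x. (\<lambda>n. \<phi>s n x) \<longlonglongrightarrow> \<phi> x" "bounded_borel \<phi>"
  shows "(\<lambda>n. calc (\<phi>s n) f) \<longlonglongrightarrow> calc \<phi> f"
proof -
  obtain L where L: "\<And>x. \<bar>\<phi> x\<bar> \<le> L" using assms(4) by (auto simp: bounded_borel_def)
  have b: "bounded_borel (\<lambda>x. \<phi>s n x - \<phi> x)" for n by (intro bounded_borel_diff assms)
  have "(\<lambda>n. \<integral>x. (\<phi>s n x - \<phi> x)\<^sup>2 \<partial>\<mu> f) \<longlonglongrightarrow> (\<integral>x. 0 \<partial>\<mu> f)"
  proof (rule integral_tendsto[where M = "(M + L)\<^sup>2"])
    have "\<bar>\<phi>s n x - \<phi> x\<bar> \<le> M + L" for n x
      by (meson L abs_triangle_ineq4 add_mono assms(2) order_trans)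
    then show "\<bar>(\<phi>s n x - \<phi> x)\<^sup>2\<bar> \<le> (M + L)\<^sup>2" for n x
      using power_mono[of "\<bar>\<phi>s n x - \<phi> x\<bar>" "M + L" 2] by simp
    show "(\<lambda>n. (\<phi>s n x - \<phi> x)\<^sup>2) \<longlonglongrightarrow> 0" for x
      using tendsto_power[OF tendsto_diff[OF assms(3)[of x] tendsto_const], of "\<phi> x" 2] by simp
  qed (intro bounded_borel_power b bounded_borel_const)+
  moreover have "(\<integral>x. (\<phi>s n x - \<phi> x)\<^sup>2 \<partial>\<mu> f) = (norm (calc (\<phi>s n) f - calc \<phi> f))\<^sup>2" for n
    using norm_calc[OF b, of n f] by (simp add: calc_diff assms)
  ultimately have "(\<lambda>n. (norm (calc (\<phi>s n) f - calc \<phi> f))\<^sup>2) \<longlonglongrightarrow> 0" by simp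
  from tendsto_real_sqrt[OF this] have "(\<lambda>n. norm (calc (\<phi>s n) f - calc \<phi> f)) \<longlonglongrightarrow> 0" by simp
  then show ?thesis by (simp only: LIM_zero_iff tendsto_norm_zero_iff)
qed

end


section \<open>The Hausdorff moment problem\<close>

context
  fixes a :: "nat \<Rightarrow> nat \<Rightarrow> real"
  assumes nonneg: "\<And>k l. 0 \<le> a k l" and rec: "\<And>k l. a k l = a (Suc k) l + a k (Suc l)"
begin

text \<open>This is \<open>B\<^sup>m (1 - B)\<^sup>j = (B + (1 - B))\<^sup>n B\<^sup>m (1 - B)\<^sup>j\<close> for an abstract moment array.\<close>

lemma moment_binomial_sum: "(\<Sum>k\<le>n. real (n choose k) * a (m + k) (n - k + j)) = a m j"
proof (induction n arbitrary: m j)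
  case (Suc n)
  define g where "g k = a (m + k) (Suc n - k + j)" for k
  have 1: "(\<Sum>k\<le>n. real (n choose k) * g (Suc k)) = a (Suc m) j"
    using Suc[of "Suc m" j] by (simp add: g_def)
  have "(\<Sum>k\<le>n. real (n choose k) * g k) = (\<Sum>k\<le>n. real (n choose k) * a (m + k) (n - k + Suc j))"
    by (intro sum.cong) (auto simp: g_def Suc_diff_le)
  then have 2: "(\<Sum>k\<le>n. real (n choose k) * g k) = a m (Suc j)" by (simp only: Suc)
  have 3: "(\<Sum>k\<le>n. real (n choose k) * g k) = g 0 + (\<Sum>k\<le>n. real (n choose Suc k) * g (Suc k))"
    using sum.atMost_Suc_shift[of "\<lambda>k. real (n choose k) * g k" n]
    by (simp add: binomial_eq_0)
  have "(\<Sum>k\<le>Suc n. real (Suc n choose k) * g k)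
      = g 0 + (\<Sum>k\<le>n. real (n choose k) * g (Suc k) + real (n choose Suc k) * g (Suc k))"
    by (subst sum.atMost_Suc_shift) (simp add: distrib_right)
  also have "\<dots> = a (Suc m) j + a m (Suc j)" using 1 2 3 by (simp add: sum.distrib)
  finally show ?case using rec[of m j] by (simp add: g_def)
qed simp

lemma binomial_falling:
  assumes "m \<le> k" "k \<le> n"
  shows "real (n choose k) * (\<Prod>i<m. real k - real i)
    = real ((n - m) choose (k - m)) * (\<Prod>i<m. real n - real i)"
  using assms(1)
proof (induction m)
  case (Suc m)
  obtain k' where k': "k - m = Suc k'" using Suc.prems by (metis Suc_diff_Suc Suc_le_lessD)
  obtain n' where n': "n - m = Suc n'" using Suc.prems assms(2) by (metis Suc_diff_Suc Suc_le_lessD le_trans)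
  have absorb: "real ((n - m) choose (k - m)) * (real k - real m)
      = real ((n - Suc m) choose (k - Suc m)) * (real n - real m)"
  proof -
    have "k - Suc m = k'" "n - Suc m = n'" using k' n' by auto
    moreover have "real k - real m = real (Suc k')" "real n - real m = real (Suc n')"
      using k' n' Suc.prems assms(2) by linarith+
    moreover have "real (Suc k' * (Suc n' choose Suc k')) = real (Suc n' * (n' choose k'))"
      by (simp only: Suc_times_binomial)
    ultimately show ?thesis by (simp only: k' n' of_nat_mult mult.commute)
  qed
  have "real (n choose k) * (\<Prod>i<Suc m. real k - real i)
      = real ((n - m) choose (k - m)) * (\<Prod>i<m. real n - real i) * (real k - real m)"
    using Suc by simp
  also have "\<dots> = (\<Prod>i<m. real n - real i) * (real ((n - m) choose (k - m)) * (real k - real m))"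
    by (simp only: mult_ac)
  also have "\<dots> = real ((n - Suc m) choose (k - Suc m)) * (\<Prod>i<Suc m. real n - real i)"
    unfolding absorb by (simp add: mult_ac)
  finally show ?case .
qed simp

text \<open>Falling factorials instead of powers make the discrete moments exact.\<close>

lemma moment_falling_sum:
  assumes "m \<le> n"
  shows "(\<Sum>k\<le>n. (\<Prod>i<m. (real k - real i) / (real n - real i)) * (real (n choose k) * a k (n - k))) = a m 0"
proof -
  have pos: "(\<Prod>i<m. real n - real i) \<noteq> 0" using assms by simp
  let ?t = "\<lambda>k. (\<Prod>i<m. (real k - real i) / (real n - real i)) * (real (n choose k) * a k (n - k))"
  have z: "?t k = 0" if "k < m" for k using that by auto
  have "(\<Sum>k\<le>n. ?t k) = (\<Sum>k\<in>{m..n}. ?t k)"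
    by (rule sum.mono_neutral_right) (auto intro!: z simp: not_le simp del: mult_eq_0_iff)
  also have "\<dots> = (\<Sum>k\<in>{m..n}. real ((n - m) choose (k - m)) * a k (n - k))"
  proof (rule sum.cong)
    fix k assume "k \<in> {m..n}"
    then have "real (n choose k) * (\<Prod>i<m. real k - real i)
        = real ((n - m) choose (k - m)) * (\<Prod>i<m. real n - real i)"
      using binomial_falling[of m k n] by auto
    then have "(\<Prod>i<m. real k - real i) / (\<Prod>i<m. real n - real i) * real (n choose k)
        = real ((n - m) choose (k - m))"
      using pos by (simp add: field_simps)
    then show "?t k = real ((n - m) choose (k - m)) * a k (n - k)"
      by (simp add: prod_dividef mult.assoc[symmetric])
  qed simp
  also have "\<dots> = (\<Sum>k\<le>n - m. real ((n - m) choose k) * a (m + k) (n - m - k + 0))"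
    by (rule sum.reindex_bij_witness[of _ "\<lambda>k. m + k" "\<lambda>k. k - m"]) (use assms in auto)
  also have "\<dots> = a m 0" by (rule moment_binomial_sum)
  finally show ?thesis .
qed

lemma falling_power_diff:
  assumes "k \<le> n" "2 * m < n"
  shows "\<bar>(\<Prod>i<m. (real k - real i) / (real n - real i)) - (real k / real n) ^ m\<bar> \<le> m * (m / (real n - m))"
proof -
  have "\<bar>(\<Prod>i<m. (real k - real i) / (real n - real i)) - (\<Prod>i<m. real k / real n)\<bar>
      \<le> (\<Sum>i<m. \<bar>(real k - real i) / (real n - real i) - real k / real n\<bar>)"
    unfolding real_norm_def[symmetric]
    by (rule norm_prod_diff) (use assms in \<open>auto simp: abs_le_iff divide_le_eq field_simps\<close>)
  also have "\<dots> \<le> (\<Sum>i<m. m / (real n - m))"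
  proof (rule sum_mono)
    fix i assume i: "i \<in> {..<m}"
    have n0: "0 < real n" "0 < real n - i" "0 < real n - m" using assms i by auto
    have "(real k - real i) / (real n - real i) - real k / real n
        = - (i * ((real n - k) / n) / (real n - i))"
      using n0 by (simp add: field_simps)
    then have "\<bar>(real k - real i) / (real n - real i) - real k / real n\<bar>
        = i * ((real n - k) / n) / (real n - i)" using n0 assms by simp
    also have "\<dots> \<le> real m * 1 / (real n - m)"
    proof (rule frac_le)
      show "real i * ((real n - k) / n) \<le> real m * 1"
        using n0 assms i by (intro mult_mono) auto
    qed (use n0 i in auto)
    finally show "\<bar>(real k - real i) / (real n - real i) - real k / real n\<bar> \<le> m / (real n - m)" by simp
  qed
  finally show ?thesis by simp
qed

lemma moment_limit:
  "(\<lambda>n. \<Sum>k\<le>n. (real k / real n) ^ m * (real (n choose k) * a k (n - k))) \<longlonglongrightarrow> a m 0"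
proof -
  have total: "(\<Sum>k\<le>n. real (n choose k) * a k (n - k)) = a 0 0" for n
    using moment_binomial_sum[of n 0 0] by simp
  have bound: "\<bar>(\<Sum>k\<le>n. (real k / real n) ^ m * (real (n choose k) * a k (n - k))) - a m 0\<bar>
      \<le> m * (m / (real n - m)) * a 0 0" if n: "2 * m < n" for n
  proof -
    let ?w = "\<lambda>k. real (n choose k) * a k (n - k)"
    let ?p = "\<lambda>k. \<Prod>i<m. (real k - real i) / (real n - real i)"
    have eq: "(\<Sum>k\<le>n. (real k / real n) ^ m * ?w k) - a m 0
        = (\<Sum>k\<le>n. ((real k / real n) ^ m - ?p k) * ?w k)"
      using n by (subst moment_falling_sum[of m n, symmetric]) (simp_all add: left_diff_distrib sum_subtractf)
    have "\<bar>(\<Sum>k\<le>n. (real k / real n) ^ m * ?w k) - a m 0\<bar>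
        \<le> (\<Sum>k\<le>n. \<bar>((real k / real n) ^ m - ?p k) * ?w k\<bar>)"
      unfolding eq by (rule sum_abs)
    also have "\<dots> \<le> (\<Sum>k\<le>n. m * (m / (real n - m)) * ?w k)"
    proof (rule sum_mono)
      fix k assume "k \<in> {..n}"
      then have "k \<le> n" by simp
      have "\<bar>(real k / real n) ^ m - ?p k\<bar> \<le> m * (m / (real n - m))"
        by (subst abs_minus_commute) (rule falling_power_diff[OF \<open>k \<le> n\<close> n])
      then have "\<bar>(real k / real n) ^ m - ?p k\<bar> * ?w k \<le> m * (m / (real n - m)) * ?w k"
        by (rule mult_right_mono) (simp add: nonneg)
      then show "\<bar>((real k / real n) ^ m - ?p k) * ?w k\<bar> \<le> m * (m / (real n - m)) * ?w k"
        by (subst abs_mult, subst (2) abs_of_nonneg) (simp_all only: nonneg mult_nonneg_nonneg of_nat_0_le_iff)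
    qed
    finally show ?thesis by (simp only: sum_distrib_left[symmetric] total)
  qed
  have null: "(\<lambda>n. m * (m / (real n - m)) * a 0 0) \<longlonglongrightarrow> 0"
    by real_asymp
  have "\<forall>\<^sub>F n in sequentially. \<bar>(\<Sum>k\<le>n. (real k / real n) ^ m * (real (n choose k) * a k (n - k))) - a m 0\<bar>
      \<le> m * (m / (real n - m)) * a 0 0"
    using eventually_gt_at_top[of "2 * m"] by (rule eventually_mono) (rule bound)
  then have "(\<lambda>n. (\<Sum>k\<le>n. (real k / real n) ^ m * (real (n choose k) * a k (n - k))) - a m 0) \<longlonglongrightarrow> 0"
    unfolding real_norm_def[symmetric] by (rule Lim_null_comparison[OF _ null])
  then show ?thesis by (simp add: LIM_zero_iff)
qed

text \<open>The weights \<open>(n choose k) * a k (n - k)\<close> at the points \<open>k / n\<close> form discrete measures whose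
  moments converge; a weak limit point exists by Helly selection.\<close>

theorem hausdorff_moment:
  obtains M :: "real measure" where "sets M = sets borel" "finite_measure M"
    "AE x in M. 0 \<le> x \<and> x \<le> 1" "\<And>m. (\<integral>x. x ^ m \<partial>M) = a m 0"
proof (cases "a 0 0 = 0")
  case True
  have "a m 0 = 0" for m
  proof (induction m)
    case (Suc m)
    then show ?case using rec[of m 0] nonneg[of "Suc m" 0] nonneg[of m 1] by simp
  qed (rule True)
  then show thesis
    using that[of "null_measure borel"]
    by (simp add: finite_measureI AE_I'[of UNIV] null_setsI)
next
  case False
  define c where "c = a 0 0"
  have c: "0 < c" using False nonneg[of 0 0] by (simp add: c_def)
  define w where "w n k = real (n choose k) * a k (n - k) / c" for n k
  have w0: "0 \<le> w n k" for n k using c nonneg by (simp add: w_def)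
  have w1: "(\<Sum>k\<le>n. w n k) = 1" for n
    using moment_binomial_sum[of n 0 0] c by (simp add: w_def c_def flip: sum_divide_distrib)
  define D where "D n = point_measure {..n} (\<lambda>k. ennreal (w n k))" for n
  define N where "N n = distr (D n) borel (\<lambda>k. real k / real n)" for n
  have meas: "f \<in> measurable (D n) borel" for f :: "nat \<Rightarrow> real" and n
    by (simp add: D_def measurable_point_measure_eq1)
  have probD: "prob_space (D n)" for n
    unfolding D_def
    by (intro prob_spaceI) (simp add: space_point_measure emeasure_point_measure_finite w0 w1 sum_ennreal)
  have distN: "real_distribution (N n)" for n
    unfolding N_def by (intro prob_space.real_distribution_distr probD meas)
  have intN: "(\<integral>x. f x \<partial>N n) = (\<Sum>k\<le>n. w n k * f (real k / real n))"
    if f: "f \<in> borel_measurable borel" for f :: "real \<Rightarrow> real" and n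
  proof -
    have "(\<integral>x. f x \<partial>N n) = (\<integral>k. f (real k / real n) \<partial>D n)"
      unfolding N_def by (intro integral_distr meas f)
    also have "\<dots> = (\<Sum>k\<le>n. w n k * f (real k / real n))"
      unfolding D_def using w0 by (subst lebesgue_integral_point_measure_finite) auto
    finally show ?thesis .
  qed
  have "tight N"
    unfolding tight_def
  proof (intro conjI allI impI)
    fix e :: real assume "0 < e"
    \<comment> \<open>All the measures live on \<open>[0, 1]\<close>.\<close>
    have "measure (N n) {-1<..1} = 1" for n
    proof -
      interpret real_distribution "N n" by (rule distN)
      have "measure (N n) {-1<..1} = (\<integral>x. indicat_real {-1<..1} x \<partial>N n)" by simp
      also have "\<dots> = (\<Sum>k\<le>n. w n k * 1)"
        by (subst intN) (auto intro!: sum.cong simp: indicator_def divide_le_eq_1 less_le_trans[of "-1" 0])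
      finally show ?thesis using w1 by simp
    qed
    then show "\<exists>l u. l < u \<and> (\<forall>n. 1 - e < measure (N n) {l<..u})"
      using \<open>0 < e\<close> by (intro exI[of _ "-1"] exI[of _ 1]) simp
  qed (rule distN)
  then obtain r M where r: "strict_mono (r :: nat \<Rightarrow> nat)" and M: "real_distribution M"
      and weak: "weak_conv_m (N \<circ> id \<circ> r) M"
    using tight_imp_convergent_subsubsequence[of N id] strict_mono_id by blast
  interpret M: real_distribution M by (rule M)
  define cl where "cl x = max 0 (min 1 x)" for x :: real
  have clm[measurable]: "cl \<in> borel_measurable borel" unfolding cl_def[abs_def] by measurable
  have cl01: "0 \<le> cl x" "cl x \<le> 1" for x by (auto simp: cl_def)
  have moments: "(\<integral>x. cl x ^ m \<partial>M) = a m 0 / c" for m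
  proof (rule LIMSEQ_unique)
    have "(\<lambda>n. \<integral>x. cl x ^ m \<partial>(N \<circ> id \<circ> r) n) \<longlonglongrightarrow> (\<integral>x. cl x ^ m \<partial>M)"
    proof (rule weak_conv_imp_integral_bdd_continuous_conv[OF _ M weak, where B = 1])
      show "real_distribution ((N \<circ> id \<circ> r) n)" for n using distN by simp
      show "isCont (\<lambda>x. cl x ^ m) x" for x unfolding cl_def by (intro continuous_intros)
      show "norm (cl x ^ m) \<le> 1" for x using cl01[of x] by (simp add: power_le_one)
    qed
    then show "(\<lambda>n. \<integral>x. cl x ^ m \<partial>N (r n)) \<longlonglongrightarrow> (\<integral>x. cl x ^ m \<partial>M)" by simp
    have "(\<integral>x. cl x ^ m \<partial>N n) = (\<Sum>k\<le>n. (real k / real n) ^ m * (real (n choose k) * a k (n - k))) / c" for n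
    proof -
      have "(\<integral>x. cl x ^ m \<partial>N n) = (\<Sum>k\<le>n. w n k * cl (real k / real n) ^ m)"
        by (rule intN) measurable
      also have "\<dots> = (\<Sum>k\<le>n. (real k / real n) ^ m * (real (n choose k) * a k (n - k)) / c)"
      proof (intro sum.cong refl)
        fix k assume "k \<in> {..n}"
        then have "real k / real n \<le> 1" by (cases "n = 0") (auto simp: divide_le_eq_1)
        then have "cl (real k / real n) = real k / real n" by (simp add: cl_def)
        then show "w n k * cl (real k / real n) ^ m
            = (real k / real n) ^ m * (real (n choose k) * a k (n - k)) / c"
          by (simp add: w_def)
      qed
      finally show ?thesis by (simp add: sum_divide_distrib)
    qed
    then have "(\<lambda>n. \<integral>x. cl x ^ m \<partial>N n) \<longlonglongrightarrow> a m 0 / c"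
      using tendsto_divide[OF moment_limit[of m] tendsto_const, of c] c by simp
    from LIMSEQ_subseq_LIMSEQ[OF this r]
    show "(\<lambda>n. \<integral>x. cl x ^ m \<partial>N (r n)) \<longlonglongrightarrow> a m 0 / c" by (simp add: o_def)
  qed
  \<comment> \<open>Clamping moves the weak limit onto \<open>[0, 1]\<close> without a separate discussion of its support.\<close>
  define M' where "M' = density (distr M borel cl) (\<lambda>x. ennreal c)"
  show thesis
  proof
    show s: "sets M' = sets borel" by (simp add: M'_def)
    have sp: "space M' = UNIV" by (simp add: M'_def)
    have "emeasure M' (space M') = ennreal c * emeasure (distr M borel cl) UNIV"
      unfolding sp by (simp add: M'_def emeasure_density_const)
    also have "\<dots> = ennreal c"
      using M.emeasure_space_1 by (simp add: emeasure_distr)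
    finally show "finite_measure M'" by (intro finite_measureI) simp
    show "AE x in M'. 0 \<le> x \<and> x \<le> 1"
      unfolding M'_def by (subst AE_density) (auto simp: AE_distr_iff cl01)
    show "(\<integral>x. x ^ m \<partial>M') = a m 0" for m
    proof -
      have "(\<integral>x. x ^ m \<partial>M') = c * (\<integral>x. x ^ m \<partial>distr M borel cl)"
        unfolding M'_def using c by (subst integral_density) auto
      also have "(\<integral>x. x ^ m \<partial>distr M borel cl) = (\<integral>x. cl x ^ m \<partial>M)"
        by (subst integral_distr) auto
      finally show ?thesis using moments c by simp
    qed
  qed
qed

end


section \<open>Moment measures of a positive contraction\<close>

locale positive_contraction =
  fixes B :: "'a::{real_inner,complete_space} \<Rightarrow> 'a"
  assumes linear_B: "linear B"
    and sym_B: "inner (B f) h = inner f (B h)"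
    and pos_B: "0 \<le> inner (B f) f"
    and le1_B: "inner (B f) f \<le> inner f f"
begin

lemma linear_power: "linear (B ^^ n)"
  by (induction n) (simp_all add: linear_id linear_compose[unfolded o_def] linear_B o_def flip: id_def)

lemma sym_power: "inner ((B ^^ n) f) h = inner f ((B ^^ n) h)"
  by (induction n arbitrary: f h) (simp_all add: sym_B funpow_swap1)

text \<open>Squares can be moved to the other side of the inner product; what remains is \<open>B (1 - B)\<close>,
  which is \<open>B (1 - B)\<^sup>2 + (1 - B) B\<^sup>2\<close>.\<close>

lemma power_products_nonneg:
  defines "C \<equiv> \<lambda>f. f - B f"
  shows "0 \<le> inner ((B ^^ k) ((C ^^ l) f)) f"
proof -
  have symC: "inner (C f) h = inner f (C h)" for f h
    by (simp add: C_def inner_diff_left inner_diff_right sym_B)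
  have posC: "0 \<le> inner (C f) f" for f using le1_B by (simp add: C_def inner_diff_left)
  have BC: "C (B f) = B (C f)" for f by (simp add: C_def linear_diff[OF linear_B])
  have BCl: "(C ^^ l) (B f) = B ((C ^^ l) f)" for l f
    by (induction l) (simp_all add: BC)
  have BkC: "(B ^^ k) (C f) = C ((B ^^ k) f)" for k f
    by (induction k) (simp_all add: BC)
  show ?thesis
  proof (induction "k + l" arbitrary: k l f rule: less_induct)
    case less
    consider k' where "k = Suc (Suc k')" | l' where "l = Suc (Suc l')"
      | "k = 0" "l = 0" | "k = 1" "l = 0" | "k = 0" "l = 1" | "k = 1" "l = 1"
      by (metis One_nat_def not0_implies_Suc)
    then show ?case
    proof cases
      case 1
      have "inner ((B ^^ k) ((C ^^ l) f)) f = inner (B ((B ^^ k') ((C ^^ l) (B f)))) f"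
        by (simp add: 1 BCl funpow_swap1)
      then show ?thesis using less[of k' l "B f"] 1 by (simp add: sym_B)
    next
      case 2
      have "(C ^^ l) f = C ((C ^^ l') (C f))" by (simp add: 2 funpow_swap1)
      then have "inner ((B ^^ k) ((C ^^ l) f)) f = inner (C ((B ^^ k) ((C ^^ l') (C f)))) f"
        by (simp only: BkC)
      then show ?thesis using less[of k l' "C f"] 2 by (simp add: symC)
    next
      case 6
      have "inner (B (C f)) f = inner (B (C (B f))) f + inner (B (C (C f))) f"
        by (simp add: C_def linear_diff[OF linear_B] inner_diff_left)
      also have "inner (B (C (B f))) f = inner (C (B f)) (B f)" by (rule sym_B)
      also have "inner (B (C (C f))) f = inner (B (C f)) (C f)" by (simp flip: BC symC)
      finally show ?thesis using 6 posC[of "B f"] pos_B[of "C f"] by simp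
    qed (simp_all add: pos_B posC)
  qed
qed

lemma moment_measure_exists:
  "\<exists>M. sets M = sets borel \<and> finite_measure M \<and> (AE x in M. 0 \<le> x \<and> x \<le> 1) \<and>
     (\<forall>n. (\<integral>x. x ^ n \<partial>M) = inner ((B ^^ n) f) f)"
proof -
  define C where "C = (\<lambda>f. f - B f)"
  define a where "a k l = inner ((B ^^ k) ((C ^^ l) f)) f" for k l
  have nonneg: "0 \<le> a k l" for k l
    using power_products_nonneg unfolding a_def C_def .
  have rec: "a k l = a (Suc k) l + a k (Suc l)" for k l
    by (simp add: a_def C_def linear_diff[OF linear_power] inner_diff_left funpow_swap1)
  obtain M where "sets M = sets borel" "finite_measure M"
    "AE x in M. 0 \<le> x \<and> x \<le> 1" "\<And>m. (\<integral>x. x ^ m \<partial>M) = a m 0"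
    using hausdorff_moment[of a, OF nonneg rec] by blast
  then show ?thesis by (auto simp: a_def)
qed

definition moment_measure :: "'a \<Rightarrow> real measure" where
  "moment_measure f = (SOME M. sets M = sets borel \<and> finite_measure M \<and>
     (AE x in M. 0 \<le> x \<and> x \<le> 1) \<and> (\<forall>n. (\<integral>x. x ^ n \<partial>M) = inner ((B ^^ n) f) f))"

lemma moment_measure:
  "sets (moment_measure f) = sets borel" "finite_measure (moment_measure f)"
  "AE x in moment_measure f. 0 \<le> x \<and> x \<le> 1"
  "(\<integral>x. x ^ n \<partial>moment_measure f) = inner ((B ^^ n) f) f"
  using someI_ex[OF moment_measure_exists[of f]] unfolding moment_measure_def by auto

definition clamp01 :: "real \<Rightarrow> real" where "clamp01 x = max 0 (min 1 x)"

lemma clamp01: "clamp01 \<in> borel_measurable borel" "0 \<le> clamp01 x" "clamp01 x \<le> 1"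
  unfolding clamp01_def[abs_def] by auto

sublocale borel_family moment_measure
  by (rule borel_family.intro) (rule moment_measure)+

lemma integral_clamp01:
  assumes "\<phi> \<in> borel_measurable borel"
  shows "(\<integral>x. \<phi> (clamp01 x) \<partial>moment_measure f) = (\<integral>x. \<phi> x \<partial>moment_measure f)"
proof (rule integral_cong_AE)
  show "(\<lambda>x. \<phi> (clamp01 x)) \<in> borel_measurable (moment_measure f)"
    unfolding measurable_mu by (rule measurable_compose[OF clamp01(1) assms])
  show "\<phi> \<in> borel_measurable (moment_measure f)" unfolding measurable_mu by (rule assms)
  show "AE x in moment_measure f. \<phi> (clamp01 x) = \<phi> x"
    using moment_measure(3)[of f] by eventually_elim (simp add: clamp01_def)
qed

text \<open>The moments depend on \<open>f\<close> as quadratic forms, hence so do all integrals.\<close>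

lemma measure_family_moments: "measure_family moment_measure"
proof (rule measure_family.intro[OF borel_family_axioms], unfold_locales)
  let ?\<mu> = moment_measure
  show "measure (?\<mu> f) UNIV = (norm f)\<^sup>2" for f
    using moment_measure(4)[of f 0] by (simp add: space_mu power2_norm_eq_inner)
  fix A :: "real set" assume A: "A \<in> sets borel"
  have "quadratic_form (\<lambda>f. \<integral>x. indicat_real A (clamp01 x) \<partial>?\<mu> f)"
  proof (rule bounded_borel_induct_powers[OF bounded_borel_indicator[OF A] _ clamp01,
        where P = "\<lambda>\<phi>. quadratic_form (\<lambda>f. \<integral>x. \<phi> x \<partial>?\<mu> f)"])
    show "bounded_class (\<lambda>\<phi>. quadratic_form (\<lambda>f. \<integral>x. \<phi> x \<partial>?\<mu> f))"
    proof (rule bounded_classI, goal_cases)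
      case (3 \<phi>s \<phi> M)
      show ?case by (rule quadratic_form_tendsto[OF 3(2)]) (rule integral_tendsto[OF 3(1,3-5)])
    qed (simp_all add: integrable_bounded quadratic_form_add quadratic_form_cmult)
    show "quadratic_form (\<lambda>f. \<integral>x. clamp01 x ^ n \<partial>?\<mu> f)" for n
      using quadratic_form_inner[OF linear_power sym_power]
      by (simp add: integral_clamp01[of "\<lambda>x. x ^ n"] moment_measure)
  qed
  then show "quadratic_form (\<lambda>f. measure (?\<mu> f) A)"
    using A by (simp add: integral_clamp01 space_mu)
qed

end


section \<open>The real structure of a complex Hilbert space\<close>

lemma cinner_scaleC_right: "cinner x (a *\<^sub>C y) = cnj a * cinner x (y :: 'a::complex_inner)"
  by (metis cinner_commute cinner_scaleC_left complex_cnj_mult)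

text \<open>Multiplication by \<open>\<i>\<close> recovers the Hermitian form from the real inner product, so that the
  spectral theory can be developed for the real inner product and quadratic forms over the reals.\<close>

lemma cinner_eq: "cinner x y = Complex (inner x y) (inner x (\<i> *\<^sub>C (y :: 'a::complex_inner)))"
  by (simp add: complex_eq_iff cinner_scaleC_right flip: Re_cinner)

lemma scaleC_eq: "a *\<^sub>C x = Re a *\<^sub>R x + Im a *\<^sub>R \<i> *\<^sub>C (x :: 'a::complex_inner)"
proof -
  have "a *\<^sub>C x = (complex_of_real (Re a) + complex_of_real (Im a) * \<i>) *\<^sub>C x"
    by (rule arg_cong[where f = "\<lambda>b. b *\<^sub>C x"]) (simp add: complex_eq_iff)
  then show ?thesis by (simp add: scaleC_add_left scaleC_of_real flip: scaleC_scaleC)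
qed

lemma inner_i_i: "inner (\<i> *\<^sub>C x) (\<i> *\<^sub>C y) = inner x (y :: 'a::complex_inner)"
  by (simp add: cinner_scaleC_left cinner_scaleC_right flip: Re_cinner)

lemma i_i: "\<i> *\<^sub>C \<i> *\<^sub>C x = - (x :: 'a::complex_inner)"
  using scaleC_of_real[of "-1" x] by (simp add: scaleC_scaleC)

lemma inner_i_left: "inner (\<i> *\<^sub>C x) y = - inner x (\<i> *\<^sub>C (y :: 'a::complex_inner))"
  by (simp add: cinner_scaleC_left cinner_scaleC_right flip: Re_cinner)

lemma norm_i: "norm (\<i> *\<^sub>C x) = norm (x :: 'a::complex_inner)"
  by (simp add: norm_eq_sqrt_inner inner_i_i)

lemma scaleC_minus: "a *\<^sub>C (- x) = - (a *\<^sub>C (x :: 'a::complex_inner))"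
  by (metis add.right_inverse add_cancel_right_right add_eq_0_iff scaleC_add_right)

lemma linear_i: "linear (\<lambda>x. \<i> *\<^sub>C (x :: 'a::complex_inner))"
  by (rule linearI) (simp_all add: scaleC_add_right scaleC_scaleC mult.commute flip: scaleC_of_real)

lemma surj_i: "surj (\<lambda>x. \<i> *\<^sub>C (x :: 'a::complex_inner))"
  by (rule surjI[of _ "\<lambda>x. - (\<i> *\<^sub>C x)"]) (simp add: scaleC_minus i_i)

lemma adjoint_oper_iff:
  "(y, z) \<in> adjoint_oper T \<longleftrightarrow> (\<forall>x w. (x, w) \<in> T \<longrightarrow> cinner w y = cinner x z)"
  by (auto simp: adjoint_oper_def)


section \<open>Truncation\<close>

definition level :: "(real \<Rightarrow> real) \<Rightarrow> nat \<Rightarrow> real set" where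
  "level \<phi> n = {x. \<bar>\<phi> x\<bar> \<le> real n}"

definition trunc :: "(real \<Rightarrow> real) \<Rightarrow> nat \<Rightarrow> real \<Rightarrow> real" where
  "trunc \<phi> n x = indicat_real (level \<phi> n) x * \<phi> x"

lemma indicator_level_tendsto: "(\<lambda>n. indicat_real (level \<phi> n) x) \<longlonglongrightarrow> 1"
proof (rule tendsto_eventually)
  obtain N where "\<bar>\<phi> x\<bar> \<le> real N" using real_arch_simple by blast
  then have "\<forall>n\<ge>N. indicat_real (level \<phi> n) x = 1"
    by (auto simp: level_def indicator_def)
  then show "\<forall>\<^sub>F n in sequentially. indicat_real (level \<phi> n) x = 1"
    by (auto simp: eventually_sequentially)
qed

lemma trunc_tendsto: "(\<lambda>n. trunc \<phi> n x) \<longlonglongrightarrow> \<phi> x"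
  using tendsto_mult_right[OF indicator_level_tendsto, of \<phi> x "\<phi> x"] by (simp add: trunc_def)

lemma abs_trunc_le: "\<bar>trunc \<phi> n x\<bar> \<le> \<bar>\<phi> x\<bar>" "\<bar>trunc \<phi> n x\<bar> \<le> real n"
  by (auto simp: trunc_def level_def indicator_def)

lemma indicator_mult_trunc: "indicat_real (level \<phi> m) x * trunc \<phi> n x = trunc \<phi> (min m n) x"
  by (auto simp: trunc_def level_def indicator_def)

section \<open>Projection-valued measures\<close>

lemma sum_lessThan_4: "(\<Sum>k<4. f k) = f 0 + f 1 + f 2 + f (3::nat)"
  by (simp add: numeral_eq_Suc)

locale pvm =
  fixes E :: "real set \<Rightarrow> 'a::chilbert_space \<Rightarrow> 'a"
  assumes pvm: "projection_valued_measure E"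
begin

lemma orth: "A \<in> sets borel \<Longrightarrow> orth_projection (E A)"
  using pvm by (simp add: projection_valued_measure_def)

lemma E_add: "A \<in> sets borel \<Longrightarrow> E A (x + y) = E A x + E A y"
  and E_scaleC: "A \<in> sets borel \<Longrightarrow> E A (a *\<^sub>C x) = a *\<^sub>C E A x"
  and E_idem: "A \<in> sets borel \<Longrightarrow> E A (E A x) = E A x"
  using orth[of A] by (simp_all add: orth_projection_def)

lemma E_linear: "A \<in> sets borel \<Longrightarrow> linear (E A)"
  by (rule linearI) (simp_all add: E_add E_scaleC flip: scaleC_of_real)

lemma E_sym: "A \<in> sets borel \<Longrightarrow> inner (E A x) y = inner x (E A y)"
  using orth[of A] by (simp add: orth_projection_def flip: Re_cinner)

lemma E_Int: "A \<in> sets borel \<Longrightarrow> B \<in> sets borel \<Longrightarrow> E (A \<inter> B) x = E A (E B x)"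
  using pvm by (simp add: projection_valued_measure_def)

lemma E_UNIV: "E UNIV x = x"
  using pvm by (simp add: projection_valued_measure_def)

lemma E_sums:
  "range A \<subseteq> sets borel \<Longrightarrow> disjoint_family A \<Longrightarrow> (\<lambda>n. E (A n) f) sums E (\<Union>n. A n) f"
  using pvm by (simp add: projection_valued_measure_def)

lemma E_empty: "E {} f = 0"
proof -
  have "(\<lambda>n. E {} f) sums E {} f"
    using E_sums[of "\<lambda>n::nat. {}"] by (simp add: disjoint_family_on_def)
  then show ?thesis using sums_summable summable_const_iff by blast
qed

lemma inner_E_self: "A \<in> sets borel \<Longrightarrow> inner (E A f) f = (norm (E A f))\<^sup>2"
  by (metis E_idem E_sym power2_norm_eq_inner)

abbreviation \<mu> :: "'a \<Rightarrow> real measure" where "\<mu> \<equiv> scalar_measure E"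

lemma sets_scalar: "sets (\<mu> f) = sets borel"
  unfolding scalar_measure_def by (metis sets.sigma_sets_eq sets_measure_of space_borel sets.space_closed)

lemma emeasure_scalar:
  assumes "A \<in> sets borel"
  shows "emeasure (\<mu> f) A = ennreal (inner (E A f) f)"
proof -
  have "emeasure (\<mu> f) A = ennreal (Re (cinner (E A f) f))"
    unfolding scalar_measure_def
  proof (rule emeasure_measure_of_sigma[OF _ _ _ assms])
    show "sigma_algebra UNIV (sets (borel :: real measure))"
      using sets.sigma_algebra_axioms[of "borel :: real measure"] by simp
    show "positive (sets borel) (\<lambda>B. ennreal (Re (cinner (E B f) f)))"
      by (simp add: positive_def E_empty Re_cinner)
    show "countably_additive (sets borel) (\<lambda>B. ennreal (Re (cinner (E B f) f)))"
      unfolding countably_additive_def Re_cinner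
    proof (intro allI impI)
      fix A :: "nat \<Rightarrow> real set" assume A: "range A \<subseteq> sets borel" "disjoint_family A"
      have "(\<lambda>n. inner (E (A n) f) f) sums inner (E (\<Union>n. A n) f) f"
        using E_sums[OF A] by (rule bounded_linear.sums[OF bounded_linear_inner_left])
      moreover have "0 \<le> inner (E (A n) f) f" for n using A(1) by (subst inner_E_self) auto
      ultimately show "(\<Sum>n. ennreal (inner (E (A n) f) f)) = ennreal (inner (E (\<Union>n. A n) f) f)"
        by (subst suminf_ennreal2) (auto simp: sums_iff)
    qed
  qed
  then show ?thesis by (simp add: Re_cinner)
qed

lemma measure_scalar: "A \<in> sets borel \<Longrightarrow> measure (\<mu> f) A = inner (E A f) f"
  unfolding measure_def by (subst emeasure_scalar) (auto simp: inner_E_self)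

sublocale borel_family \<mu>
proof (rule borel_family.intro)
  show "sets (\<mu> f) = sets borel" for f by (rule sets_scalar)
  have "space (\<mu> f) = UNIV" for f using sets_eq_imp_space_eq[OF sets_scalar] by simp
  then show "finite_measure (\<mu> f)" for f by (intro finite_measureI) (simp add: emeasure_scalar)
qed

sublocale measure_family \<mu>
proof
  show "quadratic_form (\<lambda>f. measure (\<mu> f) A)" if "A \<in> sets borel" for A
    using quadratic_form_inner[OF E_linear E_sym] that by (simp add: measure_scalar)
  show "measure (\<mu> f) UNIV = (norm f)\<^sup>2" for f
    by (simp add: measure_scalar E_UNIV power2_norm_eq_inner)
qed

lemma calc_indicator: "A \<in> sets borel \<Longrightarrow> calc (indicat_real A) = E A"
  by (rule calc_eqI) (simp_all add: bounded_borel_indicator E_linear E_sym measure_scalar space_mu)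

sublocale multiplicative_family \<mu>
  by unfold_locales (rule calc_mult_indicators, simp_all add: calc_indicator E_Int)

lemma calc_scaleC:
  assumes \<phi>: "bounded_borel \<phi>"
  shows "calc \<phi> (a *\<^sub>C f) = a *\<^sub>C calc \<phi> f"
proof -
  have "\<mu> (\<i> *\<^sub>C f) = \<mu> f" for f
    by (rule measure_eqI) (simp_all add: sets_scalar emeasure_scalar E_scaleC inner_i_i)
  then have "calc \<phi> (\<i> *\<^sub>C f) = \<i> *\<^sub>C calc \<phi> f" for f
    using calc_commute[OF \<phi> linear_i inner_i_i surj_i] by blast
  then show ?thesis
    using linear_add[OF calc_linear[OF \<phi>]] linear_scale[OF calc_linear[OF \<phi>]]
    by (simp add: scaleC_eq[of a f] scaleC_eq[of a "calc \<phi> f"])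
qed

lemma norm_E_le: "A \<in> sets borel \<Longrightarrow> norm (E A f) \<le> norm f"
  using norm_calc_le[OF bounded_borel_indicator, of A 1 f] by (simp add: calc_indicator indicator_def)

lemma E_tendsto:
  assumes "\<And>n. S n \<in> sets borel" "\<And>x. (\<lambda>n. indicat_real (S n) x) \<longlonglongrightarrow> 1"
  shows "(\<lambda>n. E (S n) f) \<longlonglongrightarrow> f"
proof -
  have "(\<lambda>n. calc (indicat_real (S n)) f) \<longlonglongrightarrow> calc (\<lambda>x. 1) f"
    by (rule calc_tendsto[where M = 1])
       (use assms in \<open>auto intro: bounded_borel_indicator bounded_borel_const simp: indicator_def\<close>)
  then show ?thesis by (simp add: calc_indicator assms(1) calc_one)
qed


section \<open>Integrals of unbounded functions\<close>

context
  fixes \<phi> :: "real \<Rightarrow> real"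
  assumes meas[measurable]: "\<phi> \<in> borel_measurable borel"
begin

lemma level_borel[measurable]: "level \<phi> n \<in> sets borel"
  unfolding level_def by measurable

lemma trunc_bounded: "bounded_borel (trunc \<phi> n)"
proof (rule bounded_borelI[where M = "real n"])
  show "trunc \<phi> n \<in> borel_measurable borel" unfolding trunc_def[abs_def] by measurable
qed (rule abs_trunc_le)

lemma E_level_calc_trunc: "E (level \<phi> m) (calc (trunc \<phi> n) f) = calc (trunc \<phi> (min m n)) f"
  using calc_mult[OF bounded_borel_indicator[OF level_borel] trunc_bounded, of m n f]
  by (simp add: calc_indicator indicator_mult_trunc[abs_def])

lemma calc_trunc_E_level: "calc (trunc \<phi> n) (E (level \<phi> m) f) = calc (trunc \<phi> (min m n)) f"
  using calc_mult[OF trunc_bounded bounded_borel_indicator[OF level_borel], of n m f]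
  by (simp add: calc_indicator indicator_mult_trunc[abs_def] mult.commute[of "trunc \<phi> n _"])

lemma E_level_tendsto: "(\<lambda>n. E (level \<phi> n) f) \<longlonglongrightarrow> f"
  by (rule E_tendsto[OF level_borel indicator_level_tendsto])

lemma in_spectral_domain_iff:
  "f \<in> spectral_domain E \<phi> \<longleftrightarrow> integrable (\<mu> f) (\<lambda>x. (\<phi> x)\<^sup>2)"
  unfolding spectral_domain_def
  by (simp add: integrable_iff_bounded measurable_mu)

lemma integrable_of_domain:
  assumes "f \<in> spectral_domain E \<phi>"
  shows "integrable (\<mu> f) \<phi>"
proof (rule Bochner_Integration.integrable_bound)
  show "integrable (\<mu> f) (\<lambda>x. 1 + (\<phi> x)\<^sup>2)"
    using assms integrable_bounded[OF bounded_borel_const] by (simp add: in_spectral_domain_iff)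
  have "\<bar>t\<bar> \<le> 1 + t\<^sup>2" for t :: real
  proof -
    have "0 \<le> (\<bar>t\<bar> - 1)\<^sup>2" by simp
    then show ?thesis by (simp add: power2_diff)
  qed
  then show "AE x in \<mu> f. norm (\<phi> x) \<le> norm (1 + (\<phi> x)\<^sup>2)" by (intro AE_I2) simp
qed (simp add: measurable_mu)

lemma integral_trunc_tendsto:
  assumes "f \<in> spectral_domain E \<phi>"
  shows "(\<lambda>n. \<integral>x. trunc \<phi> n x \<partial>\<mu> f) \<longlonglongrightarrow> (\<integral>x. \<phi> x \<partial>\<mu> f)"
    and "(\<lambda>n. \<integral>x. (trunc \<phi> n x)\<^sup>2 \<partial>\<mu> f) \<longlonglongrightarrow> (\<integral>x. (\<phi> x)\<^sup>2 \<partial>\<mu> f)"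
proof -
  note m = bounded_borel_measurable[OF trunc_bounded]
  show "(\<lambda>n. \<integral>x. trunc \<phi> n x \<partial>\<mu> f) \<longlonglongrightarrow> (\<integral>x. \<phi> x \<partial>\<mu> f)"
    by (rule integral_dominated_convergence[where w = "\<lambda>x. \<bar>\<phi> x\<bar>"])
       (use m in \<open>auto simp: measurable_mu trunc_tendsto abs_trunc_le integrable_of_domain[OF assms]\<close>)
  show "(\<lambda>n. \<integral>x. (trunc \<phi> n x)\<^sup>2 \<partial>\<mu> f) \<longlonglongrightarrow> (\<integral>x. (\<phi> x)\<^sup>2 \<partial>\<mu> f)"
  proof (rule integral_dominated_convergence[where w = "\<lambda>x. (\<phi> x)\<^sup>2"])
    show "integrable (\<mu> f) (\<lambda>x. (\<phi> x)\<^sup>2)" using assms by (simp add: in_spectral_domain_iff)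
    show "AE x in \<mu> f. norm ((trunc \<phi> n x)\<^sup>2) \<le> (\<phi> x)\<^sup>2" for n
      by (simp add: abs_trunc_le flip: abs_le_square_iff)
    show "AE x in \<mu> f. (\<lambda>n. (trunc \<phi> n x)\<^sup>2) \<longlonglongrightarrow> (\<phi> x)\<^sup>2"
      by (intro AE_I2 tendsto_power trunc_tendsto)
  qed (use m in \<open>auto simp: measurable_mu\<close>)
qed

text \<open>Fatou's lemma: the norms of the truncated images control \<open>\<integral> \<phi>\<^sup>2 d\<mu>\<^sub>f\<close>. The domain is thereby
  described by operators and is seen to be a subspace.\<close>

lemma spectral_domainI:
  assumes "\<And>n. norm (calc (trunc \<phi> n) f) \<le> C"
  shows "f \<in> spectral_domain E \<phi>"
proof -
  note m[measurable] = bounded_borel_measurable[OF trunc_bounded]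
  have le: "(\<integral>\<^sup>+ x. ennreal ((trunc \<phi> n x)\<^sup>2) \<partial>\<mu> f) \<le> ennreal (C\<^sup>2)" for n
  proof -
    have "(\<integral>\<^sup>+ x. ennreal ((trunc \<phi> n x)\<^sup>2) \<partial>\<mu> f) = ennreal (\<integral>x. (trunc \<phi> n x)\<^sup>2 \<partial>\<mu> f)"
      by (intro nn_integral_eq_integral integrable_bounded bounded_borel_power trunc_bounded) simp
    also have "\<dots> = ennreal ((norm (calc (trunc \<phi> n) f))\<^sup>2)" by (simp add: norm_calc trunc_bounded)
    also have "\<dots> \<le> ennreal (C\<^sup>2)" using assms[of n] by (intro ennreal_leI power_mono) auto
    finally show ?thesis .
  qed
  have "(\<integral>\<^sup>+ x. ennreal ((\<phi> x)\<^sup>2) \<partial>\<mu> f) = (\<integral>\<^sup>+ x. liminf (\<lambda>n. ennreal ((trunc \<phi> n x)\<^sup>2)) \<partial>\<mu> f)"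
  proof (intro nn_integral_cong)
    fix x
    have "(\<lambda>n. ennreal ((trunc \<phi> n x)\<^sup>2)) \<longlonglongrightarrow> ennreal ((\<phi> x)\<^sup>2)"
      by (intro tendsto_intros trunc_tendsto)
    then show "ennreal ((\<phi> x)\<^sup>2) = liminf (\<lambda>n. ennreal ((trunc \<phi> n x)\<^sup>2))"
      by (intro lim_imp_Liminf[symmetric]) simp_all
  qed
  also have "\<dots> \<le> liminf (\<lambda>n. \<integral>\<^sup>+ x. ennreal ((trunc \<phi> n x)\<^sup>2) \<partial>\<mu> f)"
    by (rule nn_integral_liminf) (simp add: measurable_mu)
  also have "\<dots> \<le> ennreal (C\<^sup>2)"
    using le by (intro Liminf_le) auto
  also have "\<dots> < \<infinity>" by simp
  finally show ?thesis by (simp add: spectral_domain_def)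
qed

lemma norm_calc_trunc_le:
  assumes "f \<in> spectral_domain E \<phi>"
  shows "norm (calc (trunc \<phi> n) f) \<le> sqrt (\<integral>x. (\<phi> x)\<^sup>2 \<partial>\<mu> f)"
proof (rule real_le_rsqrt)
  have "(\<integral>x. (trunc \<phi> n x)\<^sup>2 \<partial>\<mu> f) \<le> (\<integral>x. (\<phi> x)\<^sup>2 \<partial>\<mu> f)"
  proof (rule integral_mono)
    show "integrable (\<mu> f) (\<lambda>x. (trunc \<phi> n x)\<^sup>2)"
      by (intro integrable_bounded bounded_borel_power trunc_bounded)
    show "integrable (\<mu> f) (\<lambda>x. (\<phi> x)\<^sup>2)" using assms by (simp add: in_spectral_domain_iff)
  qed (simp add: abs_trunc_le flip: abs_le_square_iff)
  then show "(norm (calc (trunc \<phi> n) f))\<^sup>2 \<le> (\<integral>x. (\<phi> x)\<^sup>2 \<partial>\<mu> f)"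
    by (simp add: norm_calc trunc_bounded)
qed

lemma spectral_domain_add:
  assumes "f \<in> spectral_domain E \<phi>" "h \<in> spectral_domain E \<phi>"
  shows "f + h \<in> spectral_domain E \<phi>"
proof (rule spectral_domainI)
  fix n
  have "norm (calc (trunc \<phi> n) (f + h)) \<le> norm (calc (trunc \<phi> n) f) + norm (calc (trunc \<phi> n) h)"
    by (simp add: calc_addv[OF trunc_bounded] norm_triangle_ineq)
  also have "\<dots> \<le> sqrt (\<integral>x. (\<phi> x)\<^sup>2 \<partial>\<mu> f) + sqrt (\<integral>x. (\<phi> x)\<^sup>2 \<partial>\<mu> h)"
    using assms by (intro add_mono norm_calc_trunc_le)
  finally show "norm (calc (trunc \<phi> n) (f + h)) \<le> \<dots>" .
qed

lemma spectral_domain_i: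
  assumes "f \<in> spectral_domain E \<phi>"
  shows "\<i> *\<^sub>C f \<in> spectral_domain E \<phi>"
  by (rule spectral_domainI[of _ "sqrt (\<integral>x. (\<phi> x)\<^sup>2 \<partial>\<mu> f)"])
     (simp add: calc_scaleC trunc_bounded norm_i norm_calc_trunc_le[OF assms])

lemma spectral_domain_minus:
  "f \<in> spectral_domain E \<phi> \<Longrightarrow> - f \<in> spectral_domain E \<phi>"
  using spectral_domain_i[OF spectral_domain_i] by (simp add: i_i)

lemma E_level_domain: "E (level \<phi> n) f \<in> spectral_domain E \<phi>"
proof (rule spectral_domainI)
  fix m
  have "norm (calc (trunc \<phi> (min n m)) f) \<le> real n * norm f"
    by (rule norm_calc_le[OF trunc_bounded]) (use abs_trunc_le(2) in \<open>force intro: order_trans\<close>)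
  then show "norm (calc (trunc \<phi> m) (E (level \<phi> n) f)) \<le> real n * norm f"
    by (simp add: calc_trunc_E_level)
qed

lemma spectral_form_eq:
  "spectral_form E \<phi> f h = Complex (polar (\<lambda>f. \<integral>x. \<phi> x \<partial>\<mu> f) f h) (polar (\<lambda>f. \<integral>x. \<phi> x \<partial>\<mu> f) f (\<i> *\<^sub>C h))"
proof -
  have "(1::complex) *\<^sub>C h = h" "(- 1::complex) *\<^sub>C h = - h" "(- \<i>) *\<^sub>C h = - (\<i> *\<^sub>C h)"
    using scaleC_of_real[of 1 h] scaleC_of_real[of "-1" h] scaleC_scaleC[of "-1" "\<i>" h]
      scaleC_of_real[of "-1" "\<i> *\<^sub>C h"] by simp_all
  then show ?thesis
    by (simp add: spectral_form_def sum_lessThan_4 polar_def complex_eq_iff power3_eq_cube power2_eq_square)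
qed

text \<open>On the part of the space where \<open>\<phi>\<close> is bounded the integral is the bounded calculus, and
  these parts exhaust the space. This description of the graph gives all further properties.\<close>

theorem spectral_integral_iff:
  "(f, g) \<in> spectral_integral E \<phi> \<longleftrightarrow> (\<forall>n. E (level \<phi> n) g = calc (trunc \<phi> n) f)"
proof -
  have lim: "(\<lambda>n. inner (calc (trunc \<phi> n) f) h) \<longlonglongrightarrow> polar (\<lambda>f. \<integral>x. \<phi> x \<partial>\<mu> f) f h"
    if "f \<in> spectral_domain E \<phi>" "h \<in> spectral_domain E \<phi>" for h
  proof -
    have "f - h \<in> spectral_domain E \<phi>"
      using spectral_domain_add[OF that(1) spectral_domain_minus[OF that(2)]] by simp
    then show ?thesis
      unfolding calc_props(2)[OF trunc_bounded] polar_def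
      using that by (intro tendsto_intros integral_trunc_tendsto spectral_domain_add) auto
  qed
  show ?thesis
  proof
    assume fg: "(f, g) \<in> spectral_integral E \<phi>"
    then have f: "f \<in> spectral_domain E \<phi>" by (simp add: spectral_integral_def)
    have form: "inner g h = polar (\<lambda>f. \<integral>x. \<phi> x \<partial>\<mu> f) f h" if "h \<in> spectral_domain E \<phi>" for h
      using fg that by (simp add: spectral_integral_def spectral_form_eq cinner_eq)
    show "\<forall>n. E (level \<phi> n) g = calc (trunc \<phi> n) f"
    proof (intro allI inner_eqI)
      fix n h
      have "(\<lambda>m. inner (calc (trunc \<phi> m) f) (E (level \<phi> n) h)) \<longlonglongrightarrow> inner (E (level \<phi> n) g) h"
        using lim[OF f E_level_domain] form[OF E_level_domain] by (simp add: E_sym level_borel)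
      moreover have "inner (calc (trunc \<phi> m) f) (E (level \<phi> n) h) = inner (calc (trunc \<phi> n) f) h"
        if "n \<le> m" for m
        using that E_level_calc_trunc[of n m f] by (simp add: min_absorb1 level_borel flip: E_sym)
      then have "(\<lambda>m. inner (calc (trunc \<phi> m) f) (E (level \<phi> n) h)) \<longlonglongrightarrow> inner (calc (trunc \<phi> n) f) h"
        by (intro tendsto_eventually) (auto simp: eventually_sequentially)
      ultimately show "inner (E (level \<phi> n) g) h = inner (calc (trunc \<phi> n) f) h"
        by (rule LIMSEQ_unique)
    qed
  next
    assume *: "\<forall>n. E (level \<phi> n) g = calc (trunc \<phi> n) f"
    have f: "f \<in> spectral_domain E \<phi>"
      by (rule spectral_domainI[of _ "norm g"]) (use * norm_E_le level_borel in metis)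
    have form: "inner g h = polar (\<lambda>f. \<integral>x. \<phi> x \<partial>\<mu> f) f h" if "h \<in> spectral_domain E \<phi>" for h
    proof (rule LIMSEQ_unique)
      show "(\<lambda>n. inner (calc (trunc \<phi> n) f) h) \<longlonglongrightarrow> polar (\<lambda>f. \<integral>x. \<phi> x \<partial>\<mu> f) f h"
        by (rule lim[OF f that])
      show "(\<lambda>n. inner (calc (trunc \<phi> n) f) h) \<longlonglongrightarrow> inner g h"
        using tendsto_inner[OF E_level_tendsto[of g] tendsto_const[of h]] * by simp
    qed
    show "(f, g) \<in> spectral_integral E \<phi>"
      by (simp add: spectral_integral_def f spectral_form_eq cinner_eq form spectral_domain_i)
  qed
qed

lemma spectral_integral_calc: "(E (level \<phi> n) u, calc (trunc \<phi> n) u) \<in> spectral_integral E \<phi>"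
  by (simp add: spectral_integral_iff E_level_calc_trunc calc_trunc_E_level min.commute)

text \<open>The truncated images form a Cauchy sequence, since their squared norms
  \<open>\<integral> (trunc \<phi> n)\<^sup>2 d\<mu>\<^sub>f\<close> converge and differences are orthogonal to the smaller image.\<close>

lemma Domain_spectral_integral: "Domain (spectral_integral E \<phi>) = spectral_domain E \<phi>"
proof (intro equalityI subsetI)
  fix f assume f: "f \<in> spectral_domain E \<phi>"
  define s where "s n = calc (trunc \<phi> n) f" for n
  have diff: "(norm (s m - s n))\<^sup>2 = \<bar>(norm (s m))\<^sup>2 - (norm (s n))\<^sup>2\<bar>" for m n
  proof -
    have *: "(norm (s m - s n))\<^sup>2 = (norm (s m))\<^sup>2 - (norm (s n))\<^sup>2" if "n \<le> m" for m n
    proof -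
      have sn: "s n = E (level \<phi> n) (s m)"
        using that E_level_calc_trunc[of n m f] by (simp add: s_def min_absorb1)
      then have "inner (s m) (s n) = (norm (s n))\<^sup>2"
        using inner_E_self[OF level_borel, of n "s m"] by (simp add: inner_commute)
      then show ?thesis
        by (simp add: power2_norm_eq_inner inner_diff_left inner_diff_right inner_commute)
    qed
    show ?thesis
    proof (cases "n \<le> m")
      case True
      then show ?thesis using *[OF True] by (metis abs_of_nonneg zero_le_power2)
    next
      case False
      then have "(norm (s n - s m))\<^sup>2 = (norm (s n))\<^sup>2 - (norm (s m))\<^sup>2" using * by simp
      then show ?thesis by (metis abs_minus_commute abs_of_nonneg norm_minus_commute zero_le_power2)
    qed
  qed
  have "(\<lambda>n. (norm (s n))\<^sup>2) \<longlonglongrightarrow> (\<integral>x. (\<phi> x)\<^sup>2 \<partial>\<mu> f)"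
    using integral_trunc_tendsto(2)[OF f] by (simp add: s_def norm_calc trunc_bounded)
  then have C: "Cauchy (\<lambda>n. (norm (s n))\<^sup>2)" by (rule LIMSEQ_imp_Cauchy)
  have "Cauchy s"
  proof (rule metric_CauchyI)
    fix e :: real assume "0 < e"
    then obtain N where N: "\<And>m n. m \<ge> N \<Longrightarrow> n \<ge> N \<Longrightarrow> dist ((norm (s m))\<^sup>2) ((norm (s n))\<^sup>2) < e\<^sup>2"
      using metric_CauchyD[OF C, of "e\<^sup>2"] by auto
    have "dist (s m) (s n) < e" if "m \<ge> N" "n \<ge> N" for m n
    proof (rule power2_less_imp_less)
      show "(dist (s m) (s n))\<^sup>2 < e\<^sup>2" using N[OF that] diff[of m n] by (simp add: dist_norm)
    qed (use \<open>0 < e\<close> in simp)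
    then show "\<exists>N. \<forall>m\<ge>N. \<forall>n\<ge>N. dist (s m) (s n) < e" by blast
  qed
  then obtain g where g: "s \<longlonglongrightarrow> g" using Cauchy_convergent convergent_def by blast
  have "E (level \<phi> n) g = calc (trunc \<phi> n) f" for n
  proof (rule LIMSEQ_unique)
    have "bounded_linear (E (level \<phi> n))"
      using calc_props(1)[OF bounded_borel_indicator[OF level_borel]] by (simp add: calc_indicator level_borel)
    then show "(\<lambda>m. E (level \<phi> n) (s m)) \<longlonglongrightarrow> E (level \<phi> n) g" using g by (rule bounded_linear.tendsto)
    show "(\<lambda>m. E (level \<phi> n) (s m)) \<longlonglongrightarrow> calc (trunc \<phi> n) f"
      by (intro tendsto_eventually eventually_sequentiallyI[of n])
         (simp add: s_def E_level_calc_trunc min_absorb1)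
  qed
  then have "(f, g) \<in> spectral_integral E \<phi>" by (simp add: spectral_integral_iff)
  then show "f \<in> Domain (spectral_integral E \<phi>)" by blast
qed (auto simp: spectral_integral_def)

lemma norm_spectral_integral:
  assumes fg: "(f, g) \<in> spectral_integral E \<phi>"
  shows "(norm g)\<^sup>2 = (\<integral>x. (\<phi> x)\<^sup>2 \<partial>\<mu> f)"
proof (rule LIMSEQ_unique)
  have f: "f \<in> spectral_domain E \<phi>" using fg by (simp add: spectral_integral_def)
  have "E (level \<phi> n) g = calc (trunc \<phi> n) f" for n using fg by (simp add: spectral_integral_iff)
  then have "(norm (E (level \<phi> n) g))\<^sup>2 = (\<integral>x. (trunc \<phi> n x)\<^sup>2 \<partial>\<mu> f)" for n
    by (simp add: norm_calc trunc_bounded)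
  then show "(\<lambda>n. (norm (E (level \<phi> n) g))\<^sup>2) \<longlonglongrightarrow> (\<integral>x. (\<phi> x)\<^sup>2 \<partial>\<mu> f)"
    using integral_trunc_tendsto(2)[OF f] by simp
  show "(\<lambda>n. (norm (E (level \<phi> n) g))\<^sup>2) \<longlonglongrightarrow> (norm g)\<^sup>2"
    by (intro tendsto_intros E_level_tendsto)
qed

lemma inner_spectral_integral:
  assumes fg: "(f, g) \<in> spectral_integral E \<phi>"
  shows "inner g f = (\<integral>x. \<phi> x \<partial>\<mu> f)"
proof (rule LIMSEQ_unique)
  have f: "f \<in> spectral_domain E \<phi>" using fg by (simp add: spectral_integral_def)
  have "E (level \<phi> n) g = calc (trunc \<phi> n) f" for n using fg by (simp add: spectral_integral_iff)
  then have "inner (E (level \<phi> n) g) f = (\<integral>x. trunc \<phi> n x \<partial>\<mu> f)" for n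
    by (simp add: inner_calc_self trunc_bounded)
  then show "(\<lambda>n. inner (E (level \<phi> n) g) f) \<longlonglongrightarrow> (\<integral>x. \<phi> x \<partial>\<mu> f)"
    using integral_trunc_tendsto(1)[OF f] by simp
  show "(\<lambda>n. inner (E (level \<phi> n) g) f) \<longlonglongrightarrow> inner g f"
    by (intro tendsto_intros E_level_tendsto)
qed

lemma spectral_integral_symmetric:
  assumes "(f, g) \<in> spectral_integral E \<phi>" "(f', g') \<in> spectral_integral E \<phi>"
  shows "inner g f' = inner f g'"
proof (rule LIMSEQ_unique)
  show "(\<lambda>n. inner (E (level \<phi> n) g) f') \<longlonglongrightarrow> inner g f'"
    by (intro tendsto_intros E_level_tendsto)
  have "inner (E (level \<phi> n) g) f' = inner f (E (level \<phi> n) g')" for n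
    using assms by (simp add: spectral_integral_iff calc_sym trunc_bounded)
  then show "(\<lambda>n. inner (E (level \<phi> n) g) f') \<longlonglongrightarrow> inner f g'"
    by (simp, intro tendsto_intros E_level_tendsto)
qed

lemma linear_spectral_integral: "linear_oper (spectral_integral E \<phi>)"
  unfolding linear_oper_def
proof (intro conjI allI impI)
  show "single_valued (spectral_integral E \<phi>)"
  proof (rule single_valuedI)
    fix f g h assume "(f, g) \<in> spectral_integral E \<phi>" "(f, h) \<in> spectral_integral E \<phi>"
    then have "E (level \<phi> n) g = E (level \<phi> n) h" for n by (simp add: spectral_integral_iff)
    then show "g = h" using E_level_tendsto[of g] E_level_tendsto[of h] LIMSEQ_unique by auto
  qed
  show "(0, 0) \<in> spectral_integral E \<phi>"
    by (simp add: spectral_integral_iff linear_0[OF E_linear[OF level_borel]]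
        linear_0[OF calc_linear[OF trunc_bounded]])
qed (auto simp: spectral_integral_iff E_add E_scaleC level_borel calc_addv calc_scaleC trunc_bounded)

text \<open>A pair in the adjoint, tested against the pairs of \<open>spectral_integral_calc\<close>, satisfies the
  criterion \<open>spectral_integral_iff\<close>.\<close>

theorem self_adjoint_spectral_integral: "self_adjoint (spectral_integral E \<phi>)"
  unfolding self_adjoint_def
proof (intro conjI linear_spectral_integral)
  have "h \<in> closure (spectral_domain E \<phi>)" for h
    unfolding closure_sequential
    by (rule exI[of _ "\<lambda>n. E (level \<phi> n) h"]) (simp add: E_level_domain E_level_tendsto)
  then show "closure (Domain (spectral_integral E \<phi>)) = UNIV"
    unfolding Domain_spectral_integral by blast
  show "adjoint_oper (spectral_integral E \<phi>) = spectral_integral E \<phi>"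
  proof (intro equalityI subsetI)
    fix p assume "p \<in> adjoint_oper (spectral_integral E \<phi>)"
    moreover obtain y z where p: "p = (y, z)" by (cases p)
    ultimately have adj: "\<And>x w. (x, w) \<in> spectral_integral E \<phi> \<Longrightarrow> cinner w y = cinner x z"
      by (simp add: adjoint_oper_iff)
    have "E (level \<phi> n) z = calc (trunc \<phi> n) y" for n
    proof (rule inner_eqI)
      fix u
      have "inner (calc (trunc \<phi> n) u) y = inner (E (level \<phi> n) u) z"
        using adj[OF spectral_integral_calc[of n u]] by (metis Re_cinner)
      then show "inner (E (level \<phi> n) z) u = inner (calc (trunc \<phi> n) y) u"
        by (metis E_sym calc_sym inner_commute level_borel trunc_bounded)
    qed
    then show "p \<in> spectral_integral E \<phi>" by (simp add: p spectral_integral_iff)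
  next
    fix p assume "p \<in> spectral_integral E \<phi>"
    moreover obtain y z where p: "p = (y, z)" by (cases p)
    ultimately have yz: "(y, z) \<in> spectral_integral E \<phi>" by simp
    then have iyz: "(\<i> *\<^sub>C y, \<i> *\<^sub>C z) \<in> spectral_integral E \<phi>"
      using linear_spectral_integral by (auto simp: linear_oper_def)
    show "p \<in> adjoint_oper (spectral_integral E \<phi>)"
      using spectral_integral_symmetric[OF _ yz] spectral_integral_symmetric[OF _ iyz]
      by (simp add: p adjoint_oper_iff cinner_eq)
  qed
qed

end

end


section \<open>Change of variables and composition\<close>

lemma pvm_vimage:
  assumes "pvm E" and k: "k \<in> borel_measurable borel"
  shows "pvm (\<lambda>B. E (k -` B))"
proof -
  interpret pvm E by fact
  have vim: "k -` B \<in> sets borel" if "B \<in> sets borel" for B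
    using measurable_sets[OF k that] by simp
  have "(\<lambda>n. E (k -` A n) f) sums E (k -` (\<Union>n. A n)) f"
    if A: "range A \<subseteq> sets borel" "disjoint_family A" for A :: "nat \<Rightarrow> real set" and f
  proof -
    have "range (\<lambda>n. k -` A n) \<subseteq> sets borel" "disjoint_family (\<lambda>n. k -` A n)"
      using A vim by (auto simp: disjoint_family_on_def)
    from E_sums[OF this] show ?thesis by (simp add: vimage_UN)
  qed
  then show ?thesis
    by unfold_locales
       (simp add: projection_valued_measure_def vim orth fun_eq_iff E_UNIV E_Int)
qed

lemma scalar_measure_vimage:
  assumes "pvm E" and k[measurable]: "k \<in> borel_measurable borel"
  shows "scalar_measure (\<lambda>B. E (k -` B)) f = distr (scalar_measure E f) borel k"
proof (rule measure_eqI)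
  interpret E: pvm E by fact
  interpret F: pvm "\<lambda>B. E (k -` B)" by (rule pvm_vimage[OF assms])
  show "sets (scalar_measure (\<lambda>B. E (k -` B)) f) = sets (distr (scalar_measure E f) borel k)"
    by (simp add: F.sets_scalar)
  fix A assume "A \<in> sets (scalar_measure (\<lambda>B. E (k -` B)) f)"
  then have A: "A \<in> sets borel" by (simp add: F.sets_scalar)
  then have "k -` A \<in> sets borel" using measurable_sets[OF k A] by simp
  then show "emeasure (scalar_measure (\<lambda>B. E (k -` B)) f) A = emeasure (distr (scalar_measure E f) borel k) A"
    using A by (simp add: F.emeasure_scalar E.emeasure_scalar emeasure_distr E.measurable_mu E.space_mu)
qed

lemma spectral_integral_vimage:
  assumes E: "pvm E" and k[measurable]: "k \<in> borel_measurable borel"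
    and \<phi>[measurable]: "\<phi> \<in> borel_measurable borel"
  shows "spectral_integral (\<lambda>B. E (k -` B)) \<phi> = spectral_integral E (\<lambda>x. \<phi> (k x))"
proof -
  interpret pvm E by fact
  note \<mu> = scalar_measure_vimage[OF E k]
  have "spectral_domain (\<lambda>B. E (k -` B)) \<phi> = spectral_domain E (\<lambda>x. \<phi> (k x))"
    by (simp add: spectral_domain_def \<mu> nn_integral_distr measurable_mu)
  moreover have "spectral_form (\<lambda>B. E (k -` B)) \<phi> = spectral_form E (\<lambda>x. \<phi> (k x))"
    by (simp add: fun_eq_iff spectral_form_def \<mu> integral_distr measurable_mu)
  ultimately show ?thesis by (simp add: spectral_integral_def)
qed

lemma spectral_integral_eqI:
  assumes "pvm E" "pvm F" "\<And>A. A \<in> sets borel \<Longrightarrow> E A = F A"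
  shows "spectral_integral E = spectral_integral F"
proof -
  interpret E: pvm E by fact
  interpret F: pvm F by fact
  have "scalar_measure E = scalar_measure F"
    by (rule ext, rule measure_eqI)
       (simp_all add: E.sets_scalar F.sets_scalar E.emeasure_scalar F.emeasure_scalar assms(3))
  then show ?thesis
    by (simp add: fun_eq_iff spectral_integral_def spectral_domain_def spectral_form_def)
qed

lemma self_adjoint_symmetric:
  assumes "self_adjoint T" "(x, w) \<in> T" "(y, z) \<in> T"
  shows "cinner w y = cinner x z"
  using assms adjoint_oper_iff[of y z T] by (simp add: self_adjoint_def)

text \<open>A symmetric extension of \<open>T\<close> is contained in the adjoint of \<open>T\<close>, which is \<open>T\<close>. This turns
  the inclusions obtained from the functional calculus into equalities of graphs.\<close>

lemma self_adjoint_maximal: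
  assumes T: "self_adjoint T" and "T \<subseteq> R"
    and sym: "\<And>x w y z. (x, w) \<in> R \<Longrightarrow> (y, z) \<in> R \<Longrightarrow> cinner w y = cinner x z"
  shows "T = R"
proof (intro equalityI subsetI)
  fix p assume "p \<in> R"
  then have "p \<in> adjoint_oper T"
    using sym \<open>T \<subseteq> R\<close> by (cases p) (auto simp: adjoint_oper_iff)
  then show "p \<in> T" using T by (simp add: self_adjoint_def)
qed (use \<open>T \<subseteq> R\<close> in blast)

lemma self_adjoint_square_symmetric:
  assumes S: "self_adjoint S" and "(x, w) \<in> S O S" "(y, z) \<in> S O S"
  shows "cinner w y = cinner x z"
proof -
  obtain u v where uv: "(x, u) \<in> S" "(u, w) \<in> S" "(y, v) \<in> S" "(v, z) \<in> S" using assms by auto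
  have "cinner w y = cinner u v" by (rule self_adjoint_symmetric[OF S uv(2,3)])
  also have "\<dots> = cinner x z" by (rule self_adjoint_symmetric[OF S uv(1,4)])
  finally show ?thesis .
qed

context pvm
begin

text \<open>The composition is symmetric and the right-hand side is self-adjoint, so that one inclusion
  suffices. Levels match because \<open>\<bar>\<phi>\<bar> \<le> n\<close> means \<open>\<phi>\<^sup>2 \<le> n\<^sup>2\<close>.\<close>

lemma spectral_integral_square:
  assumes \<phi>[measurable]: "\<phi> \<in> borel_measurable borel"
  shows "spectral_integral E \<phi> O spectral_integral E \<phi> = spectral_integral E (\<lambda>x. (\<phi> x)\<^sup>2)"
proof -
  have m2[measurable]: "(\<lambda>x. (\<phi> x)\<^sup>2) \<in> borel_measurable borel" by measurable
  have lev: "level (\<lambda>x. (\<phi> x)\<^sup>2) (n * n) = level \<phi> n" for n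
    using abs_le_square_iff[of "\<phi> _" "real n"] by (simp add: level_def power2_eq_square)
  have tr: "trunc (\<lambda>x. (\<phi> x)\<^sup>2) (n * n) = (\<lambda>x. trunc \<phi> n x * trunc \<phi> n x)" for n
    unfolding trunc_def[abs_def] lev by (simp add: fun_eq_iff indicator_def power2_eq_square)
  have "spectral_integral E (\<lambda>x. (\<phi> x)\<^sup>2) \<subseteq> spectral_integral E \<phi> O spectral_integral E \<phi>"
  proof
    fix p assume "p \<in> spectral_integral E (\<lambda>x. (\<phi> x)\<^sup>2)"
    moreover obtain f h where p: "p = (f, h)" by (cases p)
    ultimately have fh: "(f, h) \<in> spectral_integral E (\<lambda>x. (\<phi> x)\<^sup>2)" by simp
    then have "f \<in> spectral_domain E (\<lambda>x. (\<phi> x)\<^sup>2)" by (simp add: spectral_integral_def)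
    then have "f \<in> spectral_domain E \<phi>"
      using integrable_of_domain[OF m2] by (simp add: in_spectral_domain_iff[OF \<phi>])
    then obtain g where fg: "(f, g) \<in> spectral_integral E \<phi>"
      using Domain_spectral_integral[OF \<phi>] by blast
    have "E (level \<phi> n) h = calc (trunc \<phi> n) g" for n
    proof -
      have "E (level \<phi> n) h = calc (trunc (\<lambda>x. (\<phi> x)\<^sup>2) (n * n)) f"
        using fh by (simp add: spectral_integral_iff[OF m2] flip: lev)
      also have "\<dots> = calc (trunc \<phi> n) (calc (trunc \<phi> n) f)"
        by (simp add: tr calc_mult trunc_bounded[OF \<phi>])
      also have "\<dots> = calc (trunc \<phi> n) (E (level \<phi> n) g)"
        using fg by (simp add: spectral_integral_iff[OF \<phi>])
      finally show ?thesis by (simp add: calc_trunc_E_level[OF \<phi>])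
    qed
    then have "(g, h) \<in> spectral_integral E \<phi>" by (simp add: spectral_integral_iff[OF \<phi>])
    then show "p \<in> spectral_integral E \<phi> O spectral_integral E \<phi>" using fg p by blast
  qed
  from self_adjoint_maximal[OF self_adjoint_spectral_integral[OF m2] this]
  show ?thesis
    using self_adjoint_square_symmetric[OF self_adjoint_spectral_integral[OF \<phi>]] by blast
qed

lemma spectral_integral_on_bounded:
  assumes \<phi>: "\<phi> \<in> borel_measurable borel" and A: "A \<in> sets borel"
    and bd: "bounded_borel (\<lambda>x. indicat_real A x * \<phi> x)"
  shows "(E A f, calc (\<lambda>x. indicat_real A x * \<phi> x) f) \<in> spectral_integral E \<phi>"
proof -
  have "E (level \<phi> n) (calc (\<lambda>x. indicat_real A x * \<phi> x) f) = calc (trunc \<phi> n) (E A f)" for n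
    using calc_mult[OF bounded_borel_indicator[OF level_borel[OF \<phi>]] bd, of n f]
      calc_mult[OF trunc_bounded[OF \<phi>] bounded_borel_indicator[OF A], of n f]
    by (simp add: calc_indicator A level_borel[OF \<phi>] trunc_def mult_ac)
  then show ?thesis by (simp add: spectral_integral_iff[OF \<phi>])
qed


section \<open>Spectral measures of positive operators\<close>

definition supported_nonneg :: bool where
  "supported_nonneg \<longleftrightarrow> (\<forall>f. E {..<0} f = 0)"

lemma supported_nonneg_iff_AE: "supported_nonneg \<longleftrightarrow> (\<forall>f. AE x in \<mu> f. 0 \<le> x)"
proof -
  have "(AE x in \<mu> f. 0 \<le> x) \<longleftrightarrow> E {..<0} f = 0" for f
  proof -
    have "(AE x in \<mu> f. 0 \<le> x) \<longleftrightarrow> emeasure (\<mu> f) {x \<in> space (\<mu> f). \<not> 0 \<le> x} = 0"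
      by (rule AE_iff_measurable) (auto simp: sets_mu space_mu)
    also have "{x \<in> space (\<mu> f). \<not> 0 \<le> x} = {..<0}" by (auto simp: space_mu)
    finally show ?thesis by (simp add: emeasure_scalar inner_E_self)
  qed
  then show ?thesis by (simp add: supported_nonneg_def)
qed

lemma spectral_integral_cong:
  assumes s: supported_nonneg
    and [measurable]: "\<phi> \<in> borel_measurable borel" "\<psi> \<in> borel_measurable borel"
    and eq: "\<And>x. 0 \<le> x \<Longrightarrow> \<phi> x = \<psi> x"
  shows "spectral_integral E \<phi> = spectral_integral E \<psi>"
proof -
  have AE: "AE x in \<mu> f. \<phi> x = \<psi> x" for f
    using s[unfolded supported_nonneg_iff_AE, rule_format, of f] by eventually_elim (rule eq)
  have "(\<integral>\<^sup>+ x. ennreal ((\<phi> x)\<^sup>2) \<partial>\<mu> f) = (\<integral>\<^sup>+ x. ennreal ((\<psi> x)\<^sup>2) \<partial>\<mu> f)" for f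
    by (rule nn_integral_cong_AE) (use AE[of f] in eventually_elim, simp)
  moreover have "(\<integral>x. \<phi> x \<partial>\<mu> f) = (\<integral>x. \<psi> x \<partial>\<mu> f)" for f
    using AE by (intro integral_cong_AE) (simp_all add: measurable_mu)
  ultimately show ?thesis
    by (simp add: spectral_integral_def spectral_domain_def spectral_form_def[abs_def])
qed

lemma calc_cong_nonneg:
  assumes s: supported_nonneg and \<phi>: "bounded_borel \<phi>" and \<psi>: "bounded_borel \<psi>"
    and eq: "\<And>x. 0 \<le> x \<Longrightarrow> \<phi> x = \<psi> x"
  shows "calc \<phi> = calc \<psi>"
proof (rule calc_cong_integral[OF \<phi> \<psi>])
  fix f
  have "AE x in \<mu> f. \<phi> x = \<psi> x"
    using s[unfolded supported_nonneg_iff_AE, rule_format, of f] by eventually_elim (rule eq)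
  then show "(\<integral>x. \<phi> x \<partial>\<mu> f) = (\<integral>x. \<psi> x \<partial>\<mu> f)"
    using \<phi> \<psi> by (intro integral_cong_AE) (simp_all add: measurable_mu bounded_borel_measurable)
qed

lemma positive_spectral_integral:
  assumes s: supported_nonneg and \<phi>: "\<phi> \<in> borel_measurable borel"
    and nonneg: "\<And>x. 0 \<le> x \<Longrightarrow> 0 \<le> \<phi> x"
  shows "positive_oper (spectral_integral E \<phi>)"
  unfolding positive_oper_def
proof safe
  fix f g assume fg: "(f, g) \<in> spectral_integral E \<phi>"
  then have "(\<i> *\<^sub>C f, \<i> *\<^sub>C g) \<in> spectral_integral E \<phi>"
    using linear_spectral_integral[OF \<phi>] by (simp add: linear_oper_def)
  from spectral_integral_symmetric[OF \<phi> fg this]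
  have "inner g (\<i> *\<^sub>C f) = 0"
    using inner_i_left[of f g] by (simp add: inner_commute)
  moreover have "0 \<le> (\<integral>x. \<phi> x \<partial>\<mu> f)"
    by (rule integral_nonneg_AE, use s[unfolded supported_nonneg_iff_AE, rule_format, of f] in eventually_elim)
       (rule nonneg)
  ultimately show "cinner g f \<in> \<real>\<^sub>\<ge>\<^sub>0"
    by (simp add: cinner_eq complex_nonneg_Reals_iff inner_spectral_integral[OF \<phi> fg])
qed

text \<open>On the range of \<open>E [-n, -1/(n+1)]\<close> the form of \<open>\<integral> x dE\<close> is negative definite, so that
  this range is trivial.\<close>

lemma supported_nonneg_if_positive:
  assumes pos: "positive_oper (spectral_integral E (\<lambda>x. x))"
  shows supported_nonneg
  unfolding supported_nonneg_iff_AE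
proof
  fix f
  define A where "A n = {- real n..- 1 / Suc n}" for n
  have A[measurable]: "A n \<in> sets borel" for n by (simp add: A_def)
  have bd: "bounded_borel (\<lambda>x. indicat_real (A n) x * x)" for n
  proof (rule bounded_borelI[where M = "real n"])
    have "x \<le> 0" if "x \<le> - 1 / Suc n" for x :: real
      using that by (rule order_trans) simp
    then show "\<bar>indicat_real (A n) x * x\<bar> \<le> real n" for x
      by (auto simp: A_def indicator_def abs_le_iff intro: order_trans[of x 0])
  qed (use A in simp)
  have zero: "E (A n) f = 0" for n
  proof -
    let ?g = "calc (\<lambda>x. indicat_real (A n) x * x) f"
    have "(E (A n) f, ?g) \<in> spectral_integral E (\<lambda>x. x)"
      by (rule spectral_integral_on_bounded[OF _ A bd]) simp
    then have "0 \<le> inner ?g (E (A n) f)"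
      using pos by (auto simp: positive_oper_def complex_nonneg_Reals_iff Re_cinner)
    also have "inner ?g (E (A n) f) = inner (E (A n) ?g) f" by (simp add: E_sym A)
    also have "E (A n) ?g = ?g"
      using calc_mult[OF bounded_borel_indicator[OF A] bd, of n n f]
      by (simp add: calc_indicator A mult.assoc[symmetric] flip: indicator_inter_arith)
    also have "inner ?g f = (\<integral>x. indicat_real (A n) x * x \<partial>\<mu> f)" by (rule inner_calc_self[OF bd])
    also have "\<dots> \<le> (\<integral>x. (- 1 / Suc n) * indicat_real (A n) x \<partial>\<mu> f)"
      by (intro integral_mono integrable_bounded bd bounded_borel_cmult bounded_borel_indicator A)
         (auto simp: A_def indicator_def)
    also have "\<dots> = (- 1 / Suc n) * (norm (E (A n) f))\<^sup>2"
      by (simp add: measure_scalar A inner_E_self space_mu)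
    finally show ?thesis by (simp add: divide_le_0_iff)
  qed
  have "AE x in \<mu> f. \<forall>n. x \<notin> A n"
    unfolding AE_all_countable
  proof
    fix n
    have "A n \<in> null_sets (\<mu> f)" using zero[of n] by (intro null_setsI) (simp_all add: emeasure_scalar sets_mu)
    then show "AE x in \<mu> f. x \<notin> A n" by (rule AE_not_in)
  qed
  then show "AE x in \<mu> f. 0 \<le> x"
  proof eventually_elim
    case (elim x)
    show ?case
    proof (rule ccontr)
      assume "\<not> 0 \<le> x"
      then obtain N where N: "1 / Suc N < - x" using nat_approx_posE[of "- x"] by auto
      obtain N' where N': "- x \<le> real N'" using real_arch_simple by blast
      have "1 / Suc (max N N') \<le> (1 / Suc N :: real)" by (simp add: frac_le)
      then have "x \<in> A (max N N')" using N N' by (simp add: A_def)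
      then show False using elim by blast
    qed
  qed
qed


end

definition resolvent_fun :: "real \<Rightarrow> real" where "resolvent_fun x = 1 / (1 + \<bar>x\<bar>)"

lemma resolvent_fun:
  "resolvent_fun \<in> borel_measurable borel" "0 \<le> resolvent_fun x" "resolvent_fun x \<le> 1"
  "bounded_borel resolvent_fun"
proof -
  show m: "resolvent_fun \<in> borel_measurable borel" unfolding resolvent_fun_def[abs_def] by measurable
  show *: "0 \<le> resolvent_fun x" "resolvent_fun x \<le> 1" for x by (simp_all add: resolvent_fun_def)
  show "bounded_borel resolvent_fun" by (rule bounded_borelI[OF m, of 1]) (simp add: *)
qed

context pvm
begin

text \<open>With \<open>u = 1/(1 + x)\<close> one has \<open>1 - u = x u\<close> for \<open>x \<ge> 0\<close>.\<close>

lemma resolvent_in_graph: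
  assumes s: supported_nonneg
  shows "(calc resolvent_fun f, f - calc resolvent_fun f) \<in> spectral_integral E (\<lambda>x. x)"
proof -
  let ?l = "level (\<lambda>x. x)" and ?t = "trunc (\<lambda>x. x)"
  have id: "(\<lambda>x. x) \<in> borel_measurable (borel :: real measure)" by simp
  note bb = bounded_borel_indicator[OF level_borel[OF id]] trunc_bounded[OF id] resolvent_fun(4)
  have "E (?l n) (f - calc resolvent_fun f) = calc (?t n) (calc resolvent_fun f)" for n
  proof -
    have "E (?l n) (f - calc resolvent_fun f)
        = calc (\<lambda>x. indicat_real (?l n) x - indicat_real (?l n) x * resolvent_fun x) f"
      by (simp add: calc_diff bounded_borel_mult bb calc_mult calc_indicator level_borel[OF id]
          linear_diff[OF E_linear])
    also have "\<dots> = calc (\<lambda>x. ?t n x * resolvent_fun x) f"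
    proof -
      have "bounded_borel (\<lambda>x. indicat_real (?l n) x - indicat_real (?l n) x * resolvent_fun x)"
        using bounded_borel_add[OF bb(1) bounded_borel_cmult[OF bounded_borel_mult[OF bb(1,3)]], of n "-1" n]
        by simp
      then have "calc (\<lambda>x. indicat_real (?l n) x - indicat_real (?l n) x * resolvent_fun x)
          = calc (\<lambda>x. ?t n x * resolvent_fun x)"
        by (rule calc_cong_nonneg[OF s _ bounded_borel_mult[OF bb(2,3)]])
           (simp add: trunc_def resolvent_fun_def indicator_def field_simps)
      then show ?thesis by simp
    qed
    finally show ?thesis by (simp add: calc_mult bb)
  qed
  then show ?thesis by (simp add: spectral_integral_iff[OF id])
qed

end

text \<open>The difference \<open>v\<close> of two solutions satisfies \<open>T v = - v\<close>.\<close>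

lemma positive_resolvent_unique:
  assumes T: "linear_oper T" "positive_oper T" and "(u, f - u) \<in> T" "(v, f - v) \<in> T"
  shows "u = v"
proof -
  have "((-1) *\<^sub>C v, (-1) *\<^sub>C (f - v)) \<in> T" using T(1) assms(4) by (simp add: linear_oper_def)
  then have "(- v, v - f) \<in> T"
    using scaleC_of_real[of "-1" v] scaleC_of_real[of "-1" "f - v"] by simp
  then have "(u + - v, f - u + (v - f)) \<in> T" using T(1) assms(3) unfolding linear_oper_def by blast
  then have "(u - v, - (u - v)) \<in> T" by simp
  then have "cinner (- (u - v)) (u - v) \<in> \<real>\<^sub>\<ge>\<^sub>0" using T(2) by (auto simp: positive_oper_def)
  then have "0 \<le> inner (- (u - v)) (u - v)" by (simp add: complex_nonneg_Reals_iff Re_cinner)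
  then have "inner (u - v) (u - v) \<le> 0" by (simp only: inner_minus_left)
  then show ?thesis by (metis antisym inner_eq_zero_iff inner_ge_zero right_minus_eq)
qed

text \<open>The resolvent determines the moments of \<open>1 / (1 + x)\<close> under all scalar measures, and
  these moments determine the measures.\<close>

theorem spectral_measure_unique:
  assumes E: "pvm E" and F: "pvm F"
    and eq: "spectral_integral E (\<lambda>x. x) = spectral_integral F (\<lambda>x. x)"
    and pos: "positive_oper (spectral_integral E (\<lambda>x. x))" and A: "A \<in> sets borel"
  shows "E A = F A"
proof -
  interpret E: pvm E by fact
  interpret F: pvm F by fact
  have sE: E.supported_nonneg by (rule E.supported_nonneg_if_positive[OF pos])
  have sF: F.supported_nonneg by (rule F.supported_nonneg_if_positive) (use pos eq in simp)
  let ?u = resolvent_fun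
  note u = resolvent_fun
  have res: "E.calc ?u f = F.calc ?u f" for f
  proof (rule positive_resolvent_unique[OF E.linear_spectral_integral pos])
    show "(E.calc ?u f, f - E.calc ?u f) \<in> spectral_integral E (\<lambda>x. x)"
      by (rule E.resolvent_in_graph[OF sE])
    show "(F.calc ?u f, f - F.calc ?u f) \<in> spectral_integral E (\<lambda>x. x)"
      using F.resolvent_in_graph[OF sF, of f] by (simp add: eq)
  qed simp
  have pow: "E.calc (\<lambda>x. ?u x ^ n) f = F.calc (\<lambda>x. ?u x ^ n) f" for n f
  proof (induction n)
    case 0
    then show ?case by (simp add: E.calc_one F.calc_one)
  next
    case (Suc n)
    then show ?case by (simp add: E.calc_mult F.calc_mult u bounded_borel_power res)
  qed
  have int: "(\<integral>x. \<phi> (?u x) \<partial>E.\<mu> f) = (\<integral>x. \<phi> (?u x) \<partial>F.\<mu> f)" if "bounded_borel \<phi>" for \<phi> f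
  proof (rule bounded_borel_induct_powers[OF that _ u(1-3), where P = "\<lambda>\<phi>. (\<integral>x. \<phi> x \<partial>E.\<mu> f) = (\<integral>x. \<phi> x \<partial>F.\<mu> f)"])
    show "bounded_class (\<lambda>\<phi>. (\<integral>x. \<phi> x \<partial>E.\<mu> f) = (\<integral>x. \<phi> x \<partial>F.\<mu> f))"
    proof (rule bounded_classI, goal_cases)
      case (3 \<phi>s \<phi> M)
      show ?case
        using E.integral_tendsto[OF 3(1,3-5), of f] F.integral_tendsto[OF 3(1,3-5), of f] 3(2)
        by (simp add: LIMSEQ_unique)
    qed (simp_all add: E.integrable_bounded F.integrable_bounded)
    show "(\<integral>x. ?u x ^ n \<partial>E.\<mu> f) = (\<integral>x. ?u x ^ n \<partial>F.\<mu> f)" for n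
      using pow[of n f] by (simp add: u bounded_borel_power flip: E.inner_calc_self F.inner_calc_self)
  qed
  have "inner (E A f) f = inner (F A f) f" for f
  proof -
    \<comment> \<open>\<open>\<psi>\<close> undoes the substitution \<open>y = 1/(1 + x)\<close>.\<close>
    define \<psi> where "\<psi> y = indicat_real A (1 / y - 1)" for y
    have "(\<lambda>y. 1 / y - 1) \<in> borel_measurable (borel :: real measure)" by measurable
    then have \<psi>: "bounded_borel \<psi>"
      unfolding \<psi>_def[abs_def] by (rule bounded_borel_comp[OF bounded_borel_indicator[OF A]])
    then have bu: "bounded_borel (\<lambda>x. \<psi> (?u x))" by (rule bounded_borel_comp[OF _ u(1)])
    have \<psi>u: "\<psi> (?u x) = indicat_real A x" if "0 \<le> x" for x
      using that by (simp add: \<psi>_def resolvent_fun_def)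
    have "E.calc (indicat_real A) = E.calc (\<lambda>x. \<psi> (?u x))"
      by (rule E.calc_cong_nonneg[OF sE bounded_borel_indicator[OF A] bu]) (simp add: \<psi>u)
    moreover have "F.calc (indicat_real A) = F.calc (\<lambda>x. \<psi> (?u x))"
      by (rule F.calc_cong_nonneg[OF sF bounded_borel_indicator[OF A] bu]) (simp add: \<psi>u)
    ultimately show ?thesis
      using int[OF \<psi>, of f] bu A
      by (simp add: E.inner_calc_self F.inner_calc_self flip: E.calc_indicator F.calc_indicator)
  qed
  then have "E.calc (indicat_real A) = F A"
    by (intro E.calc_eqI bounded_borel_indicator A F.E_linear F.E_sym)
       (simp_all add: A E.measure_scalar E.space_mu)
  then show ?thesis by (simp add: E.calc_indicator A)
qed


section \<open>Existence of the spectral measure\<close>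

sublocale positive_contraction \<subseteq> measure_family moment_measure
  by (rule measure_family_moments)

context positive_contraction
begin

lemma calc_clamp_power: "calc (\<lambda>x. clamp01 x ^ n) = B ^^ n"
proof (rule calc_eqI)
  show "bounded_borel (\<lambda>x. clamp01 x ^ n)"
    by (intro bounded_borel_power bounded_borelI[where M = 1]) (use clamp01 in auto)
qed (simp_all add: linear_power sym_power integral_clamp01[of "\<lambda>x. x ^ n"] moment_measure)

lemma calc_clamp:
  assumes "bounded_borel \<phi>"
  shows "calc (\<lambda>x. \<phi> (clamp01 x)) = calc \<phi>"
  using assms
  by (intro calc_cong_integral bounded_borel_comp[OF _ clamp01(1)] integral_clamp01)
     (simp_all add: bounded_borel_measurable)

lemma calc_mult_moment:
  assumes "bounded_borel \<phi>" "bounded_borel \<psi>"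
  shows "calc (\<lambda>x. \<phi> x * \<psi> x) f = calc \<phi> (calc \<psi> f)"
proof -
  have "calc (\<lambda>x. \<phi> (clamp01 x) * \<psi> (clamp01 x)) f = calc (\<lambda>x. \<phi> (clamp01 x)) (calc (\<lambda>x. \<psi> (clamp01 x)) f)"
    by (rule calc_mult_powers[OF clamp01 _ assms])
       (simp add: calc_clamp_power funpow_add flip: power_add)
  then show ?thesis
    using calc_clamp[OF bounded_borel_mult[OF assms]] by (simp add: calc_clamp assms)
qed

end

sublocale positive_contraction \<subseteq> multiplicative_family moment_measure
  by unfold_locales (rule calc_mult_moment)

locale complex_positive_contraction = positive_contraction B
  for B :: "'a::chilbert_space \<Rightarrow> 'a" +
  assumes B_i: "B (\<i> *\<^sub>C f) = \<i> *\<^sub>C B f"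
begin

lemma calc_i:
  assumes \<phi>: "bounded_borel \<phi>"
  shows "calc \<phi> (\<i> *\<^sub>C f) = \<i> *\<^sub>C calc \<phi> f"
proof -
  have Bn: "(B ^^ n) (\<i> *\<^sub>C f) = \<i> *\<^sub>C (B ^^ n) f" for n f
    by (induction n) (simp_all add: B_i)
  have "moment_measure (\<i> *\<^sub>C f) = moment_measure f" for f
    unfolding moment_measure_def by (simp add: Bn inner_i_i)
  then show ?thesis using calc_commute[OF \<phi> linear_i inner_i_i surj_i] by blast
qed

lemma calc_indicator_sums:
  assumes A: "range A \<subseteq> sets borel" "disjoint_family A"
  shows "(\<lambda>n. calc (indicat_real (A n)) f) sums calc (indicat_real (\<Union>n. A n)) f"
proof -
  define U where "U n = (\<Union>k<n. A k)" for n
  define V where "V = (\<Union>n. A n)"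
  have Ab: "A n \<in> sets borel" for n using A(1) by auto
  have Ub: "U n \<in> sets borel" and Vb: "V \<in> sets borel" for n using Ab by (auto simp: U_def V_def)
  have partial: "(\<Sum>k<n. calc (indicat_real (A k)) f) = calc (indicat_real (U n)) f" for n
  proof (induction n)
    case 0
    have "calc (\<lambda>x. 0 * 0) f = 0" by (subst calc_cmult) (simp_all add: bounded_borel_const)
    moreover have "indicat_real (U 0) = (\<lambda>x. 0 * 0)" by (simp add: U_def fun_eq_iff)
    ultimately show ?case by simp
  next
    case (Suc n)
    have "A k \<inter> A n = {}" if "k < n" for k
      using A(2) that by (simp add: disjoint_family_on_def)
    then have "A n \<inter> U n = {}" by (auto simp: U_def)
    moreover have "U (Suc n) = U n \<union> A n" by (auto simp: U_def lessThan_Suc)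
    ultimately have "indicat_real (U (Suc n)) = (\<lambda>x. indicat_real (U n) x + indicat_real (A n) x)"
      by (auto simp: fun_eq_iff indicator_def)
    then show ?case using Suc by (simp add: calc_add bounded_borel_indicator Ab Ub)
  qed
  have "(\<lambda>n. calc (indicat_real (U n)) f) \<longlonglongrightarrow> calc (indicat_real V) f"
  proof (rule calc_tendsto[where M = 1])
    show "(\<lambda>n. indicat_real (U n) x) \<longlonglongrightarrow> indicat_real V x" for x
      unfolding U_def V_def by (rule LIMSEQ_indicator_UN)
  qed (auto simp: bounded_borel_indicator Ub Vb indicator_def)
  then show ?thesis by (simp add: sums_def partial V_def)
qed

lemma pvm_contraction: "pvm (\<lambda>A. calc (indicat_real A))"
proof (unfold_locales, unfold projection_valued_measure_def, intro conjI allI impI ballI)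
  fix A :: "real set" assume A: "A \<in> sets borel"
  note bA = bounded_borel_indicator[OF A]
  show "orth_projection (calc (indicat_real A))"
    unfolding orth_projection_def
  proof (intro conjI allI)
    show "calc (indicat_real A) (x + y) = calc (indicat_real A) x + calc (indicat_real A) y" for x y
      by (rule calc_addv[OF bA])
    show "calc (indicat_real A) (a *\<^sub>C x) = a *\<^sub>C calc (indicat_real A) x" for a x
      by (simp add: scaleC_eq[of a] calc_addv[OF bA] linear_scale[OF calc_linear[OF bA]] calc_i bA)
    show "calc (indicat_real A) (calc (indicat_real A) x) = calc (indicat_real A) x" for x
      by (simp flip: calc_mult[OF bA bA] indicator_inter_arith)
    show "cinner (calc (indicat_real A) x) y = cinner x (calc (indicat_real A) y)" for x y
      by (simp add: cinner_eq calc_sym[OF bA] calc_i[OF bA])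
  qed
next
  have "indicat_real UNIV = (\<lambda>x. 1)" by (simp add: fun_eq_iff)
  then show "calc (indicat_real UNIV) = id" by (simp add: calc_one id_def)
next
  fix A C :: "real set" assume "A \<in> sets borel" "C \<in> sets borel"
  then show "calc (indicat_real (A \<inter> C)) = calc (indicat_real A) \<circ> calc (indicat_real C)"
    by (simp add: fun_eq_iff bounded_borel_indicator indicator_inter_arith[abs_def]
        flip: calc_mult)
qed (rule calc_indicator_sums)

lemma scalar_measure_contraction: "scalar_measure (\<lambda>A. calc (indicat_real A)) f = moment_measure f"
proof (rule measure_eqI)
  interpret E: pvm "\<lambda>A. calc (indicat_real A)" by (rule pvm_contraction)
  show "sets (scalar_measure (\<lambda>A. calc (indicat_real A)) f) = sets (moment_measure f)"
    by (simp add: E.sets_scalar moment_measure)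
  fix A assume "A \<in> sets (scalar_measure (\<lambda>A. calc (indicat_real A)) f)"
  then have A: "A \<in> sets borel" by (simp add: E.sets_scalar)
  then have "inner (calc (indicat_real A) f) f = measure (moment_measure f) A"
    by (simp add: inner_calc_self bounded_borel_indicator space_mu)
  then show "emeasure (scalar_measure (\<lambda>A. calc (indicat_real A)) f) A = emeasure (moment_measure f) A"
    using A by (simp add: E.emeasure_scalar finite_measure.emeasure_eq_measure[OF moment_measure(2)])
qed

text \<open>The projection onto the atom at \<open>0\<close> is annihilated by \<open>B\<close>.\<close>

lemma moment_measure_pos:
  assumes inj: "\<And>f. B f = 0 \<Longrightarrow> f = 0"
  shows "AE x in moment_measure f. 0 < x"
proof -
  note b0 = bounded_borel_indicator[of "{0}", simplified]
  have bc: "bounded_borel clamp01" by (rule bounded_borelI[where M = 1]) (use clamp01 in auto)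
  have B: "calc clamp01 = B" using calc_clamp_power[of 1] by simp
  have "B (calc (indicat_real {0}) f) = calc (\<lambda>x. clamp01 x * indicat_real {0} x) f"
    by (simp only: calc_mult_moment[OF bc b0] B)
  also have "(\<lambda>x. clamp01 x * indicat_real {0} x) = (\<lambda>x. 0 * indicat_real {0} x)"
    by (auto simp: fun_eq_iff clamp01_def indicator_def)
  finally have "calc (indicat_real {0}) f = 0" using calc_cmult[OF b0, of 0 f] inj by simp
  then have "measure (moment_measure f) {0} = 0"
    using inner_calc_self[OF b0, of f] by (simp add: space_mu)
  then have "emeasure (moment_measure f) {0} = 0"
    by (simp add: finite_measure.emeasure_eq_measure[OF moment_measure(2)])
  then have "{0} \<in> null_sets (moment_measure f)" by (intro null_setsI) (simp_all add: moment_measure)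
  from AE_not_in[OF this] moment_measure(3)[of f] show ?thesis
    by eventually_elim simp
qed

end


text \<open>Among real numbers \<open>x \<ge> 0\<close> and \<open>0 < y \<le> 1\<close>, the substitution \<open>x = 1/y - 1\<close> inverts
  \<open>y = 1/(1 + x)\<close>. So a spectral measure of \<open>B = (1 + L)\<^sup>-\<^sup>1\<close>, which has no mass at \<open>0\<close> as \<open>B\<close> is
  injective, is transported to one whose resolvent is \<open>B\<close>.\<close>

lemma pvm_with_resolvent_exists:
  fixes B :: "'a::chilbert_space \<Rightarrow> 'a"
  assumes B: "positive_contraction B" and i: "\<And>f. B (\<i> *\<^sub>C f) = \<i> *\<^sub>C B f"
    and inj: "\<And>f. B f = 0 \<Longrightarrow> f = 0"
  obtains F where "pvm F" "\<And>f. (B f, f - B f) \<in> spectral_integral F (\<lambda>x. x)"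
proof -
  interpret B: complex_positive_contraction B
    by (rule complex_positive_contraction.intro[OF B]) (unfold_locales, rule i)
  define E where "E A = B.calc (indicat_real A)" for A
  have pE: "pvm E" unfolding E_def[abs_def] by (rule B.pvm_contraction)
  have \<mu>E: "scalar_measure E f = B.moment_measure f" for f
    unfolding E_def[abs_def] by (rule B.scalar_measure_contraction)
  \<comment> \<open>Division by zero gives \<open>k 0 = - 1\<close>; the point \<open>0\<close> has measure zero by
    \<open>moment_measure_pos\<close>.\<close>
  define k where "k y = 1 / y - 1" for y :: real
  have k[measurable]: "k \<in> borel_measurable borel" unfolding k_def[abs_def] by measurable
  define F where "F A = E (k -` A)" for A
  have pF: "pvm F" unfolding F_def[abs_def] by (rule pvm_vimage[OF pE k])
  interpret F: pvm F by (rule pF)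
  have \<mu>F: "scalar_measure F f = distr (B.moment_measure f) borel k" for f
    using scalar_measure_vimage[OF pE k, of f] by (simp add: F_def[abs_def] \<mu>E)
  have "AE y in B.moment_measure f. 0 < y" for f
    by (rule B.moment_measure_pos) (rule inj)
  then have pos: "AE y in B.moment_measure f. 0 < y \<and> y \<le> 1" for f
    using B.moment_measure(3)[of f] by eventually_elim simp
  have F_nonneg: F.supported_nonneg
    unfolding F.supported_nonneg_iff_AE \<mu>F
  proof
    fix f
    have "AE y in B.moment_measure f. 0 \<le> k y"
      using pos[of f] by eventually_elim (simp add: k_def)
    then show "AE x in distr (B.moment_measure f) borel k. 0 \<le> x"
      by (subst AE_distr_iff) (auto simp: B.measurable_mu)
  qed
  have "F.calc resolvent_fun = B"
  proof (rule F.calc_eqI[OF resolvent_fun(4) B.linear_B B.sym_B])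
    fix f
    have "(\<integral>x. resolvent_fun x \<partial>scalar_measure F f) = (\<integral>y. resolvent_fun (k y) \<partial>B.moment_measure f)"
      unfolding \<mu>F using resolvent_fun(1) by (subst integral_distr) (auto simp: B.measurable_mu)
    also have "\<dots> = (\<integral>y. y ^ 1 \<partial>B.moment_measure f)"
    proof (rule integral_cong_AE)
      show "AE y in B.moment_measure f. resolvent_fun (k y) = y ^ 1"
        using pos[of f] by eventually_elim (simp add: k_def resolvent_fun_def)
    qed (use measurable_compose[OF k resolvent_fun(1)] in \<open>simp_all add: B.measurable_mu\<close>)
    also have "\<dots> = inner (B f) f" using B.moment_measure(4)[where n = 1] by simp
    finally show "inner (B f) f = (\<integral>x. resolvent_fun x \<partial>scalar_measure F f)" ..
  qed
  then have "(B f, f - B f) \<in> spectral_integral F (\<lambda>x. x)" for f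
    using F.resolvent_in_graph[OF F_nonneg, of f] by simp
  then show thesis using that pF by blast
qed

lemma linear_operD:
  assumes "linear_oper T"
  shows "(x, y) \<in> T \<Longrightarrow> (x', y') \<in> T \<Longrightarrow> (x + x', y + y') \<in> T"
    and "(x, y) \<in> T \<Longrightarrow> (a *\<^sub>C x, a *\<^sub>C y) \<in> T"
    and "(x, y) \<in> T \<Longrightarrow> (c *\<^sub>R x, c *\<^sub>R y) \<in> T"
    and "(x, y) \<in> T \<Longrightarrow> (x, y') \<in> T \<Longrightarrow> y = y'"
    and "(0, 0) \<in> T"
  using assms scaleC_of_real[of c x] scaleC_of_real[of c y]
  by (auto simp: linear_oper_def single_valued_def) metis

lemma self_adjoint_graph_iff:
  assumes T: "self_adjoint T"
  shows "(y, z) \<in> T \<longleftrightarrow> (\<forall>x w. (x, w) \<in> T \<longrightarrow> inner w y = inner x z)"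
proof
  assume "(y, z) \<in> T"
  then show "\<forall>x w. (x, w) \<in> T \<longrightarrow> inner w y = inner x z"
    using self_adjoint_symmetric[OF T] by (metis Re_cinner)
next
  assume *: "\<forall>x w. (x, w) \<in> T \<longrightarrow> inner w y = inner x z"
  have "cinner w y = cinner x z" if "(x, w) \<in> T" for x w
  proof -
    have "(\<i> *\<^sub>C x, \<i> *\<^sub>C w) \<in> T" using linear_operD(2)[OF _ that] T unfolding self_adjoint_def by blast
    then have "inner (\<i> *\<^sub>C w) y = inner (\<i> *\<^sub>C x) z" using * by blast
    then show ?thesis using * that by (simp add: cinner_eq inner_i_left)
  qed
  then have "(y, z) \<in> adjoint_oper T" by (simp add: adjoint_oper_iff)
  then show "(y, z) \<in> T" using T by (simp add: self_adjoint_def)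
qed

lemma positive_operD: "positive_oper T \<Longrightarrow> (f, g) \<in> T \<Longrightarrow> 0 \<le> inner g f"
  by (auto simp: positive_oper_def complex_nonneg_Reals_iff Re_cinner)

text \<open>The range of \<open>1 + L\<close> is closed because \<open>1 + L\<close> is bounded below, and a vector \<open>h\<close>
  orthogonal to it satisfies \<open>L h = - h\<close>, so that \<open>h = 0\<close>.\<close>

lemma positive_self_adjoint_resolvent:
  fixes L :: "'a::chilbert_space oper"
  assumes L: "self_adjoint L" and pos: "positive_oper L"
  obtains u where "(u, f - u) \<in> L"
proof -
  have lin: "linear_oper L" using L by (simp add: self_adjoint_def)
  note linD = linear_operD[OF lin]
  define M where "M = {y. \<exists>u. (u, y - u) \<in> L}"
  have "subspace M"
    unfolding subspace_def
  proof (intro conjI ballI allI)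
    show "0 \<in> M" using linD(5) by (auto simp: M_def intro!: exI[of _ 0])
    fix x y c assume "x \<in> M"
    then obtain u where u: "(u, x - u) \<in> L" by (auto simp: M_def)
    then have "(c *\<^sub>R u, c *\<^sub>R x - c *\<^sub>R u) \<in> L" using linD(3)[OF u, of c] by (simp add: scaleR_diff_right)
    then show "c *\<^sub>R x \<in> M" by (auto simp: M_def)
    assume "y \<in> M"
    then obtain v where v: "(v, y - v) \<in> L" by (auto simp: M_def)
    have "(u + v, x + y - (u + v)) \<in> L" using linD(1)[OF u v] by (simp add: algebra_simps)
    then show "x + y \<in> M" by (auto simp: M_def)
  qed
  moreover have "closed M"
    unfolding closed_sequential_limits
  proof (intro allI impI, elim conjE)
    fix s y assume "\<forall>n. s n \<in> M" and lim: "s \<longlonglongrightarrow> y"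
    then obtain u where u: "\<And>n. (u n, s n - u n) \<in> L" by (simp add: M_def) metis
    have contract: "norm (u m - u n) \<le> norm (s m - s n)" for m n
    proof -
      have "(u m + (- 1) *\<^sub>R u n, s m - u m + (- 1) *\<^sub>R (s n - u n)) \<in> L"
        by (intro linD(1) linD(3) u)
      then have "0 \<le> inner (s m - u m + (- 1) *\<^sub>R (s n - u n)) (u m + (- 1) *\<^sub>R u n)"
        by (rule positive_operD[OF pos])
      then have "inner (u m - u n) (u m - u n) \<le> inner (s m - s n) (u m - u n)"
        by (simp add: algebra_simps)
      also have "\<dots> \<le> norm (s m - s n) * norm (u m - u n)" by (rule norm_cauchy_schwarz)
      finally have "norm (u m - u n) * norm (u m - u n) \<le> norm (s m - s n) * norm (u m - u n)"
        by (simp add: dot_square_norm power2_eq_square)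
      then show ?thesis by (cases "u m = u n") auto
    qed
    have "Cauchy s" using lim by (rule LIMSEQ_imp_Cauchy)
    then have "Cauchy u"
      unfolding Cauchy_def dist_norm using contract by (meson le_less_trans)
    then obtain v where v: "u \<longlonglongrightarrow> v" using Cauchy_convergent convergent_def by blast
    have "inner w v = inner x (y - v)" if xw: "(x, w) \<in> L" for x w
    proof (rule LIMSEQ_unique)
      show "(\<lambda>n. inner w (u n)) \<longlonglongrightarrow> inner w v" by (intro tendsto_intros v)
      have "inner w (u n) = inner x (s n - u n)" for n
        using u xw self_adjoint_graph_iff[OF L] by blast
      then show "(\<lambda>n. inner w (u n)) \<longlonglongrightarrow> inner x (y - v)"
        by (simp, intro tendsto_intros v lim)
    qed
    then have "(v, y - v) \<in> L" using self_adjoint_graph_iff[OF L] by blast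
    then show "y \<in> M" by (auto simp: M_def)
  qed
  ultimately obtain m where m: "m \<in> M" "\<And>y. y \<in> M \<Longrightarrow> inner (f - m) y = 0"
    using orthogonal_foot_exists[of M f] by blast
  define h where "h = f - m"
  have "inner w h = inner x (- h)" if "(x, w) \<in> L" for x w
  proof -
    have "x + w \<in> M" using that by (auto simp: M_def intro!: exI[of _ x])
    then have "inner h (x + w) = 0" using m(2) by (simp add: h_def)
    then show ?thesis by (simp add: inner_add_right inner_commute)
  qed
  then have "(h, - h) \<in> L" using self_adjoint_graph_iff[OF L] by blast
  from positive_operD[OF pos this] have "h = 0"
    by (metis antisym inner_eq_zero_iff inner_ge_zero inner_minus_left neg_0_le_iff_le)
  then have "f \<in> M" using m(1) by (simp add: h_def)
  then show thesis using that by (auto simp: M_def)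
qed

theorem spectral_measure_exists:
  fixes L :: "'a::chilbert_space oper"
  assumes L: "self_adjoint L" and pos: "positive_oper L"
  shows "\<exists>E. is_spectral_measure L E"
proof -
  have lin: "linear_oper L" using L by (simp add: self_adjoint_def)
  note linD = linear_operD[OF lin]
  have "\<exists>u. (u, f - u) \<in> L" for f using positive_self_adjoint_resolvent[OF L pos] by metis
  then obtain B where B: "\<And>f. (B f, f - B f) \<in> L" by metis
  have B_eqI: "B f = u" if "(u, f - u) \<in> L" for f u
    by (rule positive_resolvent_unique[OF lin pos B that])
  have contraction: "positive_contraction B"
  proof
    show "B (f + h) = B f + B h" for f h
      using linD(1)[OF B B, of f h] by (intro B_eqI) (simp add: algebra_simps)
    show "B (c *\<^sub>R f) = c *\<^sub>R B f" for c f
      using linD(3)[OF B, of c f] by (intro B_eqI) (simp add: scaleR_diff_right)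
    show "inner (B f) h = inner f (B h)" for f h
    proof -
      have "inner (f - B f) (B h) = inner (B f) (h - B h)"
        using B self_adjoint_graph_iff[OF L] by blast
      then show ?thesis by (simp add: inner_diff_left inner_diff_right)
    qed
    have le: "inner (B f) (B f) \<le> inner (B f) f" for f
      using positive_operD[OF pos B, of f] by (simp add: inner_diff_left inner_commute[of f])
    then show "0 \<le> inner (B f) f" for f by (meson inner_ge_zero order_trans)
    show "inner (B f) f \<le> inner f f" for f
    proof -
      have "0 \<le> inner (f - B f) (f - B f)" by simp
      then show ?thesis using le[of f] by (simp add: inner_diff_left inner_diff_right inner_commute)
    qed
  qed
  have "B (\<i> *\<^sub>C f) = \<i> *\<^sub>C B f" for f
  proof (rule B_eqI)
    have "\<i> *\<^sub>C (f - B f) = \<i> *\<^sub>C f - \<i> *\<^sub>C B f"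
      using scaleC_add_right[of \<i> f "- B f"] by (simp add: scaleC_minus)
    then show "(\<i> *\<^sub>C B f, \<i> *\<^sub>C f - \<i> *\<^sub>C B f) \<in> L" using linD(2)[OF B, of \<i> f] by simp
  qed
  moreover have "f = 0" if "B f = 0" for f using linD(4)[OF _ linD(5), of f] B[of f] that by simp
  ultimately obtain F where F: "pvm F" "\<And>f. (B f, f - B f) \<in> spectral_integral F (\<lambda>x. x)"
    using pvm_with_resolvent_exists[OF contraction] by metis
  interpret F: pvm F by fact
  have id: "(\<lambda>x. x) \<in> borel_measurable (borel :: real measure)" by simp
  have "L \<subseteq> spectral_integral F (\<lambda>x. x)"
  proof
    fix p assume "p \<in> L"
    moreover obtain u w where p: "p = (u, w)" by (cases p)
    ultimately have "B (u + w) = u" by (intro B_eqI) simp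
    then show "p \<in> spectral_integral F (\<lambda>x. x)" using F(2)[of "u + w"] by (simp add: p)
  qed
  then have "L = spectral_integral F (\<lambda>x. x)"
    using self_adjoint_symmetric[OF F.self_adjoint_spectral_integral[OF id]]
    by (rule self_adjoint_maximal[OF L])
  then show ?thesis using F.pvm by (auto simp: is_spectral_measure_def)
qed


section \<open>The square root and its spectral measure\<close>

context
  fixes L :: "'a::chilbert_space oper"
  assumes L: "self_adjoint L" and pos: "positive_oper L"
begin

lemma spectral_measure_props:
  shows pvm_spectral_measure: "pvm (spectral_measure L)"
    and spectral_integral_spectral_measure: "spectral_integral (spectral_measure L) (\<lambda>x. x) = L"
    and supported_spectral_measure: "pvm.supported_nonneg (spectral_measure L)"
proof -
  have *: "is_spectral_measure L (spectral_measure L)"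
    unfolding spectral_measure_def using spectral_measure_exists[OF L pos] by (rule someI_ex)
  then show "pvm (spectral_measure L)" by unfold_locales (simp add: is_spectral_measure_def)
  then interpret pvm "spectral_measure L" .
  show "spectral_integral (spectral_measure L) (\<lambda>x. x) = L" using * by (simp add: is_spectral_measure_def)
  then show supported_nonneg using supported_nonneg_if_positive pos by simp
qed

text \<open>The push-forward of the spectral measure of a square root under squaring is a spectral
  measure of \<open>L\<close>, hence the only one.\<close>

lemma spectral_measure_square:
  assumes S: "pvm F" "spectral_integral F (\<lambda>x. x) O spectral_integral F (\<lambda>x. x) = L"
    and A: "A \<in> sets borel"
  shows "F ((\<lambda>x. x\<^sup>2) -` A) = spectral_measure L A"
proof -
  interpret F: pvm F by fact
  have sq: "(\<lambda>x::real. x\<^sup>2) \<in> borel_measurable borel" by measurable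
  have "spectral_integral (\<lambda>B. F ((\<lambda>x. x\<^sup>2) -` B)) (\<lambda>x. x) = spectral_integral F (\<lambda>x. x\<^sup>2)"
    by (rule spectral_integral_vimage[OF S(1) sq]) simp
  also have "\<dots> = L" using F.spectral_integral_square[of "\<lambda>x. x"] S(2) by simp
  finally show ?thesis
    using spectral_measure_unique[OF pvm_vimage[OF S(1) sq] pvm_spectral_measure _ _ A]
    by (simp add: spectral_integral_spectral_measure pos)
qed

text \<open>A second positive square root has a spectral measure too, and \<open>L\<close> determines its
  push-forward under squaring.\<close>

lemma sqrt_oper_props:
  shows self_adjoint_sqrt: "self_adjoint (sqrt_oper L)"
    and positive_sqrt: "positive_oper (sqrt_oper L)"
    and sqrt_square: "sqrt_oper L O sqrt_oper L = L"
proof -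
  interpret E: pvm "spectral_measure L" by (rule pvm_spectral_measure)
  note sE = supported_spectral_measure
  let ?S = "spectral_integral (spectral_measure L) sqrt"
  have msqrt: "sqrt \<in> borel_measurable borel" by measurable
  have "?S O ?S = spectral_integral (spectral_measure L) (\<lambda>x. (sqrt x)\<^sup>2)"
    by (rule E.spectral_integral_square[OF msqrt])
  also have "\<dots> = spectral_integral (spectral_measure L) (\<lambda>x. x)"
    by (rule E.spectral_integral_cong[OF sE]) simp_all
  finally have "?S O ?S = L" by (simp add: spectral_integral_spectral_measure)
  then have ex: "self_adjoint ?S \<and> positive_oper ?S \<and> ?S O ?S = L"
    using E.self_adjoint_spectral_integral[OF msqrt] E.positive_spectral_integral[OF sE msqrt] by simp
  have "S = ?S" if S: "self_adjoint S \<and> positive_oper S \<and> S O S = L" for S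
  proof -
    obtain F where "is_spectral_measure S F" using spectral_measure_exists S by blast
    then have F: "pvm F" "S = spectral_integral F (\<lambda>x. x)"
      by (auto simp: is_spectral_measure_def pvm_def)
    interpret F: pvm F by (rule F(1))
    have sF: F.supported_nonneg using F.supported_nonneg_if_positive S F(2) by simp
    have sq: "(\<lambda>x::real. x\<^sup>2) \<in> borel_measurable borel" by measurable
    have "S = spectral_integral F (\<lambda>x. sqrt (x\<^sup>2))"
      unfolding F(2) by (rule F.spectral_integral_cong[OF sF]) simp_all
    also have "\<dots> = spectral_integral (\<lambda>B. F ((\<lambda>x. x\<^sup>2) -` B)) sqrt"
      by (rule spectral_integral_vimage[OF F(1) sq msqrt, symmetric])
    also have "\<dots> = ?S"
      using spectral_integral_eqI[OF pvm_vimage[OF F(1) sq] pvm_spectral_measure]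
        spectral_measure_square[OF F(1)] S F(2) by simp
    finally show ?thesis .
  qed
  with ex have "sqrt_oper L = ?S" unfolding sqrt_oper_def by (intro the_equality) blast+
  with ex show "self_adjoint (sqrt_oper L)" "positive_oper (sqrt_oper L)" "sqrt_oper L O sqrt_oper L = L"
    by simp_all
qed

end

text \<open>The preimage of \<open>[0, \<omega>\<^sup>2]\<close> under squaring is \<open>[-\<omega>, \<omega>]\<close>, whose negative part has
  spectral measure zero.\<close>

theorem paley_wiener_sqrt:
  fixes L :: "'a::chilbert_space oper"
  assumes L: "self_adjoint L" and pos: "positive_oper L" and \<omega>: "0 \<le> \<omega>"
  shows "paley_wiener (sqrt_oper L) \<omega> = range (spectral_measure L {0..\<omega>\<^sup>2})"
proof -
  let ?S = "sqrt_oper L"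
  note S = self_adjoint_sqrt[OF L pos] positive_sqrt[OF L pos]
  interpret F: pvm "spectral_measure ?S" by (rule pvm_spectral_measure[OF S])
  have "(\<lambda>x. x\<^sup>2) -` {0..\<omega>\<^sup>2} = {-\<omega>..\<omega>}"
  proof -
    have "x\<^sup>2 \<le> \<omega>\<^sup>2 \<longleftrightarrow> - \<omega> \<le> x \<and> x \<le> \<omega>" for x
      using \<omega> abs_le_square_iff[of x \<omega>] by (auto simp: abs_le_iff)
    then show ?thesis by auto
  qed
  then have "spectral_measure L {0..\<omega>\<^sup>2} = spectral_measure ?S {-\<omega>..\<omega>}"
    using spectral_measure_square[OF L pos F.pvm_axioms, of "{0..\<omega>\<^sup>2}"]
    by (simp add: spectral_integral_spectral_measure[OF S] sqrt_square[OF L pos])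
  also have "\<dots> = F.calc (indicat_real {-\<omega>..\<omega>})" by (simp add: F.calc_indicator)
  also have "\<dots> = F.calc (indicat_real {0..\<omega>})"
    using \<omega> by (intro F.calc_cong_nonneg[OF supported_spectral_measure[OF S]] bounded_borel_indicator)
      (auto simp: indicator_def)
  finally show ?thesis by (simp add: paley_wiener_def F.calc_indicator)
qed


section \<open>A discrete Hardy inequality\<close>

lemma convex_powr_two_point:
  fixes x y p :: real
  assumes "1 \<le> p" "0 \<le> x" "0 \<le> y" "0 < \<rho>" "\<rho> < 1"
  shows "(\<rho> * x + (1 - \<rho>) * y) powr p \<le> \<rho> * x powr p + (1 - \<rho>) * y powr p"
proof -
  have scale: "(c * z) powr p \<le> c * z powr p" if "0 \<le> c" "c \<le> 1" "0 \<le> z" for c z :: real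
  proof (cases "c = 0")
    case False
    have "c powr p \<le> c powr 1" using that assms False by (intro powr_mono') auto
    then show ?thesis using that False by (simp add: powr_mult mult_right_mono)
  qed (use assms in simp)
  consider "x = 0" | "y = 0" | "0 < x" "0 < y" using assms by linarith
  then show ?thesis
  proof cases
    case 1
    then show ?thesis using scale[of "1 - \<rho>" y] assms by simp
  next
    case 2
    then show ?thesis using scale[of \<rho> x] assms by simp
  next
    case 3
    have "convex_on {0<..} (\<lambda>x. x powr p)" by (rule powr_convex) fact
    from convex_onD[OF this, of "1 - \<rho>" x y] show ?thesis using 3 assms by simp
  qed
qed

text \<open>Writing \<open>\<rho> m + b = \<rho> m + (1 - \<rho>) (b / (1 - \<rho>))\<close> as a convex combination makes the power
  sums telescope.\<close>

lemma recursive_power_sum_le: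
  fixes m b :: "nat \<Rightarrow> real"
  assumes p: "1 \<le> p" and \<rho>: "0 < \<rho>" "\<rho> < 1"
    and m: "\<And>j. 0 \<le> m j" and b: "\<And>j. 0 \<le> b j"
    and m0: "m 0 \<le> b 0" and rec: "\<And>j. m (Suc j) \<le> \<rho> * m j + b (Suc j)"
  shows "(\<Sum>j<n. m j powr p) \<le> (1 / (1 - \<rho>)) powr p * (\<Sum>j<n. b j powr p)"
proof -
  define c where "c = (1 / (1 - \<rho>)) powr p"
  have step: "z powr p \<le> \<rho> * x powr p + (1 - \<rho>) * c * b j powr p"
    if "0 \<le> z" "0 \<le> x" "z \<le> \<rho> * x + b j" for x z j
  proof -
    have "z powr p \<le> (\<rho> * x + (1 - \<rho>) * (b j / (1 - \<rho>))) powr p"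
      using that p \<rho> by (intro powr_mono2) auto
    also have "\<dots> \<le> \<rho> * x powr p + (1 - \<rho>) * (b j / (1 - \<rho>)) powr p"
      using that p \<rho> b by (intro convex_powr_two_point) auto
    also have "(b j / (1 - \<rho>)) powr p = c * b j powr p"
      using \<rho> b[of j] by (simp add: c_def powr_divide)
    finally show ?thesis by (simp add: mult.assoc)
  qed
  have main: "(\<Sum>j<Suc n. m j powr p) \<le> \<rho> * (\<Sum>j<n. m j powr p) + (1 - \<rho>) * c * (\<Sum>j<Suc n. b j powr p)" for n
  proof (induction n)
    case 0
    then show ?case using step[of "m 0" 0 0] m m0 p by simp
  next
    case (Suc n)
    have "m (Suc n) powr p \<le> \<rho> * m n powr p + (1 - \<rho>) * c * b (Suc n) powr p"
      by (rule step) (use m rec in auto)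
    then show ?case using Suc by (simp add: algebra_simps)
  qed
  show ?thesis
  proof (cases n)
    case (Suc k)
    have "\<rho> * (\<Sum>j<k. m j powr p) \<le> \<rho> * (\<Sum>j<n. m j powr p)"
      using \<rho> by (intro mult_left_mono sum_mono2) (auto simp: Suc)
    then have "(1 - \<rho>) * (\<Sum>j<n. m j powr p) \<le> (1 - \<rho>) * (c * (\<Sum>j<n. b j powr p))"
      using main[of k] by (simp only: Suc) (simp add: algebra_simps)
    then show ?thesis using \<rho> by (simp add: c_def)
  qed simp
qed

lemma recursive_sup_le:
  fixes m b :: "nat \<Rightarrow> real"
  assumes \<rho>: "0 < \<rho>" "\<rho> < 1" and m0: "m 0 \<le> b 0"
    and rec: "\<And>j. m (Suc j) \<le> \<rho> * m j + b (Suc j)" and bA: "\<And>j. b j \<le> A" and A: "0 \<le> A"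
  shows "m j \<le> A / (1 - \<rho>)"
proof (induction j)
  case 0
  have "A * (1 - \<rho>) \<le> A * 1" using A \<rho> by (intro mult_left_mono) auto
  then have "A \<le> A / (1 - \<rho>)" using \<rho> by (simp add: le_divide_eq)
  then show ?case using m0 bA[of 0] by simp
next
  case (Suc j)
  have "m (Suc j) \<le> \<rho> * (A / (1 - \<rho>)) + A"
    using rec[of j] bA[of "Suc j"] mult_left_mono[OF Suc, of \<rho>] \<rho> by linarith
  also have "\<dots> = A / (1 - \<rho>)" using \<rho> by (simp add: field_simps)
  finally show ?case .
qed


section \<open>Approximation spaces and the real interpolation method\<close>

lemma ennreal_le_suminf: "f j \<le> suminf f" for f :: "nat \<Rightarrow> ennreal"
  using sum_le_suminf[of f "{j}"] by simp

lemma ennreal_finiteE: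
  assumes "x \<noteq> (\<infinity>::ennreal)"
  obtains s where "x = ennreal s" "0 \<le> s"
  using assms by (cases x) auto

lemma ennreal_root_le:
  assumes "x \<le> ennreal R" "0 \<le> R" "0 < p"
  shows "ennreal_root p x \<le> ennreal (R powr (1 / p))"
proof -
  have "x \<noteq> \<infinity>" using assms(1) by (auto simp: top_unique)
  moreover have "enn2real x \<le> R" using assms by (simp add: enn2real_leI)
  ultimately show ?thesis
    using assms by (simp add: ennreal_root_def powr_mono2 ennreal_leI)
qed

lemma ennreal_root_ennreal: "0 \<le> s \<Longrightarrow> ennreal_root p (ennreal s) = ennreal (s powr (1 / p))"
  by (simp add: ennreal_root_def)

text \<open>The hypotheses are a Jackson inequality for the error \<open>\<parallel>f - P j f\<parallel>\<close> and a Bernstein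
  inequality for the increments of the approximants, at the dyadic scale.\<close>

locale jackson_bernstein =
  fixes X :: "'a::real_normed_vector set" and N :: "'a \<Rightarrow> real" and P :: "nat \<Rightarrow> 'a \<Rightarrow> 'a"
    and r :: nat and C :: real
  assumes r: "0 < r" and C: "1 \<le> C"
    and zero_X: "0 \<in> X" and N_zero: "N 0 = 0" and norm_le_N: "f \<in> X \<Longrightarrow> norm f \<le> N f"
    and P_X: "P j f \<in> X"
    and jackson: "g \<in> X \<Longrightarrow> norm (f - P j f) \<le> norm (f - g) + (1/2) ^ (r * j) * N g"
    and bernstein_0: "N (P 0 f) \<le> C * norm f"
    and bernstein_Suc: "N (P (Suc j) f) \<le> N (P j f) + C * 2 ^ (r * j) * norm (f - P j f)"
begin

abbreviation K :: "'a \<Rightarrow> real \<Rightarrow> real" where "K \<equiv> K_functional X N"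

lemma N_nonneg: "f \<in> X \<Longrightarrow> 0 \<le> N f"
  using norm_le_N[of f] norm_ge_zero[of f] by linarith

lemma K_le:
  assumes "0 \<le> t" "g \<in> X"
  shows "K f t \<le> norm (f - g) + t * N g"
proof -
  let ?S = "{norm f0 + t * N f1 | f0 f1. f1 \<in> X \<and> f = f0 + f1}"
  have "bdd_below ?S" using assms N_nonneg by (intro bdd_belowI[of _ 0]) auto
  moreover have "norm (f - g) + t * N g \<in> ?S" 
    by (rule CollectI, rule exI[of _ "f - g"], rule exI[of _ g]) (simp add: assms(2))
  ultimately show ?thesis unfolding K_functional_def by (intro cInf_lower)
qed

lemma K_ge:
  assumes "\<And>g. g \<in> X \<Longrightarrow> c \<le> norm (f - g) + t * N g"
  shows "c \<le> K f t"
  unfolding K_functional_def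
proof (rule cInf_greatest)
  have "f = f + 0" by simp
  then show "{norm f0 + t * N f1 | f0 f1. f1 \<in> X \<and> f = f0 + f1} \<noteq> {}" using zero_X by blast
  fix x assume "x \<in> {norm f0 + t * N f1 | f0 f1. f1 \<in> X \<and> f = f0 + f1}"
  then obtain f0 f1 where x: "x = norm f0 + t * N f1" "f1 \<in> X" "f = f0 + f1" by blast
  then show "c \<le> x" using assms[OF x(2)] by simp
qed

lemma K_nonneg: "0 \<le> t \<Longrightarrow> 0 \<le> K f t"
  by (rule K_ge) (simp add: N_nonneg)

lemma K_mono: "0 \<le> s \<Longrightarrow> s \<le> t \<Longrightarrow> K f s \<le> K f t"
proof (rule K_ge)
  fix g assume st: "0 \<le> s" "s \<le> t" and g: "g \<in> X"
  have "K f s \<le> norm (f - g) + s * N g" by (rule K_le[OF st(1) g])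
  also have "\<dots> \<le> norm (f - g) + t * N g" using st N_nonneg[OF g] by (simp add: mult_right_mono)
  finally show "K f s \<le> norm (f - g) + t * N g" .
qed

lemma K_le_norm: "0 \<le> t \<Longrightarrow> K f t \<le> norm f"
  using K_le[OF _ zero_X, of t f] by (simp add: N_zero)

lemma norm_le_K_one: "norm f \<le> K f 1"
proof (rule K_ge)
  fix g assume "g \<in> X"
  then show "norm f \<le> norm (f - g) + 1 * N g"
    using norm_le_N[of g] norm_triangle_ineq[of "f - g" g] by simp
qed

context
  fixes \<alpha> :: real assumes \<alpha>: "0 < \<alpha>" "\<alpha> < real r"
begin

text \<open>The weights \<open>2^(j \<alpha>)\<close> are \<open>t powr (- \<alpha> / r)\<close> at the points \<open>t = pt j\<close>.\<close>

definition pt :: "real \<Rightarrow> real" where "pt x = 2 powr (- (real r * x))"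

definition err :: "'a \<Rightarrow> nat \<Rightarrow> real" where
  "err f j = 2 powr (real j * \<alpha>) * norm (f - P j f)"

definition Kseq :: "'a \<Rightarrow> nat \<Rightarrow> real" where
  "Kseq f j = 2 powr (real j * \<alpha>) * K f (pt (real j))"

lemma pt_pos: "0 < pt x"
  by (simp add: pt_def)

lemma pt_mono: "x \<le> y \<Longrightarrow> pt y \<le> pt x"
  by (simp add: pt_def mult_left_mono)

lemma pt_nat: "pt (real j) = (1/2) ^ (r * j)"
  by (simp add: pt_def powr_minus powr_realpow power_one_over flip: of_nat_mult) (simp add: inverse_eq_divide)

lemma pt_zero: "pt 0 = 1"
  by (simp add: pt_def)

lemma pt_powr: "pt x powr (- (\<alpha> / real r)) = 2 powr (x * \<alpha>)"
  using r by (simp add: pt_def powr_powr mult.commute)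

lemma pt_diff: "pt x - pt (x + 1) = (2 ^ r - 1) * pt (x + 1)"
proof -
  have "pt x = 2 powr real r * pt (x + 1)"
    by (simp add: pt_def algebra_simps flip: powr_add)
  then show ?thesis by (simp add: powr_realpow algebra_simps)
qed

lemma pt_cover:
  assumes "0 < t"
  shows "(\<exists>j::nat. t \<in> {pt (real j + 1)<..pt (real j)}) \<or> (\<exists>n::nat. t \<in> {pt (- real n)<..pt (- real n - 1)})"
proof -
  define x where "x = - (log 2 t / r)"
  have "t = 2 powr (log 2 t)" using assms by simp
  then have t: "t = pt x" using r by (simp add: x_def pt_def)
  have lt: "pt v < pt u" if "u < v" for u v using that r by (simp add: pt_def)
  have mem: "t \<in> {pt (of_int \<lfloor>x\<rfloor> + 1)<..pt (of_int \<lfloor>x\<rfloor>)}"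
    unfolding t greaterThanAtMost_iff by (intro conjI lt pt_mono) linarith+
  show ?thesis
  proof (cases "0 \<le> \<lfloor>x\<rfloor>")
    case True
    then have "of_int \<lfloor>x\<rfloor> = real (nat \<lfloor>x\<rfloor>)" by simp
    then show ?thesis using mem by metis
  next
    case False
    then have "of_int \<lfloor>x\<rfloor> = - real (nat (- \<lfloor>x\<rfloor> - 1)) - 1" by (simp add: of_nat_nat)
    then have "t \<in> {pt (- real (nat (- \<lfloor>x\<rfloor> - 1)))<..pt (- real (nat (- \<lfloor>x\<rfloor> - 1)) - 1)}" using mem by simp
    then show ?thesis by blast
  qed
qed

lemma err_nonneg: "0 \<le> err f j"
  by (simp add: err_def)

lemma Kseq_nonneg: "0 \<le> Kseq f j"
  using K_nonneg[of "pt (real j)" f] pt_pos[of "real j"] by (simp add: Kseq_def)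

lemma Kseq_zero: "Kseq f 0 = norm f"
  using norm_le_K_one[of f] K_le_norm[of 1 f] by (simp add: Kseq_def pt_zero)

text \<open>The Jackson inequality bounds the error by every competitor in the \<open>K\<close>-functional.\<close>

lemma err_le_Kseq: "err f j \<le> Kseq f j"
proof -
  have "norm (f - P j f) \<le> K f (pt (real j))"
    by (rule K_ge) (simp add: pt_nat jackson)
  then show ?thesis by (simp add: err_def Kseq_def)
qed

text \<open>The weighted norms \<open>\<rho> ^ j * N (P j f)\<close> of the approximants satisfy the recursion of the
  Hardy inequality, with \<open>\<rho> < 1\<close> because \<open>\<alpha> < r\<close>.\<close>

definition \<rho> :: real where "\<rho> = 2 powr (\<alpha> - real r)"

lemma rho: "0 < \<rho>" "\<rho> < 1"
  using \<alpha> by (simp_all add: \<rho>_def powr_less_one)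

lemma rho_power: "\<rho> ^ j = 2 powr (real j * \<alpha>) * (1/2) ^ (r * j)"
proof -
  have "\<rho> ^ j = 2 powr (real j * (\<alpha> - real r))"
    by (simp add: \<rho>_def powr_powr mult.commute flip: powr_realpow)
  also have "\<dots> = 2 powr (real j * \<alpha>) * pt (real j)"
    by (simp add: pt_def algebra_simps flip: powr_add)
  finally show ?thesis by (simp add: pt_nat)
qed

definition smooth :: "'a \<Rightarrow> nat \<Rightarrow> real" where "smooth f j = \<rho> ^ j * N (P j f)"

definition source :: "'a \<Rightarrow> nat \<Rightarrow> real" where
  "source f j = (case j of 0 \<Rightarrow> C * norm f | Suc i \<Rightarrow> C * err f i)"

lemma smooth_nonneg: "0 \<le> smooth f j"
  using rho N_nonneg[OF P_X] by (simp add: smooth_def)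

lemma source_nonneg: "0 \<le> source f j"
  using C err_nonneg by (simp add: source_def split: nat.split)

lemma smooth_zero: "smooth f 0 \<le> source f 0"
  using bernstein_0 by (simp add: smooth_def source_def)

lemma smooth_Suc: "smooth f (Suc j) \<le> \<rho> * smooth f j + source f (Suc j)"
proof -
  have "(1/2::real) ^ (r * j) * 2 ^ (r * j) = 1" by (simp add: power_mult_distrib[symmetric])
  then have w: "\<rho> ^ j * 2 ^ (r * j) = 2 powr (real j * \<alpha>)" by (simp add: rho_power)
  have "smooth f (Suc j) \<le> \<rho> ^ Suc j * (N (P j f) + C * 2 ^ (r * j) * norm (f - P j f))"
    unfolding smooth_def using rho bernstein_Suc by (intro mult_left_mono) auto
  also have "\<dots> = \<rho> * smooth f j + \<rho> * C * ((\<rho> ^ j * 2 ^ (r * j)) * norm (f - P j f))"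
    by (simp add: smooth_def algebra_simps)
  also have "\<dots> = \<rho> * smooth f j + \<rho> * (C * err f j)"
    unfolding w by (simp add: err_def)
  also have "\<dots> \<le> \<rho> * smooth f j + 1 * (C * err f j)"
    using rho C err_nonneg[of f j] by (intro add_left_mono mult_right_mono) auto
  finally show ?thesis by (simp add: source_def)
qed

text \<open>The competitor is \<open>P j f\<close>.\<close>

lemma Kseq_le: "Kseq f j \<le> err f j + smooth f j"
proof -
  have "K f (pt (real j)) \<le> norm (f - P j f) + (1/2) ^ (r * j) * N (P j f)"
    using K_le[OF _ P_X, of "pt (real j)" f j f] pt_pos[of "real j"] by (simp add: pt_nat)
  then have "Kseq f j \<le> 2 powr (real j * \<alpha>) * (norm (f - P j f) + (1/2) ^ (r * j) * N (P j f))"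
    unfolding Kseq_def by (intro mult_left_mono) auto
  then show ?thesis by (simp add: err_def smooth_def rho_power algebra_simps)
qed

lemma weighted_K_upper:
  assumes "t \<in> {pt (x + 1)<..pt x}"
  shows "t powr (- (\<alpha> / real r)) * K f t \<le> 2 powr ((x + 1) * \<alpha>) * K f (pt x)"
proof (rule mult_mono)
  have t: "0 < t" using assms pt_pos[of "x + 1"] by auto
  show "t powr (- (\<alpha> / real r)) \<le> 2 powr ((x + 1) * \<alpha>)"
    unfolding pt_powr[symmetric] using assms \<alpha> by (intro powr_mono2') (auto simp: pt_pos)
  show "K f t \<le> K f (pt x)" using t assms by (intro K_mono) auto
  show "0 \<le> K f t" using t by (intro K_nonneg) simp
qed simp

lemma weighted_K_lower:
  assumes "t \<in> {pt (x + 1)<..pt x}"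
  shows "2 powr (x * \<alpha>) * K f (pt (x + 1)) \<le> t powr (- (\<alpha> / real r)) * K f t"
proof (rule mult_mono)
  have t: "0 < t" using assms pt_pos[of "x + 1"] by auto
  show "2 powr (x * \<alpha>) \<le> t powr (- (\<alpha> / real r))"
    unfolding pt_powr[symmetric] using assms \<alpha> t by (intro powr_mono2') auto
  show "K f (pt (x + 1)) \<le> K f t" using pt_pos[of "x + 1"] assms by (intro K_mono) auto
  show "0 \<le> K f (pt (x + 1))" using pt_pos[of "x + 1"] by (intro K_nonneg) simp
qed simp


subsection \<open>The case of a supremum\<close>

abbreviation interp_sup :: "'a \<Rightarrow> ennreal" where
  "interp_sup f \<equiv> (SUP t \<in> {0<..}. ennreal (t powr (- (\<alpha> / real r)) * K f t))"

lemma sup_lower: "ennreal (norm f) + (SUP j. ennreal (err f j)) \<le> ennreal 2 * interp_sup f"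
proof -
  have le: "ennreal (Kseq f j) \<le> interp_sup f" for j
    by (rule SUP_upper2[of "pt (real j)"]) (simp_all add: pt_pos pt_powr Kseq_def)
  have "(SUP j. ennreal (err f j)) \<le> interp_sup f"
  proof (rule SUP_least)
    show "ennreal (err f j) \<le> interp_sup f" for j
      by (rule order_trans[OF ennreal_leI[OF err_le_Kseq] le])
  qed
  moreover have "ennreal (norm f) \<le> interp_sup f" using le[of 0] by (simp add: Kseq_zero)
  ultimately have "ennreal (norm f) + (SUP j. ennreal (err f j)) \<le> interp_sup f + interp_sup f"
    by (rule add_mono[rotated])
  then show ?thesis by (simp add: mult_2)
qed

definition Csup :: real where "Csup = 2 powr \<alpha> * (1 + C / (1 - \<rho>))"

lemma Csup: "1 \<le> Csup"
proof -
  have "1 \<le> 2 powr \<alpha>" using \<alpha> by (simp add: ge_one_powr_ge_zero)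
  moreover have "1 \<le> 1 + C / (1 - \<rho>)" using C rho by simp
  ultimately show ?thesis unfolding Csup_def by (metis mult_mono' mult_1 zero_le_one)
qed

lemma sup_upper: "interp_sup f \<le> ennreal Csup * (ennreal (norm f) + (SUP j. ennreal (err f j)))"
proof (cases "(SUP j. ennreal (err f j)) = \<infinity>")
  case True
  have "ennreal Csup * (ennreal (norm f) + \<infinity>) = \<infinity>" using Csup by (simp add: ennreal_mult_top)
  then show ?thesis unfolding True by simp
next
  case False
  then obtain A where A: "(SUP j. ennreal (err f j)) = ennreal A" "0 \<le> A"
    by (cases "SUP j. ennreal (err f j)") auto
  have errA: "err f j \<le> A" for j
  proof -
    have "ennreal (err f j) \<le> ennreal A" unfolding A(1)[symmetric] by (rule SUP_upper) simp
    then show ?thesis using A(2) by simp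
  qed
  have smooth: "smooth f j \<le> C * (norm f + A) / (1 - \<rho>)" for j
  proof (rule recursive_sup_le[OF rho smooth_zero smooth_Suc])
    show "source f j \<le> C * (norm f + A)" for j
      unfolding source_def using C errA A(2) err_nonneg
      by (auto intro!: mult_left_mono add_increasing split: nat.split)
    show "0 \<le> C * (norm f + A)" using C A(2) by simp
  qed
  have Kb: "2 powr \<alpha> * Kseq f j \<le> Csup * (norm f + A)" for j
  proof -
    have "Kseq f j \<le> (norm f + A) + C * (norm f + A) / (1 - \<rho>)"
      using Kseq_le[of f j] smooth[of j] errA[of j] norm_ge_zero[of f] by linarith
    also have "\<dots> = (1 + C / (1 - \<rho>)) * (norm f + A)" by (simp add: algebra_simps)
    finally show ?thesis unfolding Csup_def by (simp add: mult.assoc mult_left_mono)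
  qed
  have "ennreal (t powr (- (\<alpha> / real r)) * K f t) \<le> ennreal (Csup * (norm f + A))" if "t \<in> {0<..}" for t
  proof (rule ennreal_leI)
    from pt_cover[of t] that consider j :: nat where "t \<in> {pt (real j + 1)<..pt (real j)}"
      | n :: nat where "t \<in> {pt (- real n)<..pt (- real n - 1)}" by auto
    then show "t powr (- (\<alpha> / real r)) * K f t \<le> Csup * (norm f + A)"
    proof cases
      case 1
      have "t powr (- (\<alpha> / real r)) * K f t \<le> 2 powr ((real j + 1) * \<alpha>) * K f (pt (real j))"
        by (rule weighted_K_upper[OF 1])
      also have "\<dots> = 2 powr \<alpha> * Kseq f j" by (simp add: Kseq_def algebra_simps powr_add)
      finally show ?thesis using Kb[of j] by simp
    next
      case 2
      have "t powr (- (\<alpha> / real r)) * K f t \<le> 2 powr ((- real n - 1 + 1) * \<alpha>) * K f (pt (- real n - 1))"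
        by (rule weighted_K_upper) (use 2 in simp)
      also have "\<dots> \<le> 1 * norm f"
      proof (rule mult_mono)
        show "2 powr ((- real n - 1 + 1) * \<alpha>) \<le> 1"
          using powr_mono[of "(- real n - 1 + 1) * \<alpha>" 0 2] \<alpha> by (simp add: mult_nonpos_nonneg)
        show "K f (pt (- real n - 1)) \<le> norm f" by (rule K_le_norm) (simp add: pt_pos less_imp_le)
        show "0 \<le> K f (pt (- real n - 1))" by (rule K_nonneg) (simp add: pt_pos less_imp_le)
      qed simp
      also have "\<dots> \<le> Csup * (norm f + A)" using Csup A(2) by (intro mult_mono) auto
      finally show ?thesis .
    qed
  qed
  then have "interp_sup f \<le> ennreal (Csup * (norm f + A))" by (rule SUP_least)
  also have "\<dots> = ennreal Csup * (ennreal (norm f) + ennreal A)"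
    using Csup A(2) by (simp add: ennreal_mult flip: ennreal_plus)
  finally show ?thesis using A(1) by simp
qed


subsection \<open>The case of a finite exponent\<close>

context
  fixes p :: real assumes p: "1 \<le> p"
begin

definition integrand :: "'a \<Rightarrow> real \<Rightarrow> real" where
  "integrand f t = (t powr (- (\<alpha> / real r)) * K f t) powr p / t"

abbreviation interp_int :: "'a \<Rightarrow> ennreal" where
  "interp_int f \<equiv> (\<integral>\<^sup>+ t \<in> {0<..}. ennreal (integrand f t) \<partial>lborel)"

lemma emeasure_pt: "emeasure lborel {pt (x + 1)<..pt x} = ennreal ((2 ^ r - 1) * pt (x + 1))"
  by (simp add: pt_diff pt_mono)

lemma step_value:
  assumes "0 \<le> c"
  shows "ennreal (c / pt (x + 1)) * emeasure lborel {pt (x + 1)<..pt x} = ennreal ((2 ^ r - 1) * c)"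
  unfolding emeasure_pt using assms pt_pos[of "x + 1"] by (simp flip: ennreal_mult)

text \<open>The \<open>K\<close>-functional is monotone in \<open>t\<close> and the power decreasing, which yields step functions
  below and above the integrand on the intervals between consecutive points.\<close>

lemma integral_lower: "ennreal ((1 - (1/2) ^ r) * 2 powr (- \<alpha> * p)) * (\<Sum>j. ennreal (Kseq f j powr p)) \<le> interp_int f"
proof -
  \<comment> \<open>The interval from \<open>pt j\<close> up to \<open>pt (j - 1)\<close>: on it the \<open>K\<close>-functional is at least its value
    at the left end point. The first interval lies to the right of \<open>1\<close>.\<close>
  define A where "A j = {pt (real j - 1 + 1)<..pt (real j - 1)}" for j :: nat
  define c where "c j = (2 powr (- \<alpha>) * Kseq f j) powr p * (1/2) ^ r / pt (real j - 1 + 1)" for j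
  have c0: "0 \<le> c j" for j using pt_pos[of "real j - 1 + 1"] by (simp add: c_def less_imp_le)
  have disj: "i = j" if "t \<in> A i" "t \<in> A j" for i j t
  proof -
    have *: False if "t \<in> A i" "t \<in> A j" "i < j" for i j
    proof -
      have "pt (real j - 1) \<le> pt (real i - 1 + 1)" using that by (intro pt_mono) auto
      then show False using that by (auto simp: A_def)
    qed
    show ?thesis using *[of i j] *[of j i] that by (cases i j rule: linorder_cases) auto
  qed
  have pw: "(\<Sum>j. ennreal (c j) * indicator (A j) t) \<le> ennreal (integrand f t) * indicator {0<..} t" for t
  proof (cases "\<exists>j. t \<in> A j")
    case True
    then obtain j where j: "t \<in> A j" by blast
    then have t: "0 < t" using pt_pos[of "real j - 1 + 1"] by (auto simp: A_def)
    have "(\<Sum>i. ennreal (c i) * indicator (A i) t) = (\<Sum>i\<in>{j}. ennreal (c i) * indicator (A i) t)"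
      using disj[OF _ j] by (intro suminf_finite) (auto simp: indicator_def)
    also have "\<dots> = ennreal (c j)" using j by simp
    also have "\<dots> \<le> ennreal (integrand f t)"
    proof (rule ennreal_leI)
      have "2 powr (- \<alpha>) * Kseq f j = 2 powr ((real j - 1) * \<alpha>) * K f (pt (real j - 1 + 1))"
        by (simp add: Kseq_def algebra_simps powr_diff powr_minus field_simps)
      also have "\<dots> \<le> t powr (- (\<alpha> / real r)) * K f t"
        by (rule weighted_K_lower) (use j in \<open>simp add: A_def\<close>)
      finally have 1: "(2 powr (- \<alpha>) * Kseq f j) powr p \<le> (t powr (- (\<alpha> / real r)) * K f t) powr p"
        using p Kseq_nonneg by (intro powr_mono2) auto
      have "t \<le> pt (real j - 1)" using j by (simp add: A_def)
      also have "\<dots> = 2 ^ r * pt (real j - 1 + 1)" using pt_diff[of "real j - 1"] by (simp add: algebra_simps)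
      finally have "1 / (2 ^ r * pt (real j - 1 + 1)) \<le> 1 / t"
        using t pt_pos[of "real j - 1 + 1"] by (intro divide_left_mono) auto
      from mult_mono[OF 1 this] show "c j \<le> integrand f t"
        using t pt_pos[of "real j - 1 + 1"] by (simp add: c_def integrand_def power_one_over)
    qed
    finally show ?thesis using t by simp
  next
    case False
    then have "(\<lambda>j. ennreal (c j) * indicator (A j) t) = (\<lambda>j. 0)" by (auto simp: fun_eq_iff)
    then show ?thesis by simp
  qed
  have "(\<integral>\<^sup>+ t. (\<Sum>j. ennreal (c j) * indicator (A j) t) \<partial>lborel) = (\<Sum>j. \<integral>\<^sup>+ t. ennreal (c j) * indicator (A j) t \<partial>lborel)"
    by (rule nn_integral_suminf) (simp add: A_def)
  also have "\<dots> = (\<Sum>j. ennreal ((1 - (1/2) ^ r) * 2 powr (- \<alpha> * p)) * ennreal (Kseq f j powr p))"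
  proof (rule suminf_cong)
    fix j
    have "(\<integral>\<^sup>+ t. ennreal (c j) * indicator (A j) t \<partial>lborel)
        = ennreal ((2 powr (- \<alpha>) * Kseq f j) powr p * (1/2) ^ r / pt (real j - 1 + 1))
          * emeasure lborel {pt (real j - 1 + 1)<..pt (real j - 1)}"
      by (subst nn_integral_cmult_indicator) (simp_all add: A_def c_def)
    also have "\<dots> = ennreal ((2 ^ r - 1) * ((2 powr (- \<alpha>) * Kseq f j) powr p * (1/2) ^ r))"
      by (rule step_value) simp
    also have "(2 ^ r - 1) * ((2 powr (- \<alpha>) * Kseq f j) powr p * (1/2) ^ r)
        = (1 - (1/2) ^ r) * 2 powr (- \<alpha> * p) * Kseq f j powr p"
      using Kseq_nonneg by (simp add: powr_mult powr_powr power_one_over field_simps)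
    finally show "(\<integral>\<^sup>+ t. ennreal (c j) * indicator (A j) t \<partial>lborel)
        = ennreal ((1 - (1/2) ^ r) * 2 powr (- \<alpha> * p)) * ennreal (Kseq f j powr p)"
      by (simp add: ennreal_mult power_le_one)
  qed
  also have "\<dots> = ennreal ((1 - (1/2) ^ r) * 2 powr (- \<alpha> * p)) * (\<Sum>j. ennreal (Kseq f j powr p))"
    by (rule ennreal_suminf_cmult)
  finally have "\<dots> = (\<integral>\<^sup>+ t. (\<Sum>j. ennreal (c j) * indicator (A j) t) \<partial>lborel)" ..
  also have "\<dots> \<le> interp_int f" by (rule nn_integral_mono) (rule pw)
  finally show ?thesis .
qed

lemma integral_upper:
  obtains c where "0 < c" "\<And>f. interp_int f \<le> ennreal c * (\<Sum>j. ennreal (Kseq f j powr p))"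
proof -
  define A where "A j = {pt (real j + 1)<..pt (real j)}" for j :: nat
  define B where "B n = {pt (- real n - 1 + 1)<..pt (- real n - 1)}" for n :: nat
  \<comment> \<open>On the intervals \<open>B n\<close>, which cover \<open>t > 1\<close>, the \<open>K\<close>-functional is bounded by the norm and
    the powers of \<open>t\<close> contribute a geometric series with ratio \<open>\<beta>\<close>.\<close>
  define \<beta> where "\<beta> = 2 powr (- \<alpha> * p)"
  have \<beta>: "0 < \<beta>" "\<beta> < 1" using \<alpha> p by (simp_all add: \<beta>_def powr_less_one mult_neg_pos)
  define d where "d = (2 ^ r - 1) * 2 powr (\<alpha> * p)"
  define d' where "d' = (2 ^ r - 1) * (1 / (1 - \<beta>))"
  have r1: "1 < (2::real) ^ r" using r by (simp add: one_less_power)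
  have d: "0 < d" "0 < d'" using r1 \<beta> by (simp_all add: d_def d'_def)
  show thesis
  proof
    show "0 < d + d'" using d by simp
    fix f
    define u where "u j = (2 powr \<alpha> * Kseq f j) powr p / pt (real j + 1)" for j
    define v where "v n = norm f powr p * \<beta> ^ n / pt (- real n - 1 + 1)" for n
    have pw: "ennreal (integrand f t) * indicator {0<..} t
        \<le> (\<Sum>j. ennreal (u j) * indicator (A j) t) + (\<Sum>n. ennreal (v n) * indicator (B n) t)" for t
    proof (cases "0 < t")
      case t: True
      have int_le: "integrand f t \<le> w powr p / pt (x + 1)"
        if "t \<in> {pt (x + 1)<..pt x}" "2 powr ((x + 1) * \<alpha>) * K f (pt x) \<le> w" for x w
        unfolding integrand_def
      proof (rule frac_le)
        show "(t powr (- (\<alpha> / real r)) * K f t) powr p \<le> w powr p"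
          using weighted_K_upper[OF that(1), of f] that(2) p t K_nonneg[of t f] by (intro powr_mono2) auto
      qed (use that pt_pos in auto)
      from pt_cover[OF t] consider j where "t \<in> A j" | n where "t \<in> B n"
        by (auto simp: A_def B_def)
      then show ?thesis
      proof cases
        case 1
        have "integrand f t \<le> u j"
          unfolding u_def by (rule int_le) (use 1 in \<open>simp_all add: A_def Kseq_def algebra_simps powr_add\<close>)
        then have "ennreal (integrand f t) \<le> ennreal (u j) * indicator (A j) t"
          using 1 by (simp add: ennreal_leI)
        also have "\<dots> \<le> (\<Sum>j. ennreal (u j) * indicator (A j) t)"
          by (rule ennreal_le_suminf[where f = "\<lambda>j. ennreal (u j) * indicator (A j) t"])
        finally show ?thesis using t by (simp add: add_increasing2)
      next
        case 2
        have "integrand f t \<le> (2 powr (- real n * \<alpha>) * norm f) powr p / pt (- real n - 1 + 1)"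
        proof (rule int_le)
          show "2 powr ((- real n - 1 + 1) * \<alpha>) * K f (pt (- real n - 1)) \<le> 2 powr (- real n * \<alpha>) * norm f"
            using K_le_norm[of "pt (- real n - 1)" f] pt_pos[of "- real n - 1"] by simp
        qed (use 2 in \<open>simp add: B_def\<close>)
        also have "\<dots> = v n"
          by (simp add: v_def \<beta>_def powr_mult powr_powr mult_ac flip: powr_realpow)
        finally have "ennreal (integrand f t) \<le> ennreal (v n) * indicator (B n) t"
          using 2 by (simp add: ennreal_leI)
        also have "\<dots> \<le> (\<Sum>n. ennreal (v n) * indicator (B n) t)"
          by (rule ennreal_le_suminf[where f = "\<lambda>n. ennreal (v n) * indicator (B n) t"])
        finally show ?thesis using t by (simp add: add_increasing)
      qed
    qed simp
    have "interp_int f \<le> (\<integral>\<^sup>+ t. (\<Sum>j. ennreal (u j) * indicator (A j) t) + (\<Sum>n. ennreal (v n) * indicator (B n) t) \<partial>lborel)"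
      by (rule nn_integral_mono) (rule pw)
    also have "\<dots> = (\<Sum>j. \<integral>\<^sup>+ t. ennreal (u j) * indicator (A j) t \<partial>lborel)
        + (\<Sum>n. \<integral>\<^sup>+ t. ennreal (v n) * indicator (B n) t \<partial>lborel)"
      by (subst nn_integral_add) (simp_all add: A_def B_def nn_integral_suminf)
    also have "(\<Sum>j. \<integral>\<^sup>+ t. ennreal (u j) * indicator (A j) t \<partial>lborel)
        = ennreal d * (\<Sum>j. ennreal (Kseq f j powr p))"
    proof -
      have "(\<integral>\<^sup>+ t. ennreal (u j) * indicator (A j) t \<partial>lborel) = ennreal d * ennreal (Kseq f j powr p)" for j
      proof -
        have "(\<integral>\<^sup>+ t. ennreal (u j) * indicator (A j) t \<partial>lborel) = ennreal (u j) * emeasure lborel (A j)"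
          by (rule nn_integral_cmult_indicator) (simp add: A_def)
        also have "\<dots> = ennreal ((2 ^ r - 1) * (2 powr \<alpha> * Kseq f j) powr p)"
          unfolding u_def A_def by (rule step_value) simp
        also have "(2 ^ r - 1) * (2 powr \<alpha> * Kseq f j) powr p = d * Kseq f j powr p"
          using Kseq_nonneg by (simp add: d_def powr_mult powr_powr)
        finally show ?thesis using d by (simp add: ennreal_mult)
      qed
      then show ?thesis by (simp add: ennreal_suminf_cmult)
    qed
    also have "(\<Sum>n. \<integral>\<^sup>+ t. ennreal (v n) * indicator (B n) t \<partial>lborel) = ennreal d' * ennreal (Kseq f 0 powr p)"
    proof -
      have "(\<integral>\<^sup>+ t. ennreal (v n) * indicator (B n) t \<partial>lborel) = ennreal ((2 ^ r - 1) * (norm f powr p * \<beta> ^ n))" for n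
      proof -
        have "(\<integral>\<^sup>+ t. ennreal (v n) * indicator (B n) t \<partial>lborel) = ennreal (v n) * emeasure lborel (B n)"
          by (rule nn_integral_cmult_indicator) (simp add: B_def)
        also have "\<dots> = ennreal ((2 ^ r - 1) * (norm f powr p * \<beta> ^ n))"
          unfolding v_def B_def using \<beta> by (intro step_value) simp
        finally show ?thesis .
      qed
      moreover have "(\<lambda>n. (2 ^ r - 1) * (norm f powr p * \<beta> ^ n)) sums (d' * norm f powr p)"
        using sums_mult[OF geometric_sums[of \<beta>], of "(2 ^ r - 1) * norm f powr p"] \<beta>
        by (simp add: d'_def mult_ac)
      ultimately show ?thesis
        using r1 \<beta> d by (simp add: suminf_ennreal2 sums_iff Kseq_zero flip: ennreal_mult)
    qed
    finally have "interp_int f \<le> ennreal d * (\<Sum>j. ennreal (Kseq f j powr p))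
        + ennreal d' * ennreal (Kseq f 0 powr p)" .
    also have "\<dots> \<le> ennreal d * (\<Sum>j. ennreal (Kseq f j powr p))
        + ennreal d' * (\<Sum>j. ennreal (Kseq f j powr p))"
      by (intro add_left_mono mult_left_mono ennreal_le_suminf[where f = "\<lambda>j. ennreal (Kseq f j powr p)"]) simp
    also have "\<dots> = ennreal (d + d') * (\<Sum>j. ennreal (Kseq f j powr p))"
      using d by (simp add: distrib_right less_imp_le)
    finally show "interp_int f \<le> ennreal (d + d') * (\<Sum>j. ennreal (Kseq f j powr p))" .
  qed
qed

lemma Kseq_power_sum_le:
  obtains c where "0 < c"
    "\<And>f s. (\<Sum>j. ennreal (err f j powr p)) = ennreal s \<Longrightarrow> 0 \<le> s \<Longrightarrow>
      (\<Sum>j. ennreal (Kseq f j powr p)) \<le> ennreal (c * (norm f powr p + s))"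
proof -
  define h where "h = (1 / (1 - \<rho>)) powr p * C powr p"
  have h: "0 \<le> h" by (simp add: h_def)
  show thesis
  proof
    show "0 < 2 powr p * (1 + h)" using h by simp
    fix f s assume s: "(\<Sum>j. ennreal (err f j powr p)) = ennreal s" "0 \<le> s"
    have part: "(\<Sum>j<n. err f j powr p) \<le> s" for n
    proof -
      have "ennreal (\<Sum>j<n. err f j powr p) = (\<Sum>j<n. ennreal (err f j powr p))" by (simp add: sum_ennreal)
      also have "\<dots> \<le> ennreal s" unfolding s(1)[symmetric] by (rule sum_le_suminf) auto
      finally show ?thesis using s(2) by simp
    qed
    have src: "(\<Sum>j<n. source f j powr p) \<le> C powr p * (norm f powr p + s)" for n
    proof (cases n)
      case (Suc k)
      have "(\<Sum>j<n. source f j powr p) = (C * norm f) powr p + (\<Sum>j<k. (C * err f j) powr p)"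
        unfolding Suc by (subst sum.lessThan_Suc_shift) (simp add: source_def)
      also have "\<dots> = C powr p * (norm f powr p + (\<Sum>j<k. err f j powr p))"
        using C err_nonneg by (simp add: powr_mult sum_distrib_left distrib_left)
      also have "\<dots> \<le> C powr p * (norm f powr p + s)"
        using part[of k] by (intro mult_left_mono add_left_mono) auto
      finally show ?thesis .
    qed (use s(2) in simp)
    have sm: "(\<Sum>j<n. smooth f j powr p) \<le> h * (norm f powr p + s)" for n
    proof -
      have "(\<Sum>j<n. smooth f j powr p) \<le> (1 / (1 - \<rho>)) powr p * (\<Sum>j<n. source f j powr p)"
        by (rule recursive_power_sum_le[OF p rho smooth_nonneg source_nonneg smooth_zero smooth_Suc])
      also have "\<dots> \<le> (1 / (1 - \<rho>)) powr p * (C powr p * (norm f powr p + s))"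
        by (intro mult_left_mono src) simp
      finally show ?thesis by (simp add: h_def mult.assoc)
    qed
    have pw: "Kseq f j powr p \<le> 2 powr p * (err f j powr p + smooth f j powr p)" for j
    proof -
      let ?M = "max (err f j) (smooth f j)"
      have "Kseq f j powr p \<le> (2 * ?M) powr p"
        using Kseq_le[of f j] Kseq_nonneg p by (intro powr_mono2) auto
      also have "\<dots> = 2 powr p * ?M powr p" using err_nonneg[of f j] by (simp add: powr_mult max_def)
      also have "\<dots> \<le> 2 powr p * (err f j powr p + smooth f j powr p)"
        by (intro mult_left_mono) (auto simp: max_def)
      finally show ?thesis .
    qed
    show "(\<Sum>j. ennreal (Kseq f j powr p)) \<le> ennreal (2 powr p * (1 + h) * (norm f powr p + s))"
    proof (rule suminf_le_const)
      fix n
      have "(\<Sum>j<n. Kseq f j powr p) \<le> (\<Sum>j<n. 2 powr p * (err f j powr p + smooth f j powr p))"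
        by (rule sum_mono) (rule pw)
      also have "\<dots> = 2 powr p * ((\<Sum>j<n. err f j powr p) + (\<Sum>j<n. smooth f j powr p))"
        by (simp add: sum_distrib_left sum.distrib distrib_left)
      also have "\<dots> \<le> 2 powr p * ((norm f powr p + s) + h * (norm f powr p + s))"
        using part[of n] sm[of n] by (intro mult_left_mono add_mono) (auto intro: add_increasing)
      finally show "(\<Sum>j<n. ennreal (Kseq f j powr p)) \<le> ennreal (2 powr p * (1 + h) * (norm f powr p + s))"
        by (simp add: sum_ennreal ennreal_leI algebra_simps)
    qed auto
  qed
qed

lemma power_equivalence:
  obtains c D where "0 < c" "0 < D"
    "\<And>f. ennreal c * (ennreal (norm f) + ennreal_root p (\<Sum>j. ennreal (err f j powr p)))
      \<le> ennreal_root p (interp_int f)"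
    "\<And>f. ennreal_root p (interp_int f)
      \<le> ennreal D * (ennreal (norm f) + ennreal_root p (\<Sum>j. ennreal (err f j powr p)))"
proof -
  have p0: "0 < p" using p by simp
  define k where "k = (1 - (1/2) ^ r) * 2 powr (- \<alpha> * p)"
  have k: "0 < k" using r by (simp add: k_def power_less_one_iff)
  define c where "c = 1 / (2 * (1 / k) powr (1 / p))"
  obtain c1 where c1: "0 < c1" "\<And>f. interp_int f \<le> ennreal c1 * (\<Sum>j. ennreal (Kseq f j powr p))"
    using integral_upper by blast
  obtain c2 where c2: "0 < c2" "\<And>f s. (\<Sum>j. ennreal (err f j powr p)) = ennreal s \<Longrightarrow> 0 \<le> s \<Longrightarrow>
      (\<Sum>j. ennreal (Kseq f j powr p)) \<le> ennreal (c2 * (norm f powr p + s))"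
    using Kseq_power_sum_le by blast
  define D where "D = (c1 * (c2 * 2)) powr (1 / p)"
  show thesis
  proof
    show "0 < c" using k by (simp add: c_def)
    show "0 < D" using c1 c2 by (simp add: D_def)
    fix f
    let ?S = "\<Sum>j. ennreal (err f j powr p)"
    show "ennreal c * (ennreal (norm f) + ennreal_root p ?S) \<le> ennreal_root p (interp_int f)"
    proof (cases "interp_int f = \<infinity>")
      case True
      then show ?thesis by (simp add: ennreal_root_def)
    next
      case False
      then obtain i where i: "interp_int f = ennreal i" "0 \<le> i" by (rule ennreal_finiteE)
      have Ksum: "(\<Sum>j. ennreal (Kseq f j powr p)) \<le> ennreal (i / k)"
      proof -
        have "ennreal k * (\<Sum>j. ennreal (Kseq f j powr p)) \<le> ennreal k * ennreal (i / k)"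
          using integral_lower[of f] i k by (simp add: k_def flip: ennreal_mult)
        then show ?thesis using k by (simp add: ennreal_mult_le_mult_iff)
      qed
      have "?S \<le> (\<Sum>j. ennreal (Kseq f j powr p))"
        by (intro suminf_le ennreal_leI powr_mono2 err_le_Kseq err_nonneg) (use p in auto)
      then have 1: "ennreal_root p ?S \<le> ennreal ((i / k) powr (1 / p))"
        using Ksum i k p0 by (intro ennreal_root_le) auto
      have "ennreal (Kseq f 0 powr p) \<le> ennreal (i / k)"
        by (rule order_trans[OF ennreal_le_suminf[where f = "\<lambda>j. ennreal (Kseq f j powr p)"] Ksum])
      then have "norm f powr p \<le> i / k" using i k by (simp add: Kseq_zero)
      then have "(norm f powr p) powr (1 / p) \<le> (i / k) powr (1 / p)" using p0 by (intro powr_mono2) auto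
      then have "norm f \<le> (i / k) powr (1 / p)" using p0 by (simp add: powr_powr)
      then have "ennreal (norm f) + ennreal_root p ?S \<le> ennreal ((i / k) powr (1 / p)) + ennreal ((i / k) powr (1 / p))"
        using 1 by (intro add_mono ennreal_leI)
      also have "\<dots> = ennreal (2 * (i / k) powr (1 / p))" by (simp flip: ennreal_plus)
      finally have "ennreal c * (ennreal (norm f) + ennreal_root p ?S) \<le> ennreal c * ennreal (2 * (i / k) powr (1 / p))"
        by (rule mult_left_mono) simp
      also have "\<dots> = ennreal (c * (2 * (i / k) powr (1 / p)))" 
        using k by (intro ennreal_mult[symmetric]) (simp_all add: c_def)
      also have "c * (2 * (i / k) powr (1 / p)) = i powr (1 / p)"
        using i k by (simp add: c_def powr_divide)
      finally show ?thesis using i by (simp add: ennreal_root_ennreal)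
    qed
    show "ennreal_root p (interp_int f) \<le> ennreal D * (ennreal (norm f) + ennreal_root p ?S)"
    proof (cases "?S = \<infinity>")
      case True
      then show ?thesis using c1 c2 by (simp add: ennreal_root_def D_def ennreal_mult_top)
    next
      case False
      then obtain s where s: "?S = ennreal s" "0 \<le> s" by (rule ennreal_finiteE)
      define m where "m = norm f + s powr (1 / p)"
      have "norm f powr p \<le> m powr p" using p0 by (intro powr_mono2) (auto simp: m_def)
      moreover have "(s powr (1 / p)) powr p \<le> m powr p" using p0 by (intro powr_mono2) (auto simp: m_def)
      ultimately have ms: "norm f powr p + s \<le> 2 * m powr p" using p0 s(2) by (simp add: powr_powr)
      have "interp_int f \<le> ennreal c1 * ennreal (c2 * (norm f powr p + s))"
        using c1(2)[of f] c2(2)[OF s] by (meson mult_left_mono order_trans zero_le)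
      also have "\<dots> = ennreal (c1 * (c2 * (norm f powr p + s)))"
        using c1(1) c2(1) s(2) by (simp add: ennreal_mult)
      also have "\<dots> \<le> ennreal (c1 * (c2 * (2 * m powr p)))"
        using c1(1) c2(1) ms by (intro ennreal_leI mult_left_mono) auto
      finally have "ennreal_root p (interp_int f) \<le> ennreal ((c1 * (c2 * (2 * m powr p))) powr (1 / p))"
        using c1(1) c2(1) p0 by (intro ennreal_root_le) auto
      also have "(c1 * (c2 * (2 * m powr p))) powr (1 / p) = D * m"
      proof -
        have "m \<ge> 0" by (simp add: m_def)
        then have "(m powr p) powr (1 / p) = m" using p0 by (simp add: powr_powr)
        then show ?thesis using c1(1) c2(1) by (simp add: D_def powr_mult)
      qed
      also have "ennreal (D * m) = ennreal D * (ennreal (norm f) + ennreal_root p ?S)"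
        using s by (simp add: m_def D_def ennreal_root_ennreal ennreal_mult flip: ennreal_plus)
      finally show ?thesis .
    qed
  qed
qed

end

theorem interpolation_norm_equivalence:
  assumes q: "1 \<le> (q::ennreal)"
  obtains c D where "0 < c" "0 < D"
    "\<And>f. ennreal c * (ennreal (norm f) + (if q = \<infinity> then (SUP j. ennreal (err f j))
        else ennreal_root (enn2real q) (\<Sum>j. ennreal (err f j powr enn2real q))))
      \<le> interpolation_norm X N (\<alpha> / real r) q f"
    "\<And>f. interpolation_norm X N (\<alpha> / real r) q f \<le> ennreal D * (ennreal (norm f) +
        (if q = \<infinity> then (SUP j. ennreal (err f j))
        else ennreal_root (enn2real q) (\<Sum>j. ennreal (err f j powr enn2real q))))"
proof (cases "q = \<infinity>")
  case True
  have "ennreal (1/2) * (ennreal (norm f) + (SUP j. ennreal (err f j))) \<le> interp_sup f" for f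
  proof -
    have "ennreal (1/2) * (ennreal (norm f) + (SUP j. ennreal (err f j))) \<le> ennreal (1/2) * (ennreal 2 * interp_sup f)"
      by (rule mult_left_mono[OF sup_lower]) simp
    also have "\<dots> = ennreal (1/2 * 2) * interp_sup f"
      by (subst ennreal_mult) (simp_all add: mult.assoc)
    finally show ?thesis by simp
  qed
  then show thesis
    using that[of "1/2" Csup] sup_upper Csup True by (simp add: interpolation_norm_def)
next
  case False
  have "1 \<le> enn2real q"
    using q False by (cases q) auto
  from power_equivalence[OF this] obtain c D where *: "0 < c" "0 < D"
    "\<And>f. ennreal c * (ennreal (norm f) + ennreal_root (enn2real q) (\<Sum>j. ennreal (err f j powr enn2real q)))
      \<le> ennreal_root (enn2real q) (interp_int (enn2real q) f)"
    "\<And>f. ennreal_root (enn2real q) (interp_int (enn2real q) f)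
      \<le> ennreal D * (ennreal (norm f) + ennreal_root (enn2real q) (\<Sum>j. ennreal (err f j powr enn2real q)))"
    by blast
  have norm_eq: "interpolation_norm X N (\<alpha> / real r) q f = ennreal_root (enn2real q) (interp_int (enn2real q) f)" for f
    unfolding interpolation_norm_def if_not_P[OF False] integrand_def[OF \<open>1 \<le> enn2real q\<close>] ..
  show thesis
    by (rule that[OF *(1,2)]; unfold norm_eq if_not_P[OF False]; rule *(3,4))
qed

end

end


section \<open>Jackson and Bernstein inequalities for the spectral projections\<close>

locale positive_spectral = pvm E for E :: "real set \<Rightarrow> 'a::chilbert_space \<Rightarrow> 'a" +
  fixes r :: nat
  assumes nonneg: supported_nonneg and r_pos: "0 < r"
begin

definition weight :: "real \<Rightarrow> real" where "weight x = (1 + x) powr (real r / 2)"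

lemma weight_borel: "weight \<in> borel_measurable borel"
  unfolding weight_def[abs_def] by measurable

definition sob :: "'a oper" where "sob = spectral_integral E weight"

definition Nrm :: "'a \<Rightarrow> real" where "Nrm f = norm f + norm (oper_apply sob f)"

definition proj :: "nat \<Rightarrow> 'a \<Rightarrow> 'a" where "proj j = E {0..4 ^ j}"

lemma linear_sob: "linear_oper sob"
  unfolding sob_def by (rule linear_spectral_integral[OF weight_borel])

lemma oper_apply_sob: "(f, g) \<in> sob \<Longrightarrow> oper_apply sob f = g"
  unfolding oper_apply_def by (intro the_equality) (auto intro: linear_operD(4)[OF linear_sob])

lemma Nrm_add:
  assumes "f \<in> Domain sob" "g \<in> Domain sob"
  shows "Nrm (f + g) \<le> Nrm f + Nrm g"
proof -
  obtain u v where uv: "(f, u) \<in> sob" "(g, v) \<in> sob" using assms by auto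
  have "oper_apply sob (f + g) = u + v" by (rule oper_apply_sob[OF linear_operD(1)[OF linear_sob uv]])
  then show ?thesis
    using norm_triangle_ineq[of f g] norm_triangle_ineq[of u v]
    by (simp add: Nrm_def oper_apply_sob[OF uv(1)] oper_apply_sob[OF uv(2)])
qed

lemma weight_sq: "0 \<le> x \<Longrightarrow> (weight x)\<^sup>2 = (1 + x) ^ r"
  by (simp add: weight_def power2_eq_square powr_realpow flip: powr_add)

lemma proj_residual_le: "norm (f - proj j f) \<le> norm f"
proof (rule power2_le_imp_le)
  have "(norm (f - proj j f))\<^sup>2 = (norm f)\<^sup>2 - (norm (proj j f))\<^sup>2"
    using inner_E_self[of "{0..4 ^ j}" f]
    by (simp add: proj_def power2_norm_eq_inner inner_diff_left inner_diff_right inner_commute)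
  then show "(norm (f - proj j f))\<^sup>2 \<le> (norm f)\<^sup>2" by simp
qed simp

text \<open>Off \<open>[0, 4 ^ j]\<close> the weight is at least \<open>2 ^ (r j)\<close>.\<close>

lemma jackson_smooth:
  assumes fg: "(f, g) \<in> sob"
  shows "norm (f - proj j f) \<le> (1/2) ^ (r * j) * norm g"
proof (rule power2_le_imp_le)
  let ?A = "{0..4 ^ j} :: real set"
  have f: "integrable (\<mu> f) (\<lambda>x. (weight x)\<^sup>2)"
    using fg by (simp add: sob_def spectral_integral_def flip: in_spectral_domain_iff[OF weight_borel])
  have w: "1 - indicat_real ?A x \<le> (1/4) ^ (r * j) * (weight x)\<^sup>2" if "0 \<le> x" for x
  proof (cases "x \<le> 4 ^ j")
    case False
    have "(4 ^ j) ^ r \<le> (1 + x) ^ r" using False by (intro power_mono) auto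
    then have "(1/4) ^ (r * j) * (4 ^ j) ^ r \<le> (1/4) ^ (r * j) * (weight x)\<^sup>2"
      using that by (intro mult_left_mono) (simp_all add: weight_sq)
    moreover have "(1/4 :: real) ^ (r * j) * (4 ^ j) ^ r = 1"
      by (simp add: power_one_over mult.commute flip: power_mult)
    ultimately show ?thesis using False by simp
  qed (use that in simp)
  have "(norm (f - proj j f))\<^sup>2 = inner f f - inner (E ?A f) f"
    using inner_E_self[of ?A f]
    by (simp add: proj_def power2_norm_eq_inner inner_diff_left inner_diff_right inner_commute)
  also have "\<dots> = (\<integral>x. 1 - indicat_real ?A x \<partial>\<mu> f)"
    using integrable_bounded[OF bounded_borel_indicator[of ?A]] integrable_bounded[OF bounded_borel_const]
    by (simp add: measure_scalar space_mu mass_mu power2_norm_eq_inner)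
  also have "\<dots> \<le> (\<integral>x. (1/4) ^ (r * j) * (weight x)\<^sup>2 \<partial>\<mu> f)"
  proof (rule integral_mono_AE)
    show "integrable (\<mu> f) (\<lambda>x. 1 - indicat_real ?A x)"
      by (intro Bochner_Integration.integrable_diff integrable_bounded bounded_borel_const bounded_borel_indicator) simp
    show "AE x in \<mu> f. 1 - indicat_real ?A x \<le> (1/4) ^ (r * j) * (weight x)\<^sup>2"
      using nonneg[unfolded supported_nonneg_iff_AE, rule_format, of f] by eventually_elim (rule w)
  qed (use f in simp)
  also have "\<dots> = (1/4) ^ (r * j) * (norm g)\<^sup>2"
    using norm_spectral_integral[OF weight_borel] fg by (simp add: sob_def)
  also have "(1/4 :: real) ^ (r * j) = ((1/2) ^ (r * j))\<^sup>2"
    by (simp add: power2_eq_square flip: power_mult_distrib)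
  finally show "(norm (f - proj j f))\<^sup>2 \<le> ((1/2) ^ (r * j) * norm g)\<^sup>2"
    by (simp add: power_mult_distrib)
qed simp

text \<open>On \<open>[0, 4 ^ j]\<close> the weight is at most \<open>2 ^ (r (j + 1))\<close>.\<close>

lemma bernstein_proj: "proj j f \<in> Domain sob" "Nrm (proj j f) \<le> 2 * 2 ^ (r * Suc j) * norm (proj j f)"
proof -
  let ?A = "{0..4 ^ j} :: real set"
  let ?w = "\<lambda>x. indicat_real ?A x * weight x"
  have bd: "\<bar>?w x\<bar> \<le> 2 ^ (r * Suc j)" for x
  proof (cases "x \<in> ?A")
    case True
    have le: "1 + x \<le> 4 ^ Suc j"
    proof -
      have "(1::real) \<le> 4 ^ j" by simp
      moreover have "x \<le> 4 ^ j" using True by simp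
      ultimately show ?thesis unfolding power_Suc by linarith
    qed
    have "(weight x)\<^sup>2 = (1 + x) ^ r" using True by (intro weight_sq) simp
    also have "\<dots> \<le> (4 ^ Suc j) ^ r" using True by (intro power_mono le) simp
    also have "\<dots> = (2 ^ (r * Suc j))\<^sup>2"
    proof -
      have "(4::real) = 2\<^sup>2" by simp
      then show ?thesis by (simp only: power_mult[symmetric] mult_ac)
    qed
    finally have "weight x \<le> 2 ^ (r * Suc j)" by (rule power2_le_imp_le) simp
    then show ?thesis using True by (simp add: weight_def)
  qed simp
  have bb: "bounded_borel ?w"
    by (rule bounded_borelI[OF _ bd]) (use weight_borel in measurable)
  have A: "?A \<in> sets borel" by simp
  have "(E ?A (E ?A f), calc ?w (E ?A f)) \<in> sob"
    unfolding sob_def by (rule spectral_integral_on_bounded[OF weight_borel A bb])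
  then have *: "(proj j f, calc ?w (proj j f)) \<in> sob" by (simp add: proj_def E_idem)
  then show "proj j f \<in> Domain sob" by blast
  have "norm (calc ?w (proj j f)) \<le> 2 ^ (r * Suc j) * norm (proj j f)"
    by (rule norm_calc_le[OF bb bd])
  moreover have "1 * norm (proj j f) \<le> 2 ^ (r * Suc j) * norm (proj j f)"
    by (intro mult_right_mono) simp_all
  ultimately show "Nrm (proj j f) \<le> 2 * 2 ^ (r * Suc j) * norm (proj j f)"
    by (simp add: Nrm_def oper_apply_sob[OF *])
qed

lemma proj_increment: "proj (Suc j) f = proj j f + proj (Suc j) (f - proj j f)"
proof -
  have "{0..4 ^ Suc j} \<inter> {0..4 ^ j} = ({0..4 ^ j} :: real set)" by auto
  then have "proj (Suc j) (proj j f) = proj j f"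
    using E_Int[of "{0..4 ^ Suc j}" "{0..4 ^ j}" f] by (simp add: proj_def)
  then show ?thesis
    using linear_diff[OF E_linear, of "{0..4 ^ Suc j}" f "proj j f"] by (simp add: proj_def)
qed

lemma jackson_bernstein_spectral:
  "jackson_bernstein (Domain sob) Nrm proj r (2 * 2 ^ (r * 2))"
proof
  show "0 < r" by (rule r_pos)
  show "1 \<le> (2::real) * 2 ^ (r * 2)"
    using one_le_power[of "2::real" "r * 2"] by linarith
  have z: "(0, 0) \<in> sob" by (rule linear_operD(5)[OF linear_sob])
  then show "0 \<in> Domain sob" by blast
  show "Nrm 0 = 0" by (simp add: Nrm_def oper_apply_sob[OF z])
  show "norm f \<le> Nrm f" for f by (simp add: Nrm_def)
  show "proj j f \<in> Domain sob" for j f by (rule bernstein_proj)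
  show "norm (f - proj j f) \<le> norm (f - g) + (1/2) ^ (r * j) * Nrm g" if g: "g \<in> Domain sob" for f g j
  proof -
    obtain v where v: "(g, v) \<in> sob" using g by blast
    have "f - proj j f = ((f - g) - proj j (f - g)) + (g - proj j g)"
      using linear_diff[OF E_linear, of "{0..4 ^ j}" f g] by (simp add: proj_def)
    then have "norm (f - proj j f) \<le> norm ((f - g) - proj j (f - g)) + norm (g - proj j g)"
      by (metis norm_triangle_ineq)
    also have "\<dots> \<le> norm (f - g) + (1/2) ^ (r * j) * norm v"
      by (intro add_mono proj_residual_le jackson_smooth v)
    also have "\<dots> \<le> norm (f - g) + (1/2) ^ (r * j) * Nrm g"
      by (intro add_left_mono mult_left_mono) (simp_all add: Nrm_def oper_apply_sob[OF v])
    finally show ?thesis .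
  qed
  have C: "2 * 2 ^ (r * Suc (Suc j)) = 2 * 2 ^ (r * 2) * (2::real) ^ (r * j)" for j
    by (simp add: power_add[symmetric] algebra_simps)
  show "Nrm (proj 0 f) \<le> 2 * 2 ^ (r * 2) * norm f" for f
  proof -
    have "Nrm (proj 0 f) \<le> 2 * 2 ^ (r * Suc 0) * norm (proj 0 f)" by (rule bernstein_proj)
    also have "\<dots> \<le> 2 * 2 ^ (r * 2) * norm f"
      by (intro mult_mono power_increasing) (simp_all add: proj_def norm_E_le)
    finally show ?thesis .
  qed
  show "Nrm (proj (Suc j) f) \<le> Nrm (proj j f) + 2 * 2 ^ (r * 2) * 2 ^ (r * j) * norm (f - proj j f)" for j f
  proof -
    have "Nrm (proj (Suc j) f) \<le> Nrm (proj j f) + Nrm (proj (Suc j) (f - proj j f))"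
      by (subst proj_increment) (intro Nrm_add bernstein_proj)
    also have "Nrm (proj (Suc j) (f - proj j f)) \<le> 2 * 2 ^ (r * Suc (Suc j)) * norm (proj (Suc j) (f - proj j f))"
      by (rule bernstein_proj)
    also have "\<dots> \<le> 2 * 2 ^ (r * Suc (Suc j)) * norm (f - proj j f)"
      by (intro mult_left_mono) (simp_all add: proj_def norm_E_le)
    finally show ?thesis unfolding C by simp
  qed
qed

end

text \<open>The residual \<open>f - P f\<close> of the orthogonal projection \<open>P\<close> is orthogonal to its range, hence
  \<open>P f\<close> attains the infimum.\<close>

lemma best_approx_sqrt:
  fixes L :: "'a::chilbert_space oper"
  assumes L: "self_adjoint L" "positive_oper L" and \<omega>: "0 \<le> \<omega>"
  shows "best_approx (sqrt_oper L) f \<omega> = norm (f - spectral_measure L {0..\<omega>\<^sup>2} f)"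
proof -
  interpret pvm "spectral_measure L" by (rule pvm_spectral_measure[OF L])
  let ?P = "spectral_measure L {0..\<omega>\<^sup>2}"
  have A: "{0..\<omega>\<^sup>2} \<in> sets borel" by simp
  have "norm (f - ?P f) \<le> norm (f - ?P g)" for g
  proof (rule power2_le_imp_le)
    have "inner (f - ?P f) (?P (f - g)) = 0"
      using E_sym[OF A, of "f - ?P f" "f - g"] by (simp add: linear_diff[OF E_linear] E_idem)
    then have "(norm ((f - ?P f) + ?P (f - g)))\<^sup>2 = (norm (f - ?P f))\<^sup>2 + (norm (?P (f - g)))\<^sup>2"
      by (intro norm_add_Pythagorean) (simp add: orthogonal_def)
    moreover have "(f - ?P f) + ?P (f - g) = f - ?P g" by (simp add: linear_diff[OF E_linear])
    ultimately have "(norm (f - ?P g))\<^sup>2 = (norm (f - ?P f))\<^sup>2 + (norm (?P (f - g)))\<^sup>2" by metis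
    then show "(norm (f - ?P f))\<^sup>2 \<le> (norm (f - ?P g))\<^sup>2" by simp
  qed simp
  then show ?thesis
    unfolding best_approx_def paley_wiener_sqrt[OF L \<omega>] image_image
    by (intro antisym cINF_greatest cINF_lower) (auto intro: bdd_belowI[of _ 0])
qed

theorem theorem3p17:
  fixes L :: "'a::chilbert_space oper" and \<alpha> :: real and q :: ennreal and r :: nat
  assumes "self_adjoint L" and "positive_oper L"
    and "0 < \<alpha>" and "1 \<le> q" and "\<alpha> < real r"
  shows "\<exists>c C. 0 < c \<and> 0 < C \<and>
    (\<forall>f. ennreal c * approximation_norm L \<alpha> q f \<le> besov_norm L r \<alpha> q f \<and>
         besov_norm L r \<alpha> q f \<le> ennreal C * approximation_norm L \<alpha> q f)"
proof -
  note L = assms(1,2)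
  interpret positive_spectral "spectral_measure L" r
    using pvm_spectral_measure[OF L] supported_spectral_measure[OF L] assms(3,5)
    by (simp add: positive_spectral_def positive_spectral_axioms_def)
  interpret J: jackson_bernstein "Domain sob" Nrm proj r "2 * 2 ^ (r * 2)"
    by (rule jackson_bernstein_spectral)
  have sob: "sobolev_oper L r = sob"
    by (simp add: sobolev_oper_def oper_fun_def sob_def weight_def[abs_def])
  have "best_approx (sqrt_oper L) f (2 ^ j) = norm (f - proj j f)" for f j
  proof -
    have "((2::real) ^ j)\<^sup>2 = 4 ^ j" by (simp add: power2_eq_square flip: power_mult_distrib)
    then show ?thesis using best_approx_sqrt[OF L, of "2 ^ j" f] by (simp add: proj_def)
  qed
  then have approx: "approximation_norm L \<alpha> q f = ennreal (norm f) +
      (if q = \<infinity> then (SUP j. ennreal (J.err \<alpha> f j))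
       else ennreal_root (enn2real q) (\<Sum>j. ennreal (J.err \<alpha> f j powr enn2real q)))" for f
    by (simp only: approximation_norm_def J.err_def[OF assms(3,5)])
  have besov: "besov_norm L r \<alpha> q f = interpolation_norm (Domain sob) Nrm (\<alpha> / real r) q f" for f
    by (simp add: besov_norm_def sob sobolev_norm_def[abs_def] Nrm_def[abs_def])
  obtain c C where "0 < c" "0 < C"
    "\<And>f. ennreal c * approximation_norm L \<alpha> q f \<le> besov_norm L r \<alpha> q f"
    "\<And>f. besov_norm L r \<alpha> q f \<le> ennreal C * approximation_norm L \<alpha> q f"
    unfolding approx besov using J.interpolation_norm_equivalence[OF assms(3,5,4)] by blast
  then show ?thesis by blast
qed

end
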